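(* Let $p,q,\alpha,\beta$ be positive real numbers with $1<q<p<\alpha+\beta$, and let $a,b,h\in L^1(\mathcal S,\mu)$ be functions $\mathcal S\to\mathbb R$ with $a,b,h\ge 0$, $a,b,h\not\equiv 0$ and $\|h\|_1>0$. Then there exists $\kappa_0>0$ such that for all real $\lambda,\gamma$ satisfying $|\lambda|\,\|a\|_1+|\gamma|\,\|b\|_1<\kappa_0$, the boundary value problem $$-\Delta_p u=\lambda a(x)|u|^{q-2}u+\tfrac{\alpha}{\alpha+\beta}h(x)|u|^{\alpha-2}u|v|^{\beta}\ \text{ in }\mathcal S\setminus\mathcal S_0,$$ $$-\Delta_p v=\gamma b(x)|v|^{q-2}v+\tfrac{\beta}{\alpha+\beta}h(x)|u|^{\alpha}|v|^{\beta-2}v\ \text{ in }\mathcal S\setminus\mathcal S_0,$$ $$u=v=0\ \text{ on }\mathcal S_0$$ has at least two nontrivial weak solutions, i.e. at least two distinct weak solutions $(u,v)\ne(0,0)$.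
   Context: Gasket. Let $q_1,q_2,q_3\in\mathbb R^2$ be three points equidistant from each other, $\mathcal S_0=\{q_1,q_2,q_3\}$, $F_i(x)=\frac12(x-q_i)+q_i$, and $F(A)=\bigcup_{i=1}^3F_i(A)$. The Sierpiński gasket $\mathcal S$ is the unique nonempty compact set with $F(\mathcal S)=\mathcal S$; $\mathcal S_0$ is its boundary. $\mu$ is the $\frac{\ln 3}{\ln 2}$-dimensional Hausdorff measure on $\mathcal S$ (finite and positive), and $\|f\|_1=\int_{\mathcal S}|f|\,d\mu$. For a word $\omega=\omega_1\cdots\omega_m\in\{1,2,3\}^m$, $|\omega|=m$, $F_\omega=F_{\omega_1}\circ\cdots\circ F_{\omega_m}$. $p$-energy. For $p>1$ fix a function $A_p:\mathbb R^3\to[0,\infty)$ that is convex, homogeneous of degree $p$, invariant under addition of constants and under permutation of its arguments, has the Markov property (it does not increase when its arguments are truncated to an interval), and is zero only on constant triples. It is determined by an even function $g$ on $[-1,1]$, $g(x)=A_p(-1,x,1)$, via $A_p(a_1,a_2,a_3)=\left|\frac{a_3-a_1}{2}\right|^pg\left(\frac{2a_2-a_1-a_3}{a_3-a_1}\right)$ for $a_1\le a_2\le a_3$, $a_1\ne a_3$. $A_p$ is chosen so that it renormalizes with factor $r_p\in(0,1)$ (depending only on $p$): $\min_{b_1,b_2,b_3\in\mathbb R}\left[A_p(a_1,b_3,b_2)+A_p(b_3,a_2,b_1)+A_p(b_2,b_1,a_3)\right]=r_pA_p(a_1,a_2,a_3)$ for all $a_1,a_2,a_3$. Put $\mathcal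 E_p^{(m)}(u)=r_p^{-m}\sum_{|\omega|=m}A_p(u(F_\omega q_1),u(F_\omega q_2),u(F_\omega q_3))$, which is nondecreasing in $m$, and $\mathcal E_p(u)=\lim_{m\to\infty}\mathcal E_p^{(m)}(u)\in[0,\infty]$. $\mathrm{dom}(\mathcal E_p)$ is the space of continuous $u:\mathcal S\to\mathbb R$ with $\mathcal E_p(u)<\infty$, and $\mathrm{dom}_0(\mathcal E_p)$ is the subspace of those vanishing on $\mathcal S_0$. Energy form. For $u,v\in\mathrm{dom}(\mathcal E_p)$ let $\mathcal E_p^{+}(u,v)$ and $\mathcal E_p^{-}(u,v)$ be $\frac1p$ times the right, respectively left, derivative of the convex function $t\mapsto\mathcal E_p(u+tv)$ at $t=0$, and let $\mathcal E_p(u,v)$ be the compact interval $[\mathcal E_p^-(u,v),\mathcal E_p^+(u,v)]$. Sums of intervals are Minkowski sums. Weak solution. $(u,v)\in\mathrm{dom}_0(\mathcal E_p)\times\mathrm{dom}_0(\mathcal E_p)$ is a weak solution of the problem if for all $(\phi_1,\phi_2)\in\mathrm{dom}_0(\mathcal E_p)\times\mathrm{dom}_0(\mathcal E_p)$, $$\int_{\mathcal S}\lambda a|u|^{q-2}u\phi_1\,d\mu+\tfrac{\alpha}{\alpha+\beta}\int_{\mathcal S}h|u|^{\alpha-2}u|v|^{\beta}\phi_1\,d\mu+\int_{\mathcal S}\gamma b|v|^{q-2}v\phi_2\,d\mu+\tfrac{\beta}{\alpha+\beta}\int_{\mathcal S}h|u|^{\alpha}|v|^{\beta-2}v\phi_2\,d\mu\in\mathcal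 E_p(u,\phi_1)+\mathcal E_p(v,\phi_2).$$ *)

theory Defs
  imports "HOL-Analysis.Analysis" "HOL-Library.Set_Algebras"
begin

section \<open>The gasket\<close>

text \<open>
  The three vertices are a family \<open>Q\<close> indexed by the three-element type \<open>3\<close>, whose elements are
  \<open>1, 2, 3\<close> (with \<open>3 = 0\<close>); the components of vectors in \<open>real ^ 3\<close> carry the same indices.
\<close>

definition equidistant :: "(3 \<Rightarrow> real ^ 2) \<Rightarrow> bool" where
  "equidistant Q \<longleftrightarrow> (\<exists>d>0. \<forall>i j. i \<noteq> j \<longrightarrow> dist (Q i) (Q j) = d)"

definition gasket_map :: "(3 \<Rightarrow> real ^ 2) \<Rightarrow> 3 \<Rightarrow> real ^ 2 \<Rightarrow> real ^ 2" where
  "gasket_map Q i x = (1 / 2) *\<^sub>R (x - Q i) + Q i"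

definition gasket_boundary :: "(3 \<Rightarrow> real ^ 2) \<Rightarrow> (real ^ 2) set" where
  "gasket_boundary Q = range Q"

definition gasket :: "(3 \<Rightarrow> real ^ 2) \<Rightarrow> (real ^ 2) set" where
  "gasket Q = (THE K. K \<noteq> {} \<and> compact K \<and> (\<Union>i. gasket_map Q i ` K) = K)"

text \<open>The leftmost letter of a word is the outermost map.\<close>

definition word_map :: "(3 \<Rightarrow> real ^ 2) \<Rightarrow> 3 list \<Rightarrow> real ^ 2 \<Rightarrow> real ^ 2" where
  "word_map Q \<omega> = foldr (gasket_map Q) \<omega>"

section \<open>Hausdorff measure\<close>

text \<open>
  No normalising constant is included. The requirement \<^term>\<open>bounded (C i)\<close> is needed because
  \<^const>\<open>diameter\<close> is a real number and says nothing about unbounded sets. Since \<open>0 powr s = 0\<close>, the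
  empty set and singletons contribute \<open>0\<close>; this is the right convention for \<open>s > 0\<close>, the only case
  considered.
\<close>

definition hausdorff_content ::
  "real \<Rightarrow> real \<Rightarrow> 'a :: metric_space set \<Rightarrow> ennreal" where
  "hausdorff_content s \<delta> X =
     (INF C \<in> {C :: nat \<Rightarrow> 'a set. X \<subseteq> (\<Union>i. C i) \<and> (\<forall>i. bounded (C i) \<and> diameter (C i) \<le> \<delta>)}.
        \<Sum>i. ennreal (diameter (C i) powr s))"

definition hausdorff_outer :: "real \<Rightarrow> 'a :: metric_space set \<Rightarrow> ennreal" where
  "hausdorff_outer s X = (SUP \<delta> \<in> {0<..}. hausdorff_content s \<delta> X)"

text \<open>The restriction of the outer measure to its Caratheodory-measurable sets.\<close>

definition hausdorff_measure :: "real \<Rightarrow> 'a :: metric_space measure" where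
  "hausdorff_measure s =
     measure_of UNIV (lambda_system UNIV UNIV (hausdorff_outer s)) (hausdorff_outer s)"

definition gasket_measure :: "(3 \<Rightarrow> real ^ 2) \<Rightarrow> (real ^ 2) measure" where
  "gasket_measure Q = restrict_space (hausdorff_measure (ln 3 / ln 2)) (gasket Q)"

section \<open>The p-energy\<close>

text \<open>
  Homogeneity is meant for all real factors \<open>t\<close>, with \<open>\<bar>t\<bar>\<close> on the right-hand side. It contains the
  evenness of \<open>g(x) = A(-1, x, 1)\<close>; see \<open>p_form_g_even\<close> and \<open>p_form_eq_g\<close> below.
\<close>

definition p_form :: "real \<Rightarrow> (real ^ 3 \<Rightarrow> real) \<Rightarrow> bool" where
  "p_form p A \<longleftrightarrow>
     (\<forall>a. A a \<ge> 0) \<and>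
     convex_on UNIV A \<and>
     (\<forall>t a. A (t *\<^sub>R a) = \<bar>t\<bar> powr p * A a) \<and>
     (\<forall>c a. A (\<chi> i. a $ i + c) = A a) \<and>
     (\<forall>\<sigma> a. bij \<sigma> \<longrightarrow> A (\<chi> i. a $ \<sigma> i) = A a) \<and>
     (\<forall>l m a. l \<le> m \<longrightarrow> A (\<chi> i. max l (min m (a $ i))) \<le> A a) \<and>
     (\<forall>a. A a = 0 \<longleftrightarrow> (\<exists>c. \<forall>i. a $ i = c))"

definition subdivided_form :: "(real ^ 3 \<Rightarrow> real) \<Rightarrow> real ^ 3 \<Rightarrow> real ^ 3 \<Rightarrow> real" where
  "subdivided_form A a b =
     A (vector [a $ 1, b $ 3, b $ 2]) + A (vector [b $ 3, a $ 2, b $ 1]) +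
     A (vector [b $ 2, b $ 1, a $ 3])"

definition renormalizes :: "real \<Rightarrow> (real ^ 3 \<Rightarrow> real) \<Rightarrow> bool" where
  "renormalizes r A \<longleftrightarrow>
     (\<forall>a. (\<forall>b. r * A a \<le> subdivided_form A a b) \<and> (\<exists>b. subdivided_form A a b = r * A a))"

definition level_energy ::
  "(3 \<Rightarrow> real ^ 2) \<Rightarrow> real \<Rightarrow> (real ^ 3 \<Rightarrow> real) \<Rightarrow> nat \<Rightarrow> (real ^ 2 \<Rightarrow> real) \<Rightarrow> real" where
  "level_energy Q r A m u =
     (\<Sum>\<omega> | length \<omega> = m. A (\<chi> i. u (word_map Q \<omega> (Q i)))) / r ^ m"

definition energy ::
  "(3 \<Rightarrow> real ^ 2) \<Rightarrow> real \<Rightarrow> (real ^ 3 \<Rightarrow> real) \<Rightarrow> (real ^ 2 \<Rightarrow> real) \<Rightarrow> ennreal" where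
  "energy Q r A u = lim (\<lambda>m. ennreal (level_energy Q r A m u))"

text \<open>
  A function on the gasket is represented by a total function on the plane. Only its values on the
  gasket matter, so equality of such functions has to be read as equality on \<open>gasket Q\<close>.
\<close>

definition energy_dom ::
  "(3 \<Rightarrow> real ^ 2) \<Rightarrow> real \<Rightarrow> (real ^ 3 \<Rightarrow> real) \<Rightarrow> (real ^ 2 \<Rightarrow> real) set" where
  "energy_dom Q r A = {u. continuous_on (gasket Q) u \<and> energy Q r A u < \<infinity>}"

definition energy_dom0 ::
  "(3 \<Rightarrow> real ^ 2) \<Rightarrow> real \<Rightarrow> (real ^ 3 \<Rightarrow> real) \<Rightarrow> (real ^ 2 \<Rightarrow> real) set" where
  "energy_dom0 Q r A = {u \<in> energy_dom Q r A. \<forall>x \<in> gasket_boundary Q. u x = 0}"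

section \<open>The set-valued energy form\<close>

definition energy_upper ::
  "(3 \<Rightarrow> real ^ 2) \<Rightarrow> real \<Rightarrow> (real ^ 3 \<Rightarrow> real) \<Rightarrow> real \<Rightarrow>
     (real ^ 2 \<Rightarrow> real) \<Rightarrow> (real ^ 2 \<Rightarrow> real) \<Rightarrow> real" where
  "energy_upper Q r A p u v =
     vector_derivative (\<lambda>t. enn2real (energy Q r A (\<lambda>x. u x + t * v x))) (at_right 0) / p"

definition energy_lower ::
  "(3 \<Rightarrow> real ^ 2) \<Rightarrow> real \<Rightarrow> (real ^ 3 \<Rightarrow> real) \<Rightarrow> real \<Rightarrow>
     (real ^ 2 \<Rightarrow> real) \<Rightarrow> (real ^ 2 \<Rightarrow> real) \<Rightarrow> real" where
  "energy_lower Q r A p u v =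
     vector_derivative (\<lambda>t. enn2real (energy Q r A (\<lambda>x. u x + t * v x))) (at_left 0) / p"

definition energy_form ::
  "(3 \<Rightarrow> real ^ 2) \<Rightarrow> real \<Rightarrow> (real ^ 3 \<Rightarrow> real) \<Rightarrow> real \<Rightarrow>
     (real ^ 2 \<Rightarrow> real) \<Rightarrow> (real ^ 2 \<Rightarrow> real) \<Rightarrow> real set" where
  "energy_form Q r A p u v = {energy_lower Q r A p u v .. energy_upper Q r A p u v}"

section \<open>Weak solutions\<close>

text \<open>
  Integrability of the four integrands is part of the definition, because the Bochner integral of a
  non-integrable function is \<open>0\<close>. For continuous \<open>u, v, \<phi>1, \<phi>2\<close>, integrable \<open>a, b, h\<close> and \<open>q > 1\<close> it is
  automatic unless \<open>\<alpha> < 1\<close> or \<open>\<beta> < 1\<close>. Powers \<open>\<bar>u\<bar>^(\<alpha>-2) u\<close> are read as \<open>0\<close> where \<open>u = 0\<close>.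
\<close>

definition weak_solution ::
  "(3 \<Rightarrow> real ^ 2) \<Rightarrow> real \<Rightarrow> (real ^ 3 \<Rightarrow> real) \<Rightarrow> real \<Rightarrow> real \<Rightarrow> real \<Rightarrow> real \<Rightarrow>
     (real ^ 2 \<Rightarrow> real) \<Rightarrow> (real ^ 2 \<Rightarrow> real) \<Rightarrow> (real ^ 2 \<Rightarrow> real) \<Rightarrow> real \<Rightarrow> real \<Rightarrow>
     (real ^ 2 \<Rightarrow> real) \<Rightarrow> (real ^ 2 \<Rightarrow> real) \<Rightarrow> bool" where
  "weak_solution Q r A p q \<alpha> \<beta> a b h lam gam u v \<longleftrightarrow>
     u \<in> energy_dom0 Q r A \<and> v \<in> energy_dom0 Q r A \<and>
     (\<forall>\<phi>1 \<in> energy_dom0 Q r A. \<forall>\<phi>2 \<in> energy_dom0 Q r A.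
        let \<mu> = gasket_measure Q;
            f1 = (\<lambda>x. lam * a x * \<bar>u x\<bar> powr (q - 2) * u x * \<phi>1 x);
            f2 = (\<lambda>x. h x * \<bar>u x\<bar> powr (\<alpha> - 2) * u x * \<bar>v x\<bar> powr \<beta> * \<phi>1 x);
            f3 = (\<lambda>x. gam * b x * \<bar>v x\<bar> powr (q - 2) * v x * \<phi>2 x);
            f4 = (\<lambda>x. h x * \<bar>u x\<bar> powr \<alpha> * \<bar>v x\<bar> powr (\<beta> - 2) * v x * \<phi>2 x)
        in integrable \<mu> f1 \<and> integrable \<mu> f2 \<and> integrable \<mu> f3 \<and> integrable \<mu> f4 \<and>
           (\<integral>x. f1 x \<partial>\<mu>) + \<alpha> / (\<alpha> + \<beta>) * (\<integral>x. f2 x \<partial>\<mu>) +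
           (\<integral>x. f3 x \<partial>\<mu>) + \<beta> / (\<alpha> + \<beta>) * (\<integral>x. f4 x \<partial>\<mu>)
             \<in> energy_form Q r A p u \<phi>1 + energy_form Q r A p v \<phi>2)"

definition nontrivial_pair ::
  "(3 \<Rightarrow> real ^ 2) \<Rightarrow> (real ^ 2 \<Rightarrow> real) \<Rightarrow> (real ^ 2 \<Rightarrow> real) \<Rightarrow> bool" where
  "nontrivial_pair Q u v \<longleftrightarrow> (\<exists>x \<in> gasket Q. (u x, v x) \<noteq> (0, 0))"

definition distinct_pairs ::
  "(3 \<Rightarrow> real ^ 2) \<Rightarrow> (real ^ 2 \<Rightarrow> real) \<Rightarrow> (real ^ 2 \<Rightarrow> real) \<Rightarrow>
     (real ^ 2 \<Rightarrow> real) \<Rightarrow> (real ^ 2 \<Rightarrow> real) \<Rightarrow> bool" where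
  "distinct_pairs Q u v u' v' \<longleftrightarrow> (\<exists>x \<in> gasket Q. (u x, v x) \<noteq> (u' x, v' x))"

section \<open>The one-variable function that determines the form\<close>

lemma p_form_g_even:
  assumes "p_form p A"
  shows "A (vector [-1, -x, 1]) = A (vector [-1, x, 1])"
proof -
  have hom: "\<And>t a. A (t *\<^sub>R a) = \<bar>t\<bar> powr p * A a"
    and perm: "\<And>\<sigma> a. bij \<sigma> \<Longrightarrow> A (\<chi> i. a $ \<sigma> i) = A a"
    using assms unfolding p_form_def by blast+
  have "A (vector [-1, -x, 1]) = A ((-1) *\<^sub>R vector [1, x, -1])"
    by (rule arg_cong[of _ _ A]) (simp add: vec_eq_iff forall_3 vector_3)
  also have "\<dots> = A (vector [1, x, -1])"
    by (simp only: hom) simp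
  also have "vector [1, x, -1] =
      (\<chi> i. (vector [-1, x, 1] :: real ^ 3) $ (Transposition.transpose 1 3 i))"
    by (simp add: vec_eq_iff forall_3 vector_3 Transposition.transpose_def)
  also have "A \<dots> = A (vector [-1, x, 1])"
    by (rule perm) simp
  finally show ?thesis .
qed

lemma p_form_eq_g:
  assumes "p_form p A" "a1 \<le> a2" "a2 \<le> a3" "a1 \<noteq> a3"
  shows "A (vector [a1, a2, a3]) =
    \<bar>(a3 - a1) / 2\<bar> powr p * A (vector [-1, (2 * a2 - a1 - a3) / (a3 - a1), 1])"
proof -
  have hom: "\<And>t a. A (t *\<^sub>R a) = \<bar>t\<bar> powr p * A a"
    and trans: "\<And>c a. A (\<chi> i. a $ i + c) = A a"
    using assms(1) unfolding p_form_def by blast+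
  define w :: "real ^ 3" where
    "w = ((a3 - a1) / 2) *\<^sub>R vector [-1, (2 * a2 - a1 - a3) / (a3 - a1), 1]"
  have "vector [a1, a2, a3] = (\<chi> i. w $ i + (a1 + a3) / 2)"
    using assms(4) by (simp add: w_def vec_eq_iff forall_3 vector_3 field_simps)
  then show ?thesis
    by (simp only: trans) (simp only: w_def hom)
qed

end

theory Submission
  imports Defs "HOL-Complex_Analysis.Great_Picard"
begin

text \<open>
  The system is odd: if \<open>(u, v)\<close> is a weak solution, so is \<open>(-u, -v)\<close>, and the two differ when
  \<open>(u, v)\<close> is nontrivial. So it is enough to find one nontrivial solution for each choice of
  the parameters.

  If \<open>lam > 0\<close> and \<open>a\<close> is not almost everywhere zero, there is one with \<open>v = 0\<close>: minimize
  \<open>E(u) / p - lam / q \<integral> a \<bar>u\<bar>\<^sup>q\<close>, which is coercive because \<open>q < p\<close> and negative near \<open>0\<close>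
  (\<open>semitrivial_minimizer\<close>). The case \<open>gam > 0\<close> is symmetric. Otherwise \<open>- lam a\<close> and \<open>- gam b\<close>
  agree almost everywhere with nonnegative weights. Then, with \<open>s = \<alpha> + \<beta>\<close>, the functional has
  the form \<open>J = E / p + D / q - B / s\<close> with \<open>E, D \<ge> 0\<close> and parts that are homogeneous of degrees
  \<open>p\<close>, \<open>q\<close>, \<open>s\<close>. On each ray with \<open>B > 0\<close> it has exactly one critical point, a maximum, and a
  solution is obtained by minimizing \<open>J\<close> over these maxima, that is, over the Nehari set
  \<open>E + D = B\<close> (\<open>nehari_minimizer_exists\<close>, \<open>nehari_euler_inequality\<close>).

  Minimizers exist by compactness. The energy controls the oscillation on cells geometrically
  in the level, which makes sets of bounded energy equicontinuous, and the energy is lower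
  semicontinuous (\<open>cell_oscillation\<close>, \<open>compactness\<close>). That the weighted terms and the coupling
  are not identically zero needs functions of finite energy; they are built by gluing energy-minimizing pieces
  along the midpoints at which the three cells of first level meet (\<open>minimal_function\<close>,
  \<open>function_detecting_weight\<close>).

  Since \<open>A\<close> need not be differentiable, a minimizer only satisfies one-sided inequalities. They
  suffice, because the lower end of the energy form in a direction is minus the upper end in
  the opposite direction (\<open>energy_formI\<close>). If \<open>\<alpha> < 1\<close> or \<open>\<beta> < 1\<close> the derivative of the coupling
  term is singular where a component vanishes; for nonnegative minimizers its integrability
  follows from the boundedness of the difference quotients (\<open>pos_weighted_integrable_deriv\<close>).
\<close>

section \<open>Measurability for the Hausdorff measure\<close>

lemma hausdorff_content_le:
  assumes "X \<subseteq> (\<Union>i. C i)" "\<And>i. bounded (C i)" "\<And>i. diameter (C i) \<le> \<delta>"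
  shows "hausdorff_content s \<delta> X \<le> (\<Sum>i::nat. ennreal (diameter (C i) powr s))"
  unfolding hausdorff_content_def using assms by (intro INF_lower) auto

lemma hausdorff_content_mono:
  assumes "X \<subseteq> Y"
  shows "hausdorff_content s \<delta> X \<le> hausdorff_content s \<delta> Y"
  unfolding hausdorff_content_def using assms by (intro INF_superset_mono) auto

lemma hausdorff_content_antimono:
  assumes "\<delta> \<le> \<delta>'"
  shows "hausdorff_content s \<delta>' X \<le> hausdorff_content s \<delta> X"
  unfolding hausdorff_content_def using assms by (intro INF_superset_mono) (auto intro: order_trans)

lemma hausdorff_content_UN_le:
  fixes X :: "nat \<Rightarrow> 'a :: metric_space set"
  shows "hausdorff_content s \<delta> (\<Union>n. X n) \<le> (\<Sum>n. hausdorff_content s \<delta> (X n))"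
proof (rule ennreal_le_epsilon)
  fix e :: real
  assume "0 < e" and fin: "(\<Sum>n. hausdorff_content s \<delta> (X n)) < top"
  have "\<exists>C. X n \<subseteq> (\<Union>i. C i) \<and> (\<forall>i. bounded (C i) \<and> diameter (C i) \<le> \<delta>) \<and>
      (\<Sum>i. ennreal (diameter (C i) powr s)) \<le> hausdorff_content s \<delta> (X n) + e * (1/2) ^ Suc n" for n
  proof -
    have "hausdorff_content s \<delta> (X n) < top"
      using ennreal_suminf_lessD[OF fin] .
    then have "hausdorff_content s \<delta> (X n) < hausdorff_content s \<delta> (X n) + e * (1/2) ^ Suc n"
      using \<open>0 < e\<close> by (auto simp add: less_top)
    then obtain C where "C \<in> {C :: nat \<Rightarrow> 'a set. X n \<subseteq> (\<Union>i. C i) \<and> (\<forall>i. bounded (C i) \<and> diameter (C i) \<le> \<delta>)}"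
      "(\<Sum>i. ennreal (diameter (C i) powr s)) < hausdorff_content s \<delta> (X n) + e * (1/2) ^ Suc n"
      unfolding hausdorff_content_def Inf_less_iff by (auto simp: image_iff)
    then show ?thesis by (auto intro!: exI[of _ C])
  qed
  then obtain B where B: "\<And>n. X n \<subseteq> (\<Union>i. B n i)" "\<And>n i. bounded (B n i)" "\<And>n i. diameter (B n i) \<le> \<delta>"
    and Ble: "\<And>n. (\<Sum>i. ennreal (diameter (B n i) powr s)) \<le> hausdorff_content s \<delta> (X n) + e * (1/2) ^ Suc n"
    by metis
  define C where "C k = B (fst (prod_decode k)) (snd (prod_decode k))" for k
  have BC: "B n i = C (prod_encode (n, i))" for n i by (simp add: C_def)
  have "(\<Union>n. X n) \<subseteq> (\<Union>n. \<Union>i. B n i)" by (intro UN_mono B(1)) simp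
  also have "\<dots> \<subseteq> (\<Union>k. C k)" unfolding BC by (intro UN_least UN_upper) simp
  finally have "hausdorff_content s \<delta> (\<Union>n. X n) \<le> (\<Sum>k. ennreal (diameter (C k) powr s))"
    by (rule hausdorff_content_le) (simp_all only: C_def B(2,3))
  also have "\<dots> = (\<Sum>n. \<Sum>i. ennreal (diameter (B n i) powr s))"
    unfolding C_def by (rule suminf_ennreal_2dimen[where f="\<lambda>x. ennreal (diameter (B (fst x) (snd x)) powr s)"]) simp
  also have "\<dots> \<le> (\<Sum>n. hausdorff_content s \<delta> (X n) + e * (1/2) ^ Suc n)"
    by (intro suminf_le Ble) auto
  also have "\<dots> = (\<Sum>n. hausdorff_content s \<delta> (X n)) + (\<Sum>n. ennreal e * ennreal ((1/2) ^ Suc n))"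
    using \<open>0 < e\<close> by (subst suminf_add[symmetric])
      (auto simp del: ennreal_suminf_cmult simp add: ennreal_mult[symmetric])
  also have "\<dots> = (\<Sum>n. hausdorff_content s \<delta> (X n)) + e"
    unfolding ennreal_suminf_cmult
    by (subst suminf_ennreal_eq[OF zero_le_power power_half_series]) auto
  finally show "hausdorff_content s \<delta> (\<Union>n. X n) \<le> (\<Sum>n. hausdorff_content s \<delta> (X n)) + ennreal e" .
qed

lemma hausdorff_outer_mono: "X \<subseteq> Y \<Longrightarrow> hausdorff_outer s X \<le> hausdorff_outer s Y"
  unfolding hausdorff_outer_def by (intro SUP_mono) (auto intro: hausdorff_content_mono)

lemma hausdorff_outer_UN_le:
  "hausdorff_outer s (\<Union>n. X n) \<le> (\<Sum>n. hausdorff_outer s (X n))"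
  unfolding hausdorff_outer_def
proof (rule SUP_least)
  fix \<delta> :: real assume "\<delta> \<in> {0<..}"
  then show "hausdorff_content s \<delta> (\<Union>n. X n) \<le> (\<Sum>n. SUP \<delta>\<in>{0<..}. hausdorff_content s \<delta> (X n))"
    by (intro order_trans[OF hausdorff_content_UN_le] suminf_le SUP_upper) auto
qed

lemma hausdorff_outer_singleton: "hausdorff_outer s {x} = 0"
proof -
  have "hausdorff_content s \<delta> {x} \<le> 0" if "\<delta> > 0" for \<delta>
    using hausdorff_content_le[of "{x}" "\<lambda>_. {x}" \<delta> s] that by auto
  then show ?thesis unfolding hausdorff_outer_def by (intro SUP_eq_const) auto
qed

lemma hausdorff_outer_empty: "hausdorff_outer s {} = 0"
  using hausdorff_outer_mono[of "{}" "{undefined}" s] by (simp add: hausdorff_outer_singleton)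

text \<open>
  A set of diameter less than \<open>\<eta>\<close> cannot meet both \<open>X\<close> and \<open>Y\<close>, so every fine cover of the
  union splits into a cover of \<open>X\<close> and one of \<open>Y\<close>.
\<close>

lemma hausdorff_outer_Un_separated:
  fixes X Y :: "'a :: metric_space set"
  assumes "\<eta> > 0" and sep: "\<And>x y. x \<in> X \<Longrightarrow> y \<in> Y \<Longrightarrow> \<eta> \<le> dist x y"
  shows "hausdorff_outer s X + hausdorff_outer s Y \<le> hausdorff_outer s (X \<union> Y)"
proof -
  have small: "hausdorff_content s \<delta> X + hausdorff_content s \<delta> Y \<le> hausdorff_content s \<delta> (X \<union> Y)"
    if "\<delta> < \<eta>" for \<delta>
    unfolding hausdorff_content_def[of s \<delta> "X \<union> Y"]
  proof (rule INF_greatest)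
    fix C :: "nat \<Rightarrow> 'a set"
    assume "C \<in> {C. X \<union> Y \<subseteq> \<Union> (range C) \<and> (\<forall>i. bounded (C i) \<and> diameter (C i) \<le> \<delta>)}"
    then have C: "X \<union> Y \<subseteq> \<Union> (range C)" "\<And>i. bounded (C i)" "\<And>i. diameter (C i) \<le> \<delta>" by auto
    define CX where "CX i = (if C i \<inter> X = {} then {} else C i)" for i
    define CY where "CY i = (if C i \<inter> Y = {} then {} else C i)" for i
    have \<delta>: "0 \<le> \<delta>" using C(2,3)[of 0] diameter_ge_0 order_trans by blast
    have X: "hausdorff_content s \<delta> X \<le> (\<Sum>i. ennreal (diameter (CX i) powr s))"
      by (rule hausdorff_content_le) (use C \<delta> in \<open>force simp: CX_def\<close>)+
    have Y: "hausdorff_content s \<delta> Y \<le> (\<Sum>i. ennreal (diameter (CY i) powr s))"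
      by (rule hausdorff_content_le) (use C \<delta> in \<open>force simp: CY_def\<close>)+
    have "C i \<inter> X = {} \<or> C i \<inter> Y = {}" for i
    proof (rule ccontr)
      assume "\<not> ?thesis"
      then obtain x y where xy: "x \<in> C i" "x \<in> X" "y \<in> C i" "y \<in> Y" by auto
      have "dist x y \<le> \<delta>"
        using diameter_bounded_bound[OF C(2) xy(1,3)] C(3)[of i] by linarith
      with sep[OF xy(2,4)] \<open>\<delta> < \<eta>\<close> show False by linarith
    qed
    then have "ennreal (diameter (CX i) powr s) + ennreal (diameter (CY i) powr s)
        \<le> ennreal (diameter (C i) powr s)" for i
      by (cases "C i \<inter> X = {}"; cases "C i \<inter> Y = {}") (auto simp: CX_def CY_def)
    then have "(\<Sum>i. ennreal (diameter (CX i) powr s) + ennreal (diameter (CY i) powr s))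
        \<le> (\<Sum>i. ennreal (diameter (C i) powr s))"
      by (intro suminf_le) auto
    then show "hausdorff_content s \<delta> X + hausdorff_content s \<delta> Y \<le> (\<Sum>i. ennreal (diameter (C i) powr s))"
      using add_mono[OF X Y] by (subst (asm) suminf_add[symmetric]) auto
  qed
  have "hausdorff_outer s X + hausdorff_outer s Y
      = (SUP \<delta>\<in>{0<..}. hausdorff_content s \<delta> X + hausdorff_content s \<delta> Y)"
    unfolding hausdorff_outer_def
  proof (rule SUP_add_directed_ennreal[symmetric])
    fix i j :: real assume "i \<in> {0<..}" "j \<in> {0<..}"
    then show "\<exists>k\<in>{0<..}. hausdorff_content s i X + hausdorff_content s j Y
        \<le> hausdorff_content s k X + hausdorff_content s k Y"
      by (intro bexI[of _ "min i j"] add_mono hausdorff_content_antimono) auto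
  qed
  also have "\<dots> \<le> hausdorff_outer s (X \<union> Y)"
  proof (rule SUP_least)
    fix \<delta> :: real assume d: "\<delta> \<in> {0<..}"
    have "hausdorff_content s \<delta> X + hausdorff_content s \<delta> Y \<le>
        hausdorff_content s (min \<delta> (\<eta>/2)) X + hausdorff_content s (min \<delta> (\<eta>/2)) Y"
      by (intro add_mono hausdorff_content_antimono) auto
    also have "\<dots> \<le> hausdorff_content s (min \<delta> (\<eta>/2)) (X \<union> Y)"
      using \<open>\<eta> > 0\<close> by (intro small) auto
    also have "\<dots> \<le> hausdorff_outer s (X \<union> Y)"
      unfolding hausdorff_outer_def using \<open>\<eta> > 0\<close> d by (intro SUP_upper) auto
    finally show "hausdorff_content s \<delta> X + hausdorff_content s \<delta> Y \<le> hausdorff_outer s (X \<union> Y)" .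
  qed
  finally show ?thesis .
qed

lemma suminf_tail_ennreal:
  fixes f :: "nat \<Rightarrow> ennreal"
  assumes "(\<Sum>k. f k) \<noteq> top"
  shows "(\<lambda>n. \<Sum>k. f (k + n)) \<longlonglongrightarrow> 0"
proof -
  define g where "g k = enn2real (f k)" for k
  have "f k < top" for k
    using ennreal_suminf_lessD assms by (metis less_top)
  then have f: "f k = ennreal (g k)" for k by (simp add: g_def)
  have g_nonneg: "g k \<ge> 0" for k by (simp add: g_def)
  have g: "summable g"
    using assms unfolding f by (intro summable_suminf_not_top g_nonneg)
  have "(\<lambda>n. \<Sum>k. g (k + n)) \<longlonglongrightarrow> 0"
    using suminf_exist_split[OF _ g] by (intro LIMSEQ_I) auto
  then have "(\<lambda>n. ennreal (\<Sum>k. g (k + n))) \<longlonglongrightarrow> ennreal 0"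
    by (rule tendsto_ennrealI)
  moreover have "ennreal (\<Sum>k. g (k + n)) = (\<Sum>k. f (k + n))" for n
    unfolding f by (intro suminf_ennreal2[symmetric] g_nonneg) (simp add: summable_iff_shift g)
  ultimately show ?thesis by simp
qed

text \<open>
  Caratheodory's criterion. The points of \<open>X\<close> outside \<open>C\<close> are sorted into shells according to their
  distance from \<open>C\<close>. Shells whose indices differ by at least two are separated, so the shells with
  even index have total mass at most that of \<open>X\<close>, and likewise the odd ones. Hence the tails of
  the sum over all shells tend to \<open>0\<close>, and \<open>X - C\<close> is approximated in mass by the sets of points
  at distance at least \<open>1 / (n + 1)\<close>, which are separated from \<open>C\<close>.
\<close>

lemma closed_in_lambda_system:
  fixes \<nu> :: "'a :: metric_space set \<Rightarrow> ennreal"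
  assumes mono: "\<And>X Y. X \<subseteq> Y \<Longrightarrow> \<nu> X \<le> \<nu> Y"
    and empty: "\<nu> {} = 0"
    and subadd: "\<And>X :: nat \<Rightarrow> 'a set. \<nu> (\<Union>n. X n) \<le> (\<Sum>n. \<nu> (X n))"
    and sep: "\<And>\<eta> X Y. \<eta> > 0 \<Longrightarrow> (\<And>x y. x \<in> X \<Longrightarrow> y \<in> Y \<Longrightarrow> \<eta> \<le> dist x y) \<Longrightarrow>
        \<nu> X + \<nu> Y \<le> \<nu> (X \<union> Y)"
    and "closed C"
  shows "C \<in> lambda_system UNIV UNIV \<nu>"
proof (cases "C = {}")
  case True
  then show ?thesis by (simp add: lambda_system_def empty)
next
  case False
  have Un: "\<nu> (X \<union> Y) \<le> \<nu> X + \<nu> Y" for X Y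
    using subadd[of "binaryset X Y"] suminf_binaryset_eq[of \<nu> X Y] empty
    by (simp add: UN_binaryset_eq)
  have "\<nu> (C \<inter> X) + \<nu> (X - C) \<le> \<nu> X" for X
  proof (cases "\<nu> X = top")
    case True then show ?thesis by simp
  next
    case fin: False
    \<comment> \<open>The shells, numbered from the outside.\<close>
    define R where "R k = {x \<in> X. 1 / real (k + 2) \<le> infdist x C \<and> infdist x C < 1 / real (k + 1)}" for k :: nat
    have R_sep: "1 / real (j + 2) - 1 / real (j + 3) \<le> dist x y" if "x \<in> R j" "y \<in> R k" "j + 2 \<le> k" for x y j k
    proof -
      have "infdist y C < 1 / real (k + 1)" "1 / real (j + 2) \<le> infdist x C" using that by (auto simp: R_def)
      moreover have "1 / real (k + 1) \<le> 1 / real (j + 3)" using that by (intro divide_left_mono) auto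
      ultimately show ?thesis using infdist_triangle[of x C y] by linarith
    qed
    have half: "(\<Sum>k. \<nu> (R (2 * k + i))) \<le> \<nu> X" for i
    proof (rule suminf_le_const)
      show "summable (\<lambda>k. \<nu> (R (2 * k + i)))" by simp
      fix n
      have "(\<Sum>k<n. \<nu> (R (2 * k + i))) \<le> \<nu> (\<Union>k<n. R (2 * k + i))"
      proof (induction n)
        case (Suc n)
        have "\<nu> (\<Union>k<n. R (2 * k + i)) + \<nu> (R (2 * n + i)) \<le> \<nu> ((\<Union>k<n. R (2 * k + i)) \<union> R (2 * n + i))"
        proof (rule sep)
          define \<eta> where "\<eta> = Min ((\<lambda>k. 1 / real (2 * k + i + 2) - 1 / real (2 * k + i + 3)) ` {..n})"
          show "\<eta> > 0" unfolding \<eta>_def by (subst Min_gr_iff) (auto simp: divide_simps)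
          fix x y assume "x \<in> (\<Union>k<n. R (2 * k + i))" "y \<in> R (2 * n + i)"
          then obtain k where k: "k < n" "x \<in> R (2 * k + i)" by auto
          have "\<eta> \<le> 1 / real (2 * k + i + 2) - 1 / real (2 * k + i + 3)"
            unfolding \<eta>_def using k by (intro Min_le) auto
          also have "\<dots> \<le> dist x y" using R_sep[OF k(2) \<open>y \<in> R (2 * n + i)\<close>] k by auto
          finally show "\<eta> \<le> dist x y" .
        qed
        also have "(\<Union>k<n. R (2 * k + i)) \<union> R (2 * n + i) = (\<Union>k<Suc n. R (2 * k + i))"
          by (auto simp: lessThan_Suc)
        finally show ?case using Suc by (auto intro: order_trans[OF add_right_mono])
      qed (simp add: empty)
      also have "\<dots> \<le> \<nu> X" by (intro mono) (auto simp: R_def)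
      finally show "(\<Sum>k<n. \<nu> (R (2 * k + i))) \<le> \<nu> X" .
    qed
    have "(\<Sum>k. \<nu> (R k)) \<noteq> top"
    proof -
      have "(\<Sum>k<n. \<nu> (R k)) \<le> \<nu> X + \<nu> X" for n
      proof -
        have "(\<Sum>k<n. \<nu> (R k)) \<le> (\<Sum>k<2*n. \<nu> (R k))" by (intro sum_mono2) auto
        also have "\<dots> = (\<Sum>k<n. \<nu> (R (2 * k + 0))) + (\<Sum>k<n. \<nu> (R (2 * k + 1)))"
          by (induction n) (auto simp: algebra_simps)
        also have "\<dots> \<le> \<nu> X + \<nu> X"
          by (intro add_mono order_trans[OF sum_le_suminf half]) auto
        finally show ?thesis .
      qed
      then have "(\<Sum>k. \<nu> (R k)) \<le> \<nu> X + \<nu> X" by (intro suminf_le_const) auto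
      then show ?thesis using fin by (metis ennreal_add_eq_top top.extremum_uniqueI)
    qed
    then have tail: "(\<lambda>n. \<Sum>k. \<nu> (R (k + n))) \<longlonglongrightarrow> 0"
      by (rule suminf_tail_ennreal)
    have step: "\<nu> (C \<inter> X) + \<nu> (X - C) \<le> \<nu> X + (\<Sum>k. \<nu> (R (k + n)))" for n
    proof -
      define Z where "Z = {x \<in> X. 1 / real (n + 1) \<le> infdist x C}"
      have "X - C \<subseteq> Z \<union> (\<Union>k. R (k + n))"
      proof
        fix x assume x: "x \<in> X - C"
        then have pos: "infdist x C > 0"
          using \<open>closed C\<close> \<open>C \<noteq> {}\<close> by (metis DiffE in_closed_iff_infdist_zero infdist_nonneg less_eq_real_def)
        show "x \<in> Z \<union> (\<Union>k. R (k + n))"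
        proof (cases "x \<in> Z")
          case False
          then have less: "infdist x C < 1 / real (n + 1)" using x by (auto simp: Z_def)
          define m where "m = (LEAST m. 1 / real (m + 2) \<le> infdist x C)"
          obtain m0 where "1 / real (Suc m0) < infdist x C" using nat_approx_posE[OF pos] by blast
          moreover have "1 / real (m0 + 2) \<le> 1 / real (Suc m0)" by (intro divide_left_mono) auto
          ultimately have "1 / real (m0 + 2) \<le> infdist x C" by linarith
          then have m: "1 / real (m + 2) \<le> infdist x C" unfolding m_def by (rule LeastI)
          have "n \<le> m"
          proof (rule ccontr)
            assume "\<not> n \<le> m"
            then have "1 / real (n + 1) \<le> 1 / real (m + 2)" by (intro divide_left_mono) auto
            with m less show False by linarith
          qed
          moreover have "infdist x C < 1 / real (m + 1)"
          proof (cases m)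
            case 0
            then have "n = 0" using \<open>n \<le> m\<close> by simp
            then show ?thesis using 0 less by simp
          next
            case (Suc l)
            have "\<not> 1 / real (l + 2) \<le> infdist x C"
              using not_less_Least[of l "\<lambda>m. 1 / real (m + 2) \<le> infdist x C"] Suc unfolding m_def by auto
            then show ?thesis using Suc by auto
          qed
          ultimately have "x \<in> R ((m - n) + n)" using x m by (auto simp: R_def)
          then show ?thesis by blast
        qed simp
      qed
      then have "\<nu> (X - C) \<le> \<nu> Z + \<nu> (\<Union>k. R (k + n))"
        by (intro order_trans[OF mono Un]) auto
      also have "\<dots> \<le> \<nu> Z + (\<Sum>k. \<nu> (R (k + n)))" by (intro add_left_mono subadd)
      finally have "\<nu> (C \<inter> X) + \<nu> (X - C) \<le> \<nu> (C \<inter> X) + \<nu> Z + (\<Sum>k. \<nu> (R (k + n)))"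
        by (simp add: add.assoc add_left_mono)
      also have "\<nu> (C \<inter> X) + \<nu> Z \<le> \<nu> (C \<inter> X \<union> Z)"
      proof (rule sep)
        show "1 / real (n + 1) > 0" by simp
        fix x y assume "x \<in> C \<inter> X" "y \<in> Z"
        then show "1 / real (n + 1) \<le> dist x y"
          using infdist_le[of x C y] by (auto simp: Z_def dist_commute)
      qed
      also have "\<nu> (C \<inter> X \<union> Z) \<le> \<nu> X" by (intro mono) (auto simp: Z_def)
      finally show ?thesis by (simp add: add_right_mono)
    qed
    have "(\<lambda>n. \<nu> X + (\<Sum>k. \<nu> (R (k + n)))) \<longlonglongrightarrow> \<nu> X + 0"
      by (intro tendsto_add tail tendsto_const)
    then show ?thesis using step by (intro LIMSEQ_le_const[where X="\<lambda>n. \<nu> X + (\<Sum>k. \<nu> (R (k + n)))"]) auto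
  qed
  moreover have "\<nu> X \<le> \<nu> (C \<inter> X) + \<nu> (X - C)" for X
    by (intro order_trans[OF mono Un]) auto
  ultimately have "\<nu> (C \<inter> X) + \<nu> (X - C) = \<nu> X" for X by (intro antisym)
  moreover have "(UNIV - C) \<inter> X = X - C" for X by auto
  ultimately show ?thesis by (simp add: lambda_system_def)
qed

lemma sets_borel_subset_hausdorff: "sets borel \<subseteq> sets (hausdorff_measure s)"
proof -
  have "Collect closed \<subseteq> lambda_system UNIV UNIV (hausdorff_outer s)"
    by (auto intro!: closed_in_lambda_system hausdorff_outer_mono hausdorff_outer_empty
        hausdorff_outer_UN_le hausdorff_outer_Un_separated)
  then have "sigma_sets UNIV (Collect closed) \<subseteq> sigma_sets UNIV (lambda_system UNIV UNIV (hausdorff_outer s))"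
    by (rule sigma_sets_subseteq)
  then show ?thesis
    unfolding hausdorff_measure_def borel_eq_closed by simp
qed

text \<open>
  Outside the case where the outer measure is a measure on the generated sigma-algebra,
  \<^const>\<open>measure_of\<close> yields the zero measure, so outer null sets are null either way.
\<close>

lemma emeasure_hausdorff_singleton: "emeasure (hausdorff_measure s) {x} = 0"
  by (simp add: hausdorff_measure_def emeasure_measure_of_conv hausdorff_outer_singleton)

lemma space_gasket_measure: "space (gasket_measure Q) = gasket Q"
  by (simp add: gasket_measure_def hausdorff_measure_def space_restrict_space)

lemma measurable_gasket_measure:
  assumes "continuous_on (gasket Q) u"
  shows "u \<in> borel_measurable (gasket_measure Q)"
proof -
  have "u \<in> borel_measurable (restrict_space borel (gasket Q))"
    using assms by (rule borel_measurable_continuous_on_restrict)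
  moreover have "sets (restrict_space borel (gasket Q)) \<subseteq> sets (gasket_measure Q)"
    using sets_borel_subset_hausdorff by (auto simp: gasket_measure_def sets_restrict_space)
  ultimately show ?thesis
    by (auto simp: measurable_def space_gasket_measure space_restrict_space)
qed

section \<open>The gasket and its cells\<close>

lemma dist_gasket_map: "dist (gasket_map Q i x) (gasket_map Q i y) = dist x y / 2"
proof -
  have "gasket_map Q i x - gasket_map Q i y = (1/2) *\<^sub>R (x - y)"
    by (simp add: gasket_map_def algebra_simps)
  then show ?thesis by (simp add: dist_norm)
qed

lemma continuous_on_gasket_map: "continuous_on X (gasket_map Q i)"
  unfolding gasket_map_def by (intro continuous_intros)

lemma gasket_map_midpoint: "gasket_map Q i x = midpoint x (Q i)"
  by (simp add: gasket_map_def midpoint_def algebra_simps flip: scaleR_add_left)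

lemma gasket_map_vertex: "gasket_map Q i (Q i) = Q i"
  by (simp add: gasket_map_midpoint)

lemma gasket_map_commute: "gasket_map Q i (Q j) = gasket_map Q j (Q i)"
  by (simp add: gasket_map_midpoint midpoint_sym)

lemma word_map_Nil [simp]: "word_map Q [] x = x"
  and word_map_Cons [simp]: "word_map Q (i # \<omega>) x = gasket_map Q i (word_map Q \<omega> x)"
  and word_map_append [simp]: "word_map Q (\<omega> @ \<omega>') x = word_map Q \<omega> (word_map Q \<omega>' x)"
  by (simp_all add: word_map_def)

lemma dist_word_map: "dist (word_map Q \<omega> x) (word_map Q \<omega> y) = dist x y / 2 ^ length \<omega>"
  by (induction \<omega>) (simp_all add: dist_gasket_map)

lemma continuous_on_word_map: "continuous_on X (word_map Q \<omega>)"
proof (induction \<omega>)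
  case (Cons i \<omega>)
  have "continuous_on X (\<lambda>x. gasket_map Q i (word_map Q \<omega> x))"
    using Cons continuous_on_compose2[OF continuous_on_gasket_map[of UNIV]] by blast
  then show ?case by (simp cong: continuous_on_cong)
qed (simp cong: continuous_on_cong)

definition junction_points :: "(3 \<Rightarrow> real ^ 2) \<Rightarrow> (real ^ 2) set" where
  "junction_points Q = {word_map Q \<omega> (Q i) |\<omega> i. True}"

lemma junction_points_subset:
  assumes "\<And>i. Q i \<in> X" "\<And>i x. x \<in> X \<Longrightarrow> gasket_map Q i x \<in> X"
  shows "junction_points Q \<subseteq> X"
proof -
  have "word_map Q \<omega> (Q i) \<in> X" for \<omega> i
    by (induction \<omega>) (auto intro: assms)
  then show ?thesis by (auto simp: junction_points_def)
qed

lemma gasket_map_junction_points: "(\<Union>i. gasket_map Q i ` junction_points Q) = junction_points Q"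
proof (intro equalityI subsetI)
  fix x assume "x \<in> (\<Union>i. gasket_map Q i ` junction_points Q)"
  then obtain i \<omega> j where "x = gasket_map Q i (word_map Q \<omega> (Q j))"
    by (auto simp: junction_points_def)
  then have "x = word_map Q (i # \<omega>) (Q j)" by simp
  then show "x \<in> junction_points Q" unfolding junction_points_def by blast
next
  fix x assume "x \<in> junction_points Q"
  then obtain \<omega> j where x: "x = word_map Q \<omega> (Q j)" by (auto simp: junction_points_def)
  show "x \<in> (\<Union>i. gasket_map Q i ` junction_points Q)"
  proof (cases \<omega>)
    case Nil
    then have "x = gasket_map Q j (word_map Q [] (Q j))" using x by (simp add: gasket_map_vertex)
    then show ?thesis unfolding junction_points_def by blast
  next
    case (Cons i \<omega>')
    then have "x = gasket_map Q i (word_map Q \<omega>' (Q j))" using x by simp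
    then show ?thesis unfolding junction_points_def by blast
  qed
qed

lemma bounded_junction_points: "bounded (junction_points Q)"
proof -
  have "junction_points Q \<subseteq> convex hull (range Q)"
  proof (rule junction_points_subset)
    show "Q i \<in> convex hull (range Q)" for i by (simp add: hull_inc)
    show "gasket_map Q i x \<in> convex hull (range Q)" if "x \<in> convex hull (range Q)" for i x
      using that convexD_alt[OF convex_convex_hull that, of "Q i" "1/2"]
      by (simp add: gasket_map_midpoint midpoint_def hull_inc scaleR_add_right)
  qed
  then show ?thesis
    using bounded_subset finite_imp_bounded bounded_convex_hull by (metis finite_imageI finite)
qed

text \<open>
  For every \<open>n\<close>, a point of \<open>K\<close> is the image of a point of \<open>K\<close> under some word map of length \<open>n\<close>.
  The same map sends \<open>L\<close> into \<open>L\<close> and contracts distances by \<open>2\<^sup>-\<^sup>n\<close>, so the point is in the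
  closure of \<open>L\<close>. Applied in both directions, this is the uniqueness of the invariant compact set.
\<close>

lemma invariant_set_subset:
  assumes K: "bounded K" "K \<subseteq> (\<Union>i. gasket_map Q i ` K)"
    and L: "compact L" "L \<noteq> {}" "(\<Union>i. gasket_map Q i ` L) \<subseteq> L"
  shows "K \<subseteq> L"
proof
  fix x assume "x \<in> K"
  have cell: "\<exists>\<omega> y. length \<omega> = n \<and> y \<in> K \<and> z = word_map Q \<omega> y" if "z \<in> K" for z n
    using that
  proof (induction n arbitrary: z)
    case 0
    then show ?case by (intro exI[of _ "[]"] exI[of _ z]) simp
  next
    case (Suc n)
    then obtain i y where "y \<in> K" "z = gasket_map Q i y" using K(2) by blast
    moreover obtain \<omega> y' where "length \<omega> = n" "y' \<in> K" "y = word_map Q \<omega> y'"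
      using Suc.IH[OF \<open>y \<in> K\<close>] by blast
    ultimately show ?case by (intro exI[of _ "i # \<omega>"] exI[of _ y']) simp
  qed
  have wL: "word_map Q \<omega> y \<in> L" if "y \<in> L" for \<omega> y
    using that L(3) by (induction \<omega>) auto
  obtain y0 where y0: "y0 \<in> L" using L(2) by blast
  obtain D where D: "\<And>y. y \<in> K \<Longrightarrow> dist y y0 \<le> D"
    using K(1) by (metis bounded_any_center dist_commute)
  have "x \<in> closure L"
    unfolding closure_approachable
  proof (intro allI impI)
    fix e :: real assume "e > 0"
    have "(\<lambda>n. D * (1/2) ^ n) \<longlonglongrightarrow> 0" by real_asymp
    then have "\<forall>\<^sub>F n in sequentially. D * (1/2) ^ n < e"
      using \<open>e > 0\<close> by (rule order_tendstoD)
    then obtain n where n: "D * (1/2) ^ n < e" by (auto simp: eventually_sequentially)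
    obtain \<omega> y where \<omega>: "length \<omega> = n" "y \<in> K" "x = word_map Q \<omega> y" using cell[OF \<open>x \<in> K\<close>] by blast
    have "dist (word_map Q \<omega> y0) x = dist y y0 / 2 ^ n"
      by (simp add: \<omega> dist_word_map dist_commute)
    also have "\<dots> \<le> D / 2 ^ n" using D[OF \<omega>(2)] by (intro divide_right_mono) auto
    also have "\<dots> < e" using n by (simp add: power_one_over field_simps)
    finally show "\<exists>y\<in>L. dist y x < e" using wL[OF y0] by blast
  qed
  then show "x \<in> L" using L(1) by (simp add: compact_imp_closed)
qed

lemma compact_closure_junction_points: "compact (closure (junction_points Q))"
  using bounded_junction_points by (simp add: compact_closure)

text \<open>
  The self-similarity of the set of junction points passes to the closure because the images
  of its compact closure are closed. This is the existence of the gasket.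
\<close>

lemma gasket_map_closure_junction_points:
  "(\<Union>i. gasket_map Q i ` closure (junction_points Q)) = closure (junction_points Q)"
proof -
  let ?K = "closure (junction_points Q)"
  have "gasket_map Q i ` ?K = closure (gasket_map Q i ` junction_points Q)" for i
  proof (rule closure_unique[symmetric])
    show "gasket_map Q i ` junction_points Q \<subseteq> gasket_map Q i ` ?K"
      by (intro image_mono closure_subset)
    show "closed (gasket_map Q i ` ?K)"
      by (intro compact_imp_closed compact_continuous_image continuous_on_gasket_map
          compact_closure_junction_points)
    show "gasket_map Q i ` ?K \<subseteq> T" if "gasket_map Q i ` junction_points Q \<subseteq> T" "closed T" for T
      using that by (intro image_closure_subset continuous_on_gasket_map)
  qed
  then have "(\<Union>i. gasket_map Q i ` ?K) = (\<Union>i. closure (gasket_map Q i ` junction_points Q))" by simp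
  also have "\<dots> = closure (\<Union>i. gasket_map Q i ` junction_points Q)"
    unfolding UNIV_3 by (simp only: UN_insert UN_empty closure_Un closure_empty)
  finally show ?thesis by (simp only: gasket_map_junction_points)
qed

lemma gasket_eq_closure: "gasket Q = closure (junction_points Q)"
proof -
  let ?K = "closure (junction_points Q)"
  have ne: "?K \<noteq> {}" unfolding closure_eq_empty by (auto simp: junction_points_def)
  have unique: "L = ?K" if L: "L \<noteq> {}" "compact L" "(\<Union>i. gasket_map Q i ` L) = L" for L
  proof (rule equalityI)
    show "L \<subseteq> ?K"
      by (rule invariant_set_subset[OF compact_imp_bounded[OF L(2)] equalityD2[OF L(3)]
            compact_closure_junction_points ne equalityD1[OF gasket_map_closure_junction_points]])
    show "?K \<subseteq> L"
      by (rule invariant_set_subset[OF compact_imp_bounded[OF compact_closure_junction_points]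
            equalityD2[OF gasket_map_closure_junction_points] L(2,1) equalityD1[OF L(3)]])
  qed
  show ?thesis
    unfolding gasket_def
  proof (rule the_equality)
    show "?K \<noteq> {} \<and> compact ?K \<and> (\<Union>i. gasket_map Q i ` ?K) = ?K"
      by (intro conjI ne compact_closure_junction_points gasket_map_closure_junction_points)
  next
    fix L assume "L \<noteq> {} \<and> compact L \<and> (\<Union>i. gasket_map Q i ` L) = L"
    then show "L = ?K" by (elim conjE) (rule unique)
  qed
qed

lemma compact_gasket: "compact (gasket Q)"
  using bounded_junction_points by (simp add: gasket_eq_closure compact_closure)

lemma word_map_vertex_in_gasket: "word_map Q \<omega> (Q i) \<in> gasket Q"
  using closure_subset by (fastforce simp: gasket_eq_closure junction_points_def)

lemma vertex_in_gasket: "Q i \<in> gasket Q"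
  using word_map_vertex_in_gasket[of Q "[]"] by simp

lemma AE_gasket_measure_neq:
  assumes "y \<in> gasket Q"
  shows "AE x in gasket_measure Q. x \<noteq> y"
proof (rule AE_I[of _ _ "{y}"])
  let ?M = "hausdorff_measure (ln 3 / ln 2) :: (real ^ 2) measure"
  have "closed (gasket Q)" using compact_gasket by (rule compact_imp_closed)
  then have "gasket Q \<in> sets borel" by simp
  then have S: "gasket Q \<in> sets ?M" using sets_borel_subset_hausdorff by (rule subsetD[rotated])
  have "{y} \<in> sets borel" by simp
  then have y: "{y} \<in> sets ?M" using sets_borel_subset_hausdorff by (rule subsetD[rotated])
  have sp: "space ?M = UNIV" by (simp add: hausdorff_measure_def)
  show "emeasure (gasket_measure Q) {y} = 0"
    unfolding gasket_measure_def using assms S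
    by (subst emeasure_restrict_space) (auto simp: sp emeasure_hausdorff_singleton)
  show "{y} \<in> sets (gasket_measure Q)"
    unfolding gasket_measure_def sets_restrict_space
    using y assms by (intro image_eqI[of _ _ "{y}"]) auto
qed auto

lemma gasket_subset:
  assumes "closed X" "\<And>i. Q i \<in> X" "\<And>i x. x \<in> X \<Longrightarrow> gasket_map Q i x \<in> X"
  shows "gasket Q \<subseteq> X"
  unfolding gasket_eq_closure using assms by (intro closure_minimal junction_points_subset) auto

lemma gasket_self_similar: "(\<Union>i. gasket_map Q i ` gasket Q) = gasket Q"
proof (intro equalityI)
  have "gasket_map Q i ` gasket Q \<subseteq> gasket Q" for i
    unfolding gasket_eq_closure
    by (intro image_closure_subset continuous_on_gasket_map closed_closure)
      (use closure_subset gasket_map_junction_points[of Q] in blast)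
  then show "(\<Union>i. gasket_map Q i ` gasket Q) \<subseteq> gasket Q" by blast
  show "gasket Q \<subseteq> (\<Union>i. gasket_map Q i ` gasket Q)"
  proof (rule gasket_subset)
    show "closed (\<Union>i. gasket_map Q i ` gasket Q)"
      by (intro closed_UN) (auto intro!: compact_imp_closed compact_continuous_image
          continuous_on_gasket_map compact_gasket)
    show "Q i \<in> (\<Union>i. gasket_map Q i ` gasket Q)" for i
      by (rule UN_I[of i]) (auto intro!: image_eqI[of _ _ "Q i"] simp: gasket_map_vertex vertex_in_gasket)
    show "gasket_map Q i x \<in> (\<Union>i. gasket_map Q i ` gasket Q)"
      if "x \<in> (\<Union>i. gasket_map Q i ` gasket Q)" for i x
      using that \<open>(\<Union>i. gasket_map Q i ` gasket Q) \<subseteq> gasket Q\<close> by blast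
  qed
qed

lemma gasket_map_in_gasket: "x \<in> gasket Q \<Longrightarrow> gasket_map Q i x \<in> gasket Q"
  using gasket_self_similar by blast

lemma gasket_cases:
  assumes "x \<in> gasket Q"
  obtains i y where "y \<in> gasket Q" "x = gasket_map Q i y"
  using assms gasket_self_similar[of Q] by blast

lemma word_map_in_gasket: "x \<in> gasket Q \<Longrightarrow> word_map Q \<omega> x \<in> gasket Q"
  by (induction \<omega>) (auto intro: gasket_map_in_gasket)

lemma gasket_in_cell:
  assumes "x \<in> gasket Q"
  obtains \<omega> y where "length \<omega> = m" "y \<in> gasket Q" "x = word_map Q \<omega> y"
  using assms
proof (induction m arbitrary: x thesis)
  case 0
  then show ?case by (metis length_0_conv word_map_Nil)
next
  case (Suc m)
  from Suc.prems(2) obtain i y where y: "y \<in> gasket Q" "x = gasket_map Q i y" by (rule gasket_cases)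
  obtain \<omega> y' where "length \<omega> = m" "y' \<in> gasket Q" "y = word_map Q \<omega> y'"
    using Suc.IH[OF _ y(1)] by blast
  then show ?case using y by (intro Suc.prems(1)[of "i # \<omega>" y']) auto
qed

lemma finite_words [simp]: "finite {\<omega> :: 3 list. length \<omega> = m}"
  using finite_lists_length_eq[of "UNIV :: 3 set" m] by simp

lemma sum_words_Cons:
  "(\<Sum>\<omega> | length \<omega> = Suc m. f \<omega>) = (\<Sum>j \<in> UNIV. \<Sum>\<omega> | length \<omega> = m. f (j # \<omega> :: 3 list))"
proof -
  have "(\<Sum>j \<in> UNIV. \<Sum>\<omega> | length \<omega> = m. f (j # \<omega>)) =
      (\<Sum>(j, \<omega>) \<in> UNIV \<times> {\<omega>. length \<omega> = m}. f (j # \<omega>))"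
    by (simp add: sum.cartesian_product)
  also have "\<dots> = (\<Sum>\<omega> | length \<omega> = Suc m. f \<omega>)"
    by (rule sum.reindex_bij_witness[of _ "\<lambda>\<omega>. (hd \<omega>, tl \<omega>)" "\<lambda>(j, \<omega>). j # \<omega>"])
      (auto simp: length_Suc_conv)
  finally show ?thesis by simp
qed

lemma sum_words_snoc:
  "(\<Sum>\<omega> | length \<omega> = Suc m. f \<omega>) = (\<Sum>\<omega> | length \<omega> = m. \<Sum>j \<in> UNIV. f (\<omega> @ [j] :: 3 list))"
proof -
  have "(\<Sum>\<omega> | length \<omega> = m. \<Sum>j \<in> UNIV. f (\<omega> @ [j])) =
      (\<Sum>(\<omega>, j) \<in> {\<omega>. length \<omega> = m} \<times> UNIV. f (\<omega> @ [j]))"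
    by (simp add: sum.cartesian_product)
  also have "\<dots> = (\<Sum>\<omega> | length \<omega> = Suc m. f \<omega>)"
    by (rule sum.reindex_bij_witness[of _ "\<lambda>\<omega>. (butlast \<omega>, last \<omega>)" "\<lambda>(\<omega>, j). \<omega> @ [j]"])
      (auto simp: length_Suc_conv_rev)
  finally show ?thesis by simp
qed

section \<open>Barycentric coordinates\<close>

text \<open>
  The terms of second order in \<open>x\<close> cancel, so this is affine; for an equilateral triangle it is
  the barycentric coordinate belonging to the vertex \<open>Q i\<close>.
\<close>

definition bary :: "(3 \<Rightarrow> real ^ 2) \<Rightarrow> 3 \<Rightarrow> real ^ 2 \<Rightarrow> real" where
  "bary Q i x = 1/3 + ((\<Sum>j\<in>UNIV. (dist x (Q j))\<^sup>2) - 3 * (dist x (Q i))\<^sup>2) / (3 * (dist (Q 1) (Q 2))\<^sup>2)"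

lemma sum_bary: "(\<Sum>i\<in>UNIV. bary Q i x) = 1"
  by (simp add: bary_def sum_3 add_divide_distrib diff_divide_distrib)

lemma bary_midpoint: "bary Q i (midpoint x y) = (bary Q i x + bary Q i y) / 2"
proof -
  have "(dist (midpoint x y) z)\<^sup>2 = ((dist x z)\<^sup>2 + (dist y z)\<^sup>2) / 2 - (dist x y)\<^sup>2 / 4" for z :: "real ^ 2"
    unfolding midpoint_def dist_norm power2_norm_eq_inner
    by (simp add: inner_diff_left inner_diff_right inner_add_left inner_add_right inner_commute
        algebra_simps) (simp add: field_simps)
  then show ?thesis
    by (simp add: bary_def sum_3 add_divide_distrib diff_divide_distrib)
qed

lemma bary_vertex:
  assumes "equidistant Q"
  shows "bary Q i (Q j) = (if i = j then 1 else 0)"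
proof -
  obtain d where d: "d > 0" "\<And>i j. i \<noteq> j \<Longrightarrow> dist (Q i) (Q j) = d"
    using assms by (auto simp: equidistant_def)
  have D: "dist (Q i) (Q j) = (if i = j then 0 else d)" for i j using d(2) by auto
  have "bary Q i (Q j) = 1/3 + (2 * d\<^sup>2 - 3 * (if i = j then 0 else d)\<^sup>2) / (3 * d\<^sup>2)"
    unfolding bary_def D sum_3 using exhaust_3[of i] exhaust_3[of j] by auto
  then show ?thesis using d(1) by (auto simp: field_simps)
qed

lemma continuous_on_bary: "continuous_on X (bary Q i)"
  unfolding bary_def divide_inverse by (intro continuous_intros)

text \<open>
  Both properties define closed sets that contain the vertices and are stable under the three
  maps. The second one says that points of the gasket are determined by their coordinates.
\<close>

lemma gasket_bary:
  assumes "equidistant Q" "x \<in> gasket Q"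
  shows "bary Q i x \<ge> 0" "x = (\<Sum>i\<in>UNIV. bary Q i x *\<^sub>R Q i)"
proof -
  define G where "G = {x. \<forall>i. 0 \<le> bary Q i x} \<inter> {x. x = (\<Sum>i\<in>UNIV. bary Q i x *\<^sub>R Q i)}"
  have "gasket Q \<subseteq> G"
  proof (rule gasket_subset)
    show "closed G" unfolding G_def
      by (intro closed_Int closed_Collect_all closed_Collect_le closed_Collect_eq continuous_intros
          continuous_on_bary)
    show "Q i \<in> G" for i
      using exhaust_3[of i] by (auto simp: G_def bary_vertex[OF assms(1)] sum_3)
    fix i x assume x: "x \<in> G"
    have "(\<Sum>j\<in>UNIV. bary Q j (midpoint x (Q i)) *\<^sub>R Q j) =
        (1/2) *\<^sub>R ((\<Sum>j\<in>UNIV. bary Q j x *\<^sub>R Q j) + (\<Sum>j\<in>UNIV. bary Q j (Q i) *\<^sub>R Q j))"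
      unfolding bary_midpoint by (simp add: sum_3 scaleR_add_right scaleR_add_left add_divide_distrib)
    also have "\<dots> = midpoint x (Q i)"
      using x \<open>Q i \<in> G\<close> by (simp add: G_def midpoint_def)
    finally show "gasket_map Q i x \<in> G"
      using x by (auto simp: G_def gasket_map_midpoint bary_midpoint bary_vertex[OF assms(1)])
  qed
  then show "bary Q i x \<ge> 0" "x = (\<Sum>i\<in>UNIV. bary Q i x *\<^sub>R Q i)"
    using assms(2) by (auto simp: G_def)
qed

lemma bary_le_1:
  assumes "equidistant Q" "x \<in> gasket Q"
  shows "bary Q i x \<le> 1"
  using member_le_sum[of i UNIV "\<lambda>i. bary Q i x"] gasket_bary(1)[OF assms] sum_bary[of Q x] by auto

lemma bary_eq_1_imp_vertex:
  assumes "equidistant Q" "x \<in> gasket Q" "bary Q i x = 1"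
  shows "x = Q i"
proof -
  have "(\<Sum>j\<in>UNIV - {i}. bary Q j x) = 0"
    using sum_bary[of Q x] assms(3) by (subst (asm) sum.remove[of _ i]) auto
  then have "bary Q j x = 0" if "j \<noteq> i" for j
    using that gasket_bary(1)[OF assms(1,2)] by (subst (asm) sum_nonneg_eq_0_iff) auto
  then have "(\<Sum>j\<in>UNIV. bary Q j x *\<^sub>R Q j) = Q i"
    using assms(3) by (subst sum.remove[of _ i]) auto
  then show ?thesis using gasket_bary(2)[OF assms(1,2)] by simp
qed

text \<open>
  If a point lies in the cells of \<open>i\<close> and of \<open>j\<close>, its coordinate for \<open>j\<close> is at most \<open>1/2\<close> as
  seen from the first cell and at least \<open>1/2\<close> as seen from the second.
\<close>

lemma gasket_cells_meet:
  assumes "equidistant Q" "i \<noteq> j" "x \<in> gasket Q" "y \<in> gasket Q" "gasket_map Q i x = gasket_map Q j y"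
  shows "x = Q j"
proof -
  have "bary Q j (gasket_map Q i x) = bary Q j x / 2"
    using assms(1,2) by (simp add: gasket_map_midpoint bary_midpoint bary_vertex)
  moreover have "bary Q j (gasket_map Q j y) = (bary Q j y + 1) / 2"
    using assms(1) by (simp add: gasket_map_midpoint bary_midpoint bary_vertex)
  ultimately have "bary Q j x = bary Q j y + 1" using assms(5) by simp
  then have "bary Q j x = 1"
    using gasket_bary(1)[OF assms(1,4)] bary_le_1[OF assms(1,3)] by (smt (verit))
  then show ?thesis using bary_eq_1_imp_vertex[OF assms(1,3)] by simp
qed

section \<open>One-sided derivatives and powers\<close>

text \<open>
  The slope over \<open>[0, t]\<close> is increasing in \<open>t\<close> and bounded below by the slope over \<open>[-1, 0]\<close>, so
  it converges to its infimum as \<open>t\<close> decreases to \<open>0\<close>.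
\<close>

lemma convex_right_derivative_ex:
  fixes f :: "real \<Rightarrow> real"
  assumes "convex_on UNIV f"
  obtains D where "((\<lambda>t. (f t - f 0) / t) \<longlongrightarrow> D) (at_right 0)"
proof
  define g where "g t = (f t - f 0) / t" for t
  have mono: "g s \<le> g t" if "0 < s" "s \<le> t" for s t
  proof -
    have "f ((1 - s / t) *\<^sub>R 0 + (s / t) *\<^sub>R t) \<le> (1 - s / t) * f 0 + s / t * f t"
      using that by (intro convex_onD[OF assms]) auto
    then have "f s - f 0 \<le> s * ((f t - f 0) / t)" using that by (simp add: field_simps)
    then show ?thesis using that by (simp add: g_def field_simps)
  qed
  have bound: "f 0 - f (-1) \<le> g t" if "0 < t" for t
  proof -
    define c where "c = 1 / (1 + t)"
    have c: "0 \<le> c" "c \<le> 1" "(1 + t) * c = 1" using that by (auto simp: c_def)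
    have "f ((1 - c) *\<^sub>R (-1) + c *\<^sub>R t) \<le> (1 - c) * f (-1) + c * f t"
      using c by (intro convex_onD[OF assms]) auto
    also have "(1 - c) *\<^sub>R (-1) + c *\<^sub>R t = 0" using c(3) by (simp add: algebra_simps)
    finally have "(1 + t) * f 0 \<le> (1 + t) * ((1 - c) * f (-1) + c * f t)"
      using that by (intro mult_left_mono) auto
    also have "\<dots> = ((1 + t) - (1 + t) * c) * f (-1) + ((1 + t) * c) * f t" by (simp add: algebra_simps)
    finally have "(1 + t) * f 0 \<le> t * f (-1) + f t" by (simp add: c(3))
    then show ?thesis using that by (simp add: g_def field_simps)
  qed
  have below: "bdd_below (g ` {0<..})" using bound by (auto intro!: bdd_belowI2)
  show "((\<lambda>t. (f t - f 0) / t) \<longlongrightarrow> Inf (g ` {0<..})) (at_right 0)"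
    unfolding g_def[symmetric]
  proof (rule order_tendstoI)
    fix a assume "a < Inf (g ` {0<..})"
    then have "a < g t" if "0 < t" for t using that cINF_lower[OF below, of t] by auto
    then show "\<forall>\<^sub>F t in at_right 0. a < g t"
      by (rule eventually_mono[OF eventually_at_right_less[of 0]])
  next
    fix a assume "Inf (g ` {0<..}) < a"
    then obtain s where s: "0 < s" "g s < a" using below by (subst (asm) cInf_less_iff) auto
    then have "g t < a" if "0 < t" "t < s" for t using that mono[of t s] by auto
    then show "\<forall>\<^sub>F t in at_right 0. g t < a" using s by (auto simp: eventually_at_right)
  qed
qed

lemma vector_derivative_at_rightI:
  fixes f :: "real \<Rightarrow> real"
  assumes "((\<lambda>t. (f t - f 0) / t) \<longlongrightarrow> D) (at_right 0)"
  shows "vector_derivative f (at_right 0) = D"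
proof (rule vector_derivative_within)
  show "(f has_vector_derivative D) (at_right 0)"
    using assms by (simp add: has_real_derivative_iff_has_vector_derivative[symmetric] has_field_derivative_iff)
qed simp

lemma convex_right_derivative:
  fixes f :: "real \<Rightarrow> real"
  assumes "convex_on UNIV f"
  shows "((\<lambda>t. (f t - f 0) / t) \<longlongrightarrow> vector_derivative f (at_right 0)) (at_right 0)"
  using convex_right_derivative_ex[OF assms] vector_derivative_at_rightI by metis

lemma convex_left_derivative:
  fixes f :: "real \<Rightarrow> real"
  assumes "convex_on UNIV (\<lambda>t. f (- t))"
  shows "vector_derivative f (at_left 0) = - vector_derivative (\<lambda>t. f (- t)) (at_right 0)"
proof (rule vector_derivative_within)
  have "((\<lambda>t. (f (- t) - f 0) / t) \<longlongrightarrow> vector_derivative (\<lambda>t. f (- t)) (at_right 0)) (at_right 0)"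
    using convex_right_derivative[OF assms] by simp
  then have "((\<lambda>t. - ((f (- t) - f 0) / t)) \<longlongrightarrow> - vector_derivative (\<lambda>t. f (- t)) (at_right 0)) (at_right 0)"
    by (rule tendsto_minus)
  then have "((\<lambda>t. (f t - f 0) / t) \<longlongrightarrow> - vector_derivative (\<lambda>t. f (- t)) (at_right 0)) (at_left 0)"
    by (simp add: filterlim_at_left_to_right)
  then show "(f has_vector_derivative - vector_derivative (\<lambda>t. f (- t)) (at_right 0)) (at_left 0)"
    by (simp add: has_real_derivative_iff_has_vector_derivative[symmetric] has_field_derivative_iff)
qed simp

lemma powr_diff_le:
  fixes x y s R :: real
  assumes "1 \<le> s" "0 \<le> x" "x \<le> R" "0 \<le> y" "y \<le> R"
  shows "\<bar>y powr s - x powr s\<bar> \<le> s * R powr (s - 1) * \<bar>y - x\<bar>"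
proof -
  have *: "\<bar>y powr s - x powr s\<bar> \<le> s * R powr (s - 1) * \<bar>y - x\<bar>"
    if "0 \<le> x" "x < y" "y \<le> R" for x y
  proof -
    have "\<exists>l z. x < z \<and> z < y \<and> ((\<lambda>z. z powr s) has_real_derivative l) (at z) \<and>
        y powr s - x powr s = (y - x) * l"
    proof (rule MVT)
      show "continuous_on {x..y} (\<lambda>z. z powr s)"
        using that assms(1) by (intro continuous_on_powr') (auto intro: continuous_intros)
      show "(\<lambda>z. z powr s) differentiable at z" if "x < z" for z
        using has_real_derivative_powr[of z s] that \<open>0 \<le> x\<close> real_differentiable_def by auto
    qed fact
    then obtain l z where z: "x < z" "z < y" "((\<lambda>z. z powr s) has_real_derivative l) (at z)"
      "y powr s - x powr s = (y - x) * l" by blast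
    have "l = s * z powr (s - 1)"
      using z(1,3) that(1) has_real_derivative_powr[of z s] DERIV_unique by force
    moreover have "z powr (s - 1) \<le> R powr (s - 1)"
      using z that assms by (intro powr_mono2) auto
    ultimately have "l \<le> s * R powr (s - 1)" "0 \<le> l" using assms(1) by (auto intro!: mult_left_mono)
    then have "(y - x) * l \<le> (y - x) * (s * R powr (s - 1))" "0 \<le> (y - x) * l"
      using z by (auto intro!: mult_left_mono)
    then show ?thesis using z by (simp add: mult.commute)
  qed
  show ?thesis
    using *[of x y] *[of y x] assms by (cases x y rule: linorder_cases) (auto simp: abs_minus_commute)
qed

text \<open>
  For exponents below \<open>1\<close> the difference quotients are dominated by a multiple of the
  derivative at \<open>x\<close>, however far away \<open>y\<close> is. This makes dominated convergence applicable although the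
  derivative is unbounded near \<open>0\<close>.
\<close>

lemma powr_diff_le_singular:
  fixes x y s :: real
  assumes "0 < s" "s \<le> 1" "0 < x" "0 \<le> y"
  shows "\<bar>y powr s - x powr s\<bar> \<le> x powr (s - 1) * \<bar>y - x\<bar>"
proof -
  define t where "t = y / x"
  have t: "0 \<le> t" "y = x * t" using assms by (auto simp: t_def)
  have "\<bar>t powr s - 1\<bar> \<le> \<bar>t - 1\<bar>"
  proof (cases "t \<ge> 1")
    case True
    then have "1 \<le> t powr s" using assms by (intro ge_one_powr_ge_zero) auto
    moreover have "t powr s \<le> t powr 1" using assms True by (intro powr_mono) auto
    ultimately have "1 \<le> t powr s" "t powr s \<le> t powr 1" by auto
    then show ?thesis using True by auto
  next
    case False
    have "t powr s \<le> 1" using assms t False by (intro powr_le1) auto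
    moreover have "t powr 1 \<le> t powr s" using assms t False by (intro powr_mono') auto
    ultimately have "t powr s \<le> 1" "t powr 1 \<le> t powr s" by auto
    then show ?thesis using False t by auto
  qed
  then have "x powr s * \<bar>t powr s - 1\<bar> \<le> x powr s * \<bar>t - 1\<bar>"
    by (intro mult_left_mono) auto
  moreover have "\<bar>y powr s - x powr s\<bar> = x powr s * \<bar>t powr s - 1\<bar>"
  proof -
    have "y powr s - x powr s = x powr s * (t powr s - 1)"
      using assms t by (simp add: powr_mult algebra_simps)
    then show ?thesis by (simp add: abs_mult)
  qed
  moreover have "x powr s * \<bar>t - 1\<bar> = x powr (s - 1) * \<bar>y - x\<bar>"
  proof -
    have "x powr s = x powr (s - 1) * x"
      using assms powr_add[of x "s - 1" 1] by simp
    moreover have "\<bar>y - x\<bar> = x * \<bar>t - 1\<bar>"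
      using assms t by (metis abs_mult abs_of_pos mult.right_neutral right_diff_distrib)
    ultimately show ?thesis by simp
  qed
  ultimately show ?thesis by simp
qed

lemma powr_deriv_pos:
  fixes x d s :: real
  assumes "0 < x"
  shows "((\<lambda>t. (max 0 (x + t * d) powr s - x powr s) / t) \<longlongrightarrow> s * x powr (s - 1) * d) (at_right 0)"
proof -
  have "((\<lambda>t. (x + t * d) powr s) has_real_derivative s * (x + 0 * d) powr (s - 1) * d) (at 0 within {0<..})"
    using assms by (auto intro!: derivative_eq_intros simp: powr_diff)
  then have lim: "((\<lambda>t. ((x + t * d) powr s - x powr s) / t) \<longlongrightarrow> s * x powr (s - 1) * d) (at_right 0)"
    by (simp add: has_field_derivative_iff)
  have "((\<lambda>t. x + t * d) \<longlongrightarrow> x + 0 * d) (at_right 0)" by (intro tendsto_intros)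
  then have "\<forall>\<^sub>F t in at_right 0. 0 < x + t * d" using assms by (intro order_tendstoD) auto
  then have "\<forall>\<^sub>F t in at_right 0. ((x + t * d) powr s - x powr s) / t = (max 0 (x + t * d) powr s - x powr s) / t"
    by eventually_elim auto
  then show ?thesis using lim by (rule Lim_transform_eventually[rotated])
qed

lemma abs_powr_deriv:
  fixes x d s :: real
  assumes "1 < s"
  shows "((\<lambda>t. (\<bar>x + t * d\<bar> powr s - \<bar>x\<bar> powr s) / t) \<longlongrightarrow> s * \<bar>x\<bar> powr (s - 2) * x * d) (at_right 0)"
proof -
  have pos: "((\<lambda>t. (\<bar>x + t * d\<bar> powr s - \<bar>x\<bar> powr s) / t) \<longlongrightarrow> s * \<bar>x\<bar> powr (s - 2) * x * d) (at_right 0)"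
    if "0 < x" for x d
  proof -
    have "((\<lambda>t. x + t * d) \<longlongrightarrow> x + 0 * d) (at_right 0)" by (intro tendsto_intros)
    then have "\<forall>\<^sub>F t in at_right 0. 0 < x + t * d" using that by (intro order_tendstoD) auto
    then have "\<forall>\<^sub>F t in at_right 0. (max 0 (x + t * d) powr s - x powr s) / t = (\<bar>x + t * d\<bar> powr s - \<bar>x\<bar> powr s) / t"
      by eventually_elim (use that in auto)
    moreover have "x powr (s - 1) = \<bar>x\<bar> powr (s - 2) * x"
      using that powr_add[of x "s - 2" 1] by simp
    ultimately show ?thesis
      using powr_deriv_pos[OF that, of d s] by (auto intro: Lim_transform_eventually simp: mult.assoc)
  qed
  consider "x > 0" | "x < 0" | "x = 0" by linarith
  then show ?thesis
  proof cases
    case 2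
    have "\<bar>- x + t * - d\<bar> = \<bar>x + t * d\<bar>" for t
      by (metis abs_minus_cancel minus_add_distrib mult_minus_right)
    then show ?thesis using pos[of "- x" "- d"] 2 by simp
  next
    case 3
    have "((\<lambda>t. t powr (s - 1) * \<bar>d\<bar> powr s) \<longlongrightarrow> 0 * \<bar>d\<bar> powr s) (at_right 0)"
    proof (intro tendsto_intros)
      have "((\<lambda>t::real. t powr (s - 1)) \<longlongrightarrow> 0 powr (s - 1)) (at_right 0)"
        using assms by (intro tendsto_powr') (auto simp: eventually_at_right_less intro: eventually_mono[OF eventually_at_right_less])
      then show "((\<lambda>t::real. t powr (s - 1)) \<longlongrightarrow> 0) (at_right 0)" by simp
    qed
    moreover have "\<forall>\<^sub>F t in at_right 0. t powr (s - 1) * \<bar>d\<bar> powr s = (\<bar>x + t * d\<bar> powr s - \<bar>x\<bar> powr s) / t"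
      using eventually_at_right_less[of 0]
      by eventually_elim (auto simp: 3 abs_mult powr_mult powr_diff)
    ultimately show ?thesis using 3 by (auto intro: Lim_transform_eventually)
  qed (rule pos)
qed

text \<open>
  Dominated convergence and Fatou's lemma are about sequences, so one-sided limits at \<open>0\<close> are
  taken along this fixed one.
\<close>

definition eps :: "nat \<Rightarrow> real" where "eps n = 1 / real (Suc n)"

lemma eps: "0 < eps n" "eps n \<le> 1" by (auto simp: eps_def)

lemma eps_at_right: "filterlim eps (at_right 0) sequentially"
  unfolding filterlim_at
proof (intro conjI)
  show "eps \<longlonglongrightarrow> 0" unfolding eps_def by real_asymp
qed (auto simp: eps_def)

lemma tendsto_eps: "(f \<longlongrightarrow> l) (at_right 0) \<Longrightarrow> (\<lambda>n. f (eps n)) \<longlonglongrightarrow> l"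
  by (rule filterlim_compose[OF _ eps_at_right])

lemma eps_tendsto_0: "eps \<longlonglongrightarrow> 0"
  using eps_at_right by (simp add: filterlim_at)

section \<open>Perturbation on a constraint set\<close>

lemma youngs_power_difference:
  fixes t p s :: real
  assumes "0 < t" "0 < p" "p < s"
  shows "t powr p / p - t powr s / s \<le> 1 / p - 1 / s"
proof -
  have "(t powr s) powr (p / s) * 1 powr (1 - p / s) \<le> p / s * t powr s + (1 - p / s) * 1"
    using assms by (intro Youngs_inequality_0) (auto simp: field_simps)
  then have "t powr p \<le> p / s * t powr s + (1 - p / s)"
    using assms by (simp add: powr_powr)
  then have "t powr p / p \<le> (p / s * t powr s + (1 - p / s)) / p"
    using assms by (intro divide_right_mono) auto
  also have "\<dots> = t powr s / s + (1 / p - 1 / s)"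
    using assms by (simp add: field_simps)
  finally show ?thesis by simp
qed

text \<open>
  Passes from solutions in every neighbourhood of \<open>1\<close> to one convergent sequence, by choosing
  solutions that are almost as close to \<open>1\<close> as possible.
\<close>

lemma select_near_one:
  fixes R :: "nat \<Rightarrow> real \<Rightarrow> bool"
  assumes "\<And>\<delta>. 0 < \<delta> \<Longrightarrow> \<delta> < 1 \<Longrightarrow> \<forall>\<^sub>F n in sequentially. \<exists>\<tau>. \<bar>\<tau> - 1\<bar> < \<delta> \<and> R n \<tau>"
  obtains T where "T \<longlonglongrightarrow> 1" "\<forall>\<^sub>F n in sequentially. R n (T n)"
proof -
  define D where "D n = Inf ((\<lambda>\<tau>. \<bar>\<tau> - 1\<bar>) ` {\<tau>. R n \<tau>})" for n
  have bdd: "bdd_below ((\<lambda>\<tau>. \<bar>\<tau> - 1\<bar>) ` X)" for X :: "real set" by (auto intro!: bdd_belowI2[of _ 0])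
  define T where "T n = (SOME \<tau>. R n \<tau> \<and> \<bar>\<tau> - 1\<bar> < D n + eps n)" for n
  have T: "R n (T n) \<and> \<bar>T n - 1\<bar> < D n + eps n" if "\<exists>\<tau>. R n \<tau>" for n
  proof -
    have "D n < D n + eps n" using eps by simp
    then have "\<exists>\<tau>. R n \<tau> \<and> \<bar>\<tau> - 1\<bar> < D n + eps n"
      unfolding D_def using that by (subst (asm) cInf_less_iff) (auto simp: bdd)
    then show ?thesis unfolding T_def by (rule someI_ex)
  qed
  have "\<forall>\<^sub>F n in sequentially. \<bar>T n - 1\<bar> < e" if "e > 0" for e
  proof -
    define \<delta> where "\<delta> = min (e / 2) (1 / 2)"
    have \<delta>: "0 < \<delta>" "\<delta> < 1" "\<delta> \<le> e / 2" using that by (auto simp: \<delta>_def)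
    have "\<forall>\<^sub>F n in sequentially. eps n < e / 2"
      using eps_tendsto_0 that by (intro order_tendstoD) auto
    with assms[OF \<delta>(1,2)] show ?thesis
    proof eventually_elim
      case (elim n)
      then obtain \<tau> where \<tau>: "\<bar>\<tau> - 1\<bar> < \<delta>" "R n \<tau>" by blast
      have "D n \<le> \<bar>\<tau> - 1\<bar>" unfolding D_def using \<tau>(2) by (intro cINF_lower bdd) auto
      then show ?case using T[of n] \<tau> \<delta>(3) elim(2) by (smt (verit) field_sum_of_halves)
    qed
  qed
  then have "T \<longlonglongrightarrow> 1" by (simp add: tendsto_iff dist_real_def)
  moreover have "\<forall>\<^sub>F n in sequentially. R n (T n)"
    using assms[of "1/2"] by (rule eventually_mono[OF _]) (use T in auto)
  ultimately show ?thesis using that by blast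
qed

text \<open>
  Let \<open>e, d, b\<close> be the values at a point \<open>z\<close> of functionals that are homogeneous of degrees
  \<open>p, q, s\<close>, let \<open>e', d', b'\<close> be their values at perturbed points \<open>z\<^sub>n\<close>, and put
  \<open>J = e / p + d / q - b / s\<close>. Where \<open>e + d = b\<close>, \<open>J\<close> equals the functional that \<open>z\<close> minimizes
  under this constraint, and \<open>J\<close> is maximal along the ray. The factor \<open>T n\<close> rescales \<open>z\<^sub>n\<close> back to
  the constraint set, so that \<open>J (T z\<^sub>n) \<ge> J z \<ge> J (T z)\<close>. The conclusion compares the two outer
  terms, which involves the increments of the three functionals only.
\<close>

lemma constrained_perturbation:
  fixes p q s e d b :: real and e' d' b' :: "nat \<Rightarrow> real"
  assumes exps: "0 < q" "q < p" "p < s"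
    and pos: "0 < e" "0 \<le> d" and b: "b = e + d"
    and lims: "e' \<longlonglongrightarrow> e" "d' \<longlonglongrightarrow> d" "b' \<longlonglongrightarrow> b"
    and minimal: "\<And>n \<tau>. 0 < \<tau> \<Longrightarrow> 0 < b' n \<Longrightarrow> \<tau> powr p * e' n + \<tau> powr q * d' n = \<tau> powr s * b' n \<Longrightarrow>
      (1 / p - 1 / s) * e + (1 / q - 1 / s) * d
        \<le> (1 / p - 1 / s) * (\<tau> powr p * e' n) + (1 / q - 1 / s) * (\<tau> powr q * d' n)"
  obtains T where "T \<longlonglongrightarrow> (1 :: real)"
    "\<forall>\<^sub>F n in sequentially. (b' n - b) / s
      \<le> T n powr (p - s) * ((e' n - e) / p) + T n powr (q - s) * ((d' n - d) / q)"
proof -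
  define g where "g e d b \<tau> = \<tau> powr (p - s) * e + \<tau> powr (q - s) * d - b" for e d b \<tau> :: real
  define R where "R n \<tau> \<longleftrightarrow> 0 < \<tau> \<and> g (e' n) (d' n) (b' n) \<tau> = 0" for n \<tau>
  have "\<forall>\<^sub>F n in sequentially. \<exists>\<tau>. \<bar>\<tau> - 1\<bar> < \<delta> \<and> R n \<tau>" if \<delta>: "0 < \<delta>" "\<delta> < 1" for \<delta>
  proof -
    define lo where "lo = 1 - \<delta> / 2"
    define hi where "hi = 1 + \<delta> / 2"
    have lohi: "0 < lo" "lo < 1" "1 < hi" using \<delta> by (auto simp: lo_def hi_def)
    have lim: "(\<lambda>n. g (e' n) (d' n) (b' n) \<tau>) \<longlonglongrightarrow> g e d b \<tau>" for \<tau>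
      unfolding g_def by (intro tendsto_intros lims)
    have lo1: "1 < lo powr (p - s)" "1 < lo powr (q - s)"
      using powr_less_mono2_neg[of "p - s" lo 1] powr_less_mono2_neg[of "q - s" lo 1] lohi exps by auto
    have hi1: "hi powr (p - s) < 1" "hi powr (q - s) < 1"
      using powr_less_mono2_neg[of "p - s" 1 hi] powr_less_mono2_neg[of "q - s" 1 hi] lohi exps by auto
    have "1 * e < lo powr (p - s) * e" by (intro mult_strict_right_mono lo1 pos)
    moreover have "1 * d \<le> lo powr (q - s) * d" by (intro mult_right_mono less_imp_le[OF lo1(2)] pos)
    ultimately have "e < lo powr (p - s) * e" "d \<le> lo powr (q - s) * d" by simp_all
    then have "0 < g e d b lo" by (simp add: g_def b)
    then have lo_ev: "\<forall>\<^sub>F n in sequentially. 0 < g (e' n) (d' n) (b' n) lo"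
      using lim by (intro order_tendstoD)
    have "hi powr (p - s) * e < 1 * e" by (intro mult_strict_right_mono hi1 pos)
    moreover have "hi powr (q - s) * d \<le> 1 * d" by (intro mult_right_mono less_imp_le[OF hi1(2)] pos)
    ultimately have "hi powr (p - s) * e < e" "hi powr (q - s) * d \<le> d" by simp_all
    then have "g e d b hi < 0" by (simp add: g_def b)
    then have hi_ev: "\<forall>\<^sub>F n in sequentially. g (e' n) (d' n) (b' n) hi < 0"
      using lim by (intro order_tendstoD)
    from lo_ev hi_ev show ?thesis
    proof eventually_elim
      case (elim n)
      have "continuous_on {lo..hi} (g (e' n) (d' n) (b' n))"
        unfolding g_def using lohi by (intro continuous_intros) auto
      then obtain \<tau> where "lo \<le> \<tau>" "\<tau> \<le> hi" "g (e' n) (d' n) (b' n) \<tau> = 0"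
        using IVT2'[of "g (e' n) (d' n) (b' n)" hi 0 lo] elim lohi by force
      then show ?case using \<delta> lohi by (intro exI[of _ \<tau>]) (auto simp: R_def lo_def hi_def)
    qed
  qed
  then obtain T where T: "T \<longlonglongrightarrow> 1" "\<forall>\<^sub>F n in sequentially. R n (T n)"
    using select_near_one[of R] by blast
  have "0 < b" using pos b by simp
  then have b_ev: "\<forall>\<^sub>F n in sequentially. 0 < b' n" using lims(3) by (intro order_tendstoD)
  from T(2) b_ev have "\<forall>\<^sub>F n in sequentially. (b' n - b) / s
      \<le> T n powr (p - s) * ((e' n - e) / p) + T n powr (q - s) * ((d' n - d) / q)"
  proof eventually_elim
    case (elim n)
    define t where "t = T n"
    define P where "P = t powr (p - s)"
    define W where "W = t powr (q - s)"
    have t: "0 < t" "P * e' n + W * d' n = b' n"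
      using elim(1) by (auto simp: R_def g_def t_def P_def W_def)
    define Z where "Z = t powr s"
    have Z: "0 < Z" "t powr p = Z * P" "t powr q = Z * W"
      using t(1) powr_add[of t s "p - s"] powr_add[of t s "q - s"] by (auto simp: Z_def P_def W_def)
    have constraint: "t powr p * e' n + t powr q * d' n = t powr s * b' n"
      using t(2) by (simp add: Z(2,3) Z_def[symmetric] algebra_simps flip: t(2))
    have "(1 / p - 1 / s) * e + (1 / q - 1 / s) * d
        \<le> (1 / p - 1 / s) * (t powr p * e' n) + (1 / q - 1 / s) * (t powr q * d' n)"
      by (rule minimal[OF t(1) elim(2) constraint])
    also have "\<dots> = t powr p * e' n / p + t powr q * d' n / q - (t powr p * e' n + t powr q * d' n) / s"
      by (simp add: algebra_simps diff_divide_distrib add_divide_distrib)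
    finally have 1: "(1 / p - 1 / s) * e + (1 / q - 1 / s) * d
        \<le> Z * P * e' n / p + Z * W * d' n / q - Z * b' n / s"
      unfolding constraint by (simp add: Z(2,3) Z_def[symmetric])
    have "(t powr p / p - t powr s / s) * e \<le> (1 / p - 1 / s) * e"
      using pos exps t by (intro mult_right_mono youngs_power_difference) auto
    moreover have "(t powr q / q - t powr s / s) * d \<le> (1 / q - 1 / s) * d"
      using pos exps t by (intro mult_right_mono youngs_power_difference) auto
    ultimately have "(Z * P / p - Z / s) * e + (Z * W / q - Z / s) * d
        \<le> Z * P * e' n / p + Z * W * d' n / q - Z * b' n / s"
      using 1 by (simp add: Z(2,3) Z_def[symmetric])
    then have "Z * ((b' n - b) / s) \<le> Z * (P * ((e' n - e) / p) + W * ((d' n - d) / q))"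
      using exps by (simp add: b algebra_simps diff_divide_distrib add_divide_distrib)
    then have "(b' n - b) / s \<le> P * ((e' n - e) / p) + W * ((d' n - d) / q)"
      using Z(1) by (rule mult_left_le_imp_le)
    then show ?case by (simp only: P_def W_def t_def)
  qed
  then show ?thesis using that T(1) by blast
qed

section \<open>Finite-energy functions\<close>

locale gasket_form =
  fixes Q :: "3 \<Rightarrow> real ^ 2" and A :: "real ^ 3 \<Rightarrow> real" and r p :: real
  assumes equi: "equidistant Q" and p_gt_1: "1 < p" and form: "p_form p A"
    and r_pos: "0 < r" and r_less_1: "r < 1" and renorm: "renormalizes r A"
begin

abbreviation "S \<equiv> gasket Q"
abbreviation "L \<equiv> level_energy Q r A"
abbreviation "dom0 \<equiv> energy_dom0 Q r A"

definition en :: "(real ^ 2 \<Rightarrow> real) \<Rightarrow> real" where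
  "en u = enn2real (energy Q r A u)"

definition cell_values :: "(real ^ 2 \<Rightarrow> real) \<Rightarrow> 3 list \<Rightarrow> real ^ 3" where
  "cell_values u \<omega> = (\<chi> i. u (word_map Q \<omega> (Q i)))"

lemma level_energy_eq: "L m u = (\<Sum>\<omega> | length \<omega> = m. A (cell_values u \<omega>)) / r ^ m"
  by (simp add: level_energy_def cell_values_def)

lemmas form_unfolded = form[unfolded p_form_def]

lemma A_nonneg: "0 \<le> A a"
  by (rule form_unfolded[THEN conjunct1, THEN spec])

lemma A_convex: "convex_on UNIV A"
  by (rule form_unfolded[THEN conjunct2, THEN conjunct1])

lemma A_scale: "A (t *\<^sub>R a) = \<bar>t\<bar> powr p * A a"
  by (rule form_unfolded[THEN conjunct2, THEN conjunct2, THEN conjunct1, THEN spec, THEN spec])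

lemma A_shift: "A (\<chi> i. a $ i + c) = A a"
  by (rule form_unfolded[THEN conjunct2, THEN conjunct2, THEN conjunct2, THEN conjunct1, THEN spec, THEN spec])

lemma A_truncate: "l \<le> m \<Longrightarrow> A (\<chi> i. max l (min m (a $ i))) \<le> A a"
  by (rule form_unfolded[THEN conjunct2, THEN conjunct2, THEN conjunct2, THEN conjunct2, THEN conjunct2,
        THEN conjunct1, rule_format])

lemma A_eq_0_iff: "A a = 0 \<longleftrightarrow> (\<exists>c. \<forall>i. a $ i = c)"
  by (rule form_unfolded[THEN conjunct2, THEN conjunct2, THEN conjunct2, THEN conjunct2, THEN conjunct2,
        THEN conjunct2, THEN spec])

lemma A_max_0: "A (\<chi> i. max 0 (a $ i)) \<le> A a"
proof -
  have "min (norm a) (a $ i) = a $ i" for i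
    using component_le_norm_cart[of a i] by auto
  then show ?thesis using A_truncate[of 0 "norm a" a] by simp
qed

lemma A_continuous: "continuous_on UNIV A"
  by (rule convex_on_continuous[OF open_UNIV A_convex])

text \<open>
  Modulo constants and scaling, the nonconstant triples form a compact set on which \<open>A\<close> is positive.
\<close>

lemma oscillation_le:
  obtains K where "K > 0" "\<And>a i j. \<bar>a $ i - a $ j\<bar> \<le> K * A a powr (1 / p)"
proof -
  define Z where "Z = {a :: real ^ 3. a $ 1 = 0} \<inter> sphere 0 1"
  have "compact Z" unfolding Z_def
    by (intro closed_Int_compact closed_Collect_eq continuous_intros compact_sphere)
  moreover have "axis 2 1 \<in> Z"
  proof -
    have "(axis 2 1 :: real ^ 3) $ 1 = 0" by (simp add: axis_def)
    then show ?thesis by (simp add: Z_def norm_axis_1)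
  qed
  ultimately obtain z where z: "z \<in> Z" "\<And>a. a \<in> Z \<Longrightarrow> A z \<le> A a"
    using continuous_attains_inf[of Z A] A_continuous continuous_on_subset by blast
  have "A z \<noteq> 0"
  proof
    assume "A z = 0"
    then obtain c where "\<forall>i. z $ i = c" using A_eq_0_iff by blast
    then have "z = 0" using z(1) by (auto simp: Z_def vec_eq_iff)
    then show False using z(1) by (auto simp: Z_def)
  qed
  then have Az: "A z > 0" using A_nonneg[of z] by linarith
  have lower: "norm b powr p * A z \<le> A b" if "b $ 1 = 0" for b
  proof (cases "b = 0")
    case False
    have "(1 / norm b) *\<^sub>R b \<in> Z" using that False by (simp add: Z_def)
    then have "A z \<le> A ((1 / norm b) *\<^sub>R b)" by (rule z(2))
    then have "norm b powr p * A z \<le> norm b powr p * A ((1 / norm b) *\<^sub>R b)"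
      by (intro mult_left_mono) auto
    also have "\<dots> = A (norm b *\<^sub>R ((1 / norm b) *\<^sub>R b))" by (subst (2) A_scale) simp
    finally show ?thesis using False by simp
  qed (simp add: A_nonneg)
  define K where "K = 2 / A z powr (1 / p)"
  have "\<bar>a $ i - a $ j\<bar> \<le> K * A a powr (1 / p)" for a i j
  proof -
    define b where "b = (\<chi> i. a $ i + (- a $ 1))"
    have "norm b powr p * A z \<le> A a" using lower[of b] A_shift[of a "- a $ 1"] by (simp add: b_def)
    then have "(norm b powr p * A z) powr (1 / p) \<le> A a powr (1 / p)"
      using p_gt_1 Az by (intro powr_mono2) auto
    then have "norm b * A z powr (1 / p) \<le> A a powr (1 / p)"
      using p_gt_1 Az by (simp add: powr_mult powr_powr)
    then have "2 * norm b \<le> K * A a powr (1 / p)"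
      using Az by (simp add: K_def field_simps)
    moreover have "\<bar>b $ i - b $ j\<bar> \<le> 2 * norm b"
      using component_le_norm_cart[of b i] component_le_norm_cart[of b j] by linarith
    ultimately show ?thesis by (simp add: b_def)
  qed
  moreover have "K > 0" using Az by (simp add: K_def)
  ultimately show ?thesis using that by blast
qed

lemma level_energy_nonneg: "0 \<le> L m u"
  unfolding level_energy_eq using r_pos by (intro divide_nonneg_pos sum_nonneg A_nonneg) auto

text \<open>
  The three cells of level \<open>m + 1\<close> inside a cell carry values at its vertices and at the three
  midpoints, so renormalization compares their energies with that of the large cell.
\<close>

lemma level_energy_Suc: "L m u \<le> L (Suc m) u"
proof -
  have "r * A (cell_values u \<omega>) \<le> (\<Sum>j\<in>UNIV. A (cell_values u (\<omega> @ [j])))" for \<omega>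
  proof -
    let ?w = "\<lambda>i j. u (word_map Q \<omega> (gasket_map Q i (Q j)))"
    define b :: "real ^ 3" where "b = vector [?w 2 3, ?w 1 3, ?w 1 2]"
    have "r * A (cell_values u \<omega>) \<le> subdivided_form A (cell_values u \<omega>) b"
      using renorm by (simp add: renormalizes_def)
    also have "vector [cell_values u \<omega> $ 1, b $ 3, b $ 2] = cell_values u (\<omega> @ [1])"
      and "vector [b $ 3, cell_values u \<omega> $ 2, b $ 1] = cell_values u (\<omega> @ [2])"
      and "vector [b $ 2, b $ 1, cell_values u \<omega> $ 3] = cell_values u (\<omega> @ [3])"
      by (simp_all add: vec_eq_iff forall_3 vector_3 cell_values_def b_def gasket_map_vertex
          gasket_map_commute[of Q 2 1] gasket_map_commute[of Q 3 1] gasket_map_commute[of Q 3 2])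
    then have "subdivided_form A (cell_values u \<omega>) b = (\<Sum>j\<in>UNIV. A (cell_values u (\<omega> @ [j])))"
      by (simp only: subdivided_form_def sum_3)
    finally show ?thesis .
  qed
  then have "(\<Sum>\<omega> | length \<omega> = m. r * A (cell_values u \<omega>))
      \<le> (\<Sum>\<omega> | length \<omega> = Suc m. A (cell_values u \<omega>))"
    unfolding sum_words_snoc by (intro sum_mono)
  then show ?thesis
    using r_pos by (simp add: level_energy_eq sum_distrib_left[symmetric] field_simps)
qed

lemma incseq_level_energy: "incseq (\<lambda>m. L m u)"
  by (intro incseq_SucI level_energy_Suc)

lemma energy_eq_SUP: "energy Q r A u = (SUP m. ennreal (L m u))"
  unfolding energy_def
proof (intro limI LIMSEQ_SUP)
  show "incseq (\<lambda>m. ennreal (L m u))"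
    using incseq_level_energy[of u] by (auto simp: incseq_def intro: ennreal_leI)
qed

lemma energy_finite_imp_le:
  assumes "energy Q r A u < \<infinity>"
  shows "L m u \<le> en u"
proof -
  have "ennreal (L m u) \<le> energy Q r A u" unfolding energy_eq_SUP by (rule SUP_upper) simp
  also have "energy Q r A u = ennreal (en u)" using assms by (simp add: en_def)
  finally show ?thesis by (simp add: en_def ennreal_le_iff)
qed

lemma energy_leI:
  assumes "\<And>m. L m u \<le> c"
  shows "energy Q r A u < \<infinity>" "en u \<le> c"
proof -
  have "0 \<le> c" using assms[of 0] level_energy_nonneg[of 0 u] by linarith
  have le: "energy Q r A u \<le> ennreal c"
    unfolding energy_eq_SUP using assms by (intro SUP_least ennreal_leI)
  then show "energy Q r A u < \<infinity>" using order_le_less_trans ennreal_less_top by fastforce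
  show "en u \<le> c"
    using enn2real_mono[OF le] \<open>0 \<le> c\<close> by (simp add: en_def)
qed

lemma en_nonneg: "0 \<le> en u" by (simp add: en_def)

lemma dom0D:
  assumes "u \<in> dom0"
  shows "continuous_on S u" "\<And>i. u (Q i) = 0" "\<And>m. L m u \<le> en u"
  using assms by (auto simp: energy_dom0_def energy_dom_def gasket_boundary_def energy_finite_imp_le)

lemma dom0I:
  assumes "continuous_on S u" "\<And>i. u (Q i) = 0" "\<And>m. L m u \<le> c"
  shows "u \<in> dom0" "en u \<le> c"
  using assms energy_leI[of u c] by (auto simp: energy_dom0_def energy_dom_def gasket_boundary_def)

lemma level_energy_convex:
  assumes "0 \<le> s" "s \<le> 1"
  shows "L m (\<lambda>x. (1 - s) * u x + s * v x) \<le> (1 - s) * L m u + s * L m v"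
proof -
  have "A (cell_values (\<lambda>x. (1 - s) * u x + s * v x) \<omega>)
      \<le> (1 - s) * A (cell_values u \<omega>) + s * A (cell_values v \<omega>)" for \<omega>
  proof -
    have "cell_values (\<lambda>x. (1 - s) * u x + s * v x) \<omega> =
        (1 - s) *\<^sub>R cell_values u \<omega> + s *\<^sub>R cell_values v \<omega>"
      by (simp add: cell_values_def vec_eq_iff)
    then show ?thesis using convex_onD[OF A_convex assms] by simp
  qed
  then have "(\<Sum>\<omega> | length \<omega> = m. A (cell_values (\<lambda>x. (1 - s) * u x + s * v x) \<omega>))
      \<le> (\<Sum>\<omega> | length \<omega> = m. (1 - s) * A (cell_values u \<omega>) + s * A (cell_values v \<omega>))"
    by (intro sum_mono)
  from divide_right_mono[OF this, of "r ^ m"] show ?thesis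
    using r_pos by (simp add: level_energy_eq sum.distrib sum_distrib_left[symmetric] add_divide_distrib)
qed

lemma level_energy_scale: "L m (\<lambda>x. c * u x) = \<bar>c\<bar> powr p * L m u"
proof -
  have "cell_values (\<lambda>x. c * u x) \<omega> = c *\<^sub>R cell_values u \<omega>" for \<omega>
    by (simp add: cell_values_def vec_eq_iff)
  then show ?thesis by (simp add: level_energy_eq A_scale sum_distrib_left[symmetric])
qed

lemma level_energy_max_0: "L m (\<lambda>x. max 0 (u x)) \<le> L m u"
proof -
  have "A (cell_values (\<lambda>x. max 0 (u x)) \<omega>) \<le> A (cell_values u \<omega>)" for \<omega>
    using A_max_0[of "cell_values u \<omega>"] by (simp add: cell_values_def)
  then show ?thesis
    unfolding level_energy_eq using r_pos by (intro divide_right_mono sum_mono) auto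
qed

lemma zero_in_dom0: "(\<lambda>x. 0) \<in> dom0" and en_zero: "en (\<lambda>x. 0) = 0"
proof -
  have "L m (\<lambda>x. 0) \<le> 0" for m using level_energy_scale[of m 0 "\<lambda>x. 0"] p_gt_1 by simp
  from dom0I[OF _ _ this] show "(\<lambda>x. 0) \<in> dom0" "en (\<lambda>x. 0) = 0"
    using en_nonneg[of "\<lambda>x. 0"] by auto
qed

lemma scale_in_dom0: "u \<in> dom0 \<Longrightarrow> (\<lambda>x. c * u x) \<in> dom0"
  and en_scale_le: "u \<in> dom0 \<Longrightarrow> en (\<lambda>x. c * u x) \<le> \<bar>c\<bar> powr p * en u"
proof -
  assume u: "u \<in> dom0"
  have le: "L m (\<lambda>x. c * u x) \<le> \<bar>c\<bar> powr p * en u" for m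
    using dom0D(3)[OF u] by (simp add: level_energy_scale mult_left_mono)
  have cont: "continuous_on S (\<lambda>x. c * u x)"
    using dom0D(1)[OF u] by (intro continuous_intros)
  show "(\<lambda>x. c * u x) \<in> dom0" "en (\<lambda>x. c * u x) \<le> \<bar>c\<bar> powr p * en u"
    by (rule dom0I[OF cont _ le], simp add: dom0D(2)[OF u])+
qed

lemma en_scale:
  assumes "u \<in> dom0"
  shows "en (\<lambda>x. c * u x) = \<bar>c\<bar> powr p * en u"
proof (cases "c = 0")
  case False
  have "en (\<lambda>x. (1 / c) * (c * u x)) \<le> \<bar>1 / c\<bar> powr p * en (\<lambda>x. c * u x)"
    by (rule en_scale_le[OF scale_in_dom0[OF assms]])
  then have "\<bar>c\<bar> powr p * en u \<le> en (\<lambda>x. c * u x)"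
    using False by (simp add: powr_divide field_simps)
  then show ?thesis using en_scale_le[OF assms, of c] by linarith
qed (use p_gt_1 en_zero in simp)

lemma convex_comb_in_dom0:
  assumes "u \<in> dom0" "v \<in> dom0" "0 \<le> s" "s \<le> 1"
  shows "(\<lambda>x. (1 - s) * u x + s * v x) \<in> dom0"
    and "en (\<lambda>x. (1 - s) * u x + s * v x) \<le> (1 - s) * en u + s * en v"
proof -
  have le: "L m (\<lambda>x. (1 - s) * u x + s * v x) \<le> (1 - s) * en u + s * en v" for m
    using level_energy_convex[OF assms(3,4), of m u v] dom0D(3)[OF assms(1)] dom0D(3)[OF assms(2)] assms(3,4)
    by (smt (verit) mult_left_mono)
  have cont: "continuous_on S (\<lambda>x. (1 - s) * u x + s * v x)"
    using dom0D(1)[OF assms(1)] dom0D(1)[OF assms(2)] by (intro continuous_intros)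
  show "(\<lambda>x. (1 - s) * u x + s * v x) \<in> dom0"
    "en (\<lambda>x. (1 - s) * u x + s * v x) \<le> (1 - s) * en u + s * en v"
    by (rule dom0I[OF cont _ le], simp add: dom0D(2)[OF assms(1)] dom0D(2)[OF assms(2)])+
qed

lemma add_in_dom0:
  assumes "u \<in> dom0" "v \<in> dom0"
  shows "(\<lambda>x. u x + t * v x) \<in> dom0"
proof -
  have "(\<lambda>x. 2 * ((1 - 1/2) * u x + 1/2 * (t * v x))) \<in> dom0"
    using assms by (intro scale_in_dom0 convex_comb_in_dom0) auto
  then show ?thesis by simp
qed

lemma convex_on_en:
  assumes "u \<in> dom0" "v \<in> dom0"
  shows "convex_on UNIV (\<lambda>t. en (\<lambda>x. u x + t * v x))"
proof (rule convex_onI)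
  fix s x y :: real assume "0 < s" "s < 1"
  then have "en (\<lambda>z. (1 - s) * (u z + x * v z) + s * (u z + y * v z)) \<le>
      (1 - s) * en (\<lambda>z. u z + x * v z) + s * en (\<lambda>z. u z + y * v z)"
    using assms by (intro convex_comb_in_dom0 add_in_dom0) auto
  moreover have "(1 - s) * (u z + x * v z) + s * (u z + y * v z) = u z + ((1 - s) *\<^sub>R x + s *\<^sub>R y) * v z" for z
    by (simp add: algebra_simps)
  ultimately show "en (\<lambda>z. u z + ((1 - s) *\<^sub>R x + s *\<^sub>R y) * v z) \<le>
      (1 - s) * en (\<lambda>z. u z + x * v z) + s * en (\<lambda>z. u z + y * v z)" by simp
qed simp

lemma max_0_in_dom0:
  assumes "u \<in> dom0"
  shows "(\<lambda>x. max 0 (u x)) \<in> dom0" "en (\<lambda>x. max 0 (u x)) \<le> en u"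
proof -
  have le: "L m (\<lambda>x. max 0 (u x)) \<le> en u" for m
    using level_energy_max_0[of m u] dom0D(3)[OF assms, of m] by linarith
  have cont: "continuous_on S (\<lambda>x. max 0 (u x))"
    using dom0D(1)[OF assms] by (intro continuous_intros)
  show "(\<lambda>x. max 0 (u x)) \<in> dom0" "en (\<lambda>x. max 0 (u x)) \<le> en u"
    by (rule dom0I[OF cont _ le], simp add: dom0D(2)[OF assms])+
qed

lemma abs_in_dom0:
  assumes "u \<in> dom0"
  shows "(\<lambda>x. \<bar>u x\<bar>) \<in> dom0"
proof -
  have "(\<lambda>x. max 0 (u x) + 1 * max 0 (-1 * u x)) \<in> dom0"
    using assms by (intro add_in_dom0 max_0_in_dom0 scale_in_dom0)
  moreover have "max 0 (u x) + 1 * max 0 (-1 * u x) = \<bar>u x\<bar>" for x by auto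
  ultimately show ?thesis by simp
qed

lemma level_energy_tendsto:
  assumes lim: "\<And>x. x \<in> S \<Longrightarrow> (\<lambda>n. w n x) \<longlonglongrightarrow> u x"
  shows "(\<lambda>n. L m (w n)) \<longlonglongrightarrow> L m u"
proof -
  have "(\<lambda>n. A (cell_values (w n) \<omega>)) \<longlonglongrightarrow> A (cell_values u \<omega>)" for \<omega>
  proof (rule continuous_on_tendsto_compose[OF A_continuous])
    show "(\<lambda>n. cell_values (w n) \<omega>) \<longlonglongrightarrow> cell_values u \<omega>"
      unfolding cell_values_def by (intro tendsto_vec_lambda lim word_map_vertex_in_gasket)
  qed auto
  then show ?thesis
    unfolding level_energy_eq divide_inverse by (intro tendsto_intros)
qed

text \<open>
  The energy is the supremum of the energies of finite level, each of which depends
  continuously on finitely many values of the function.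
\<close>

lemma en_lower_semicontinuous:
  assumes w: "\<And>n. w n \<in> dom0" and lim: "\<And>x. x \<in> S \<Longrightarrow> (\<lambda>n. w n x) \<longlonglongrightarrow> u x"
    and cont: "continuous_on S u" and c: "(\<lambda>n. en (w n)) \<longlonglongrightarrow> c"
  shows "u \<in> dom0" "en u \<le> c"
proof -
  have le: "L m u \<le> c" for m
  proof (rule LIMSEQ_le[OF _ c])
    show "(\<lambda>n. L m (w n)) \<longlonglongrightarrow> L m u" by (rule level_energy_tendsto[OF lim])
    show "\<exists>N. \<forall>n\<ge>N. L m (w n) \<le> en (w n)" by (intro exI allI impI dom0D(3)[OF w])
  qed
  have boundary: "u (Q i) = 0" for i
    using lim[OF vertex_in_gasket, of i] by (simp add: dom0D(2)[OF w] LIMSEQ_const_iff)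
  show "u \<in> dom0" "en u \<le> c" using dom0I[OF cont boundary le] by simp_all
qed

section \<open>Equicontinuity and compactness\<close>

definition contraction :: real where "contraction = r powr (1 / p)"

lemma contraction: "0 < contraction" "contraction < 1"
  using r_pos r_less_1 p_gt_1 powr_less_mono2[of "1 / p" r 1] by (auto simp: contraction_def)

text \<open>
  Along a chain of nested cells the oscillation over the vertices decays geometrically, so a
  geometric series controls the oscillation over a whole cell.
\<close>

lemma cell_oscillation:
  obtains K where "K > 0"
    "\<And>u \<omega> i x. u \<in> dom0 \<Longrightarrow> x \<in> S \<Longrightarrow>
      \<bar>u (word_map Q \<omega> x) - u (word_map Q \<omega> (Q i))\<bar> \<le> K * contraction ^ length \<omega> * en u powr (1 / p)"
proof -
  obtain K where K: "K > 0" "\<And>a i j. \<bar>a $ i - a $ j\<bar> \<le> K * A a powr (1 / p)"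
    using oscillation_le by blast
  define K' where "K' = K / (1 - contraction)"
  have "K' > 0" using K(1) contraction by (simp add: K'_def)
  moreover have "\<bar>u (word_map Q \<omega> x) - u (word_map Q \<omega> (Q i))\<bar> \<le> K' * contraction ^ length \<omega> * en u powr (1 / p)"
    if u: "u \<in> dom0" and x: "x \<in> S" for u \<omega> i x
  proof -
    define e where "e = en u powr (1 / p)"
    have e: "0 \<le> e" by (simp add: e_def)
    have vertex: "\<bar>u (word_map Q \<omega> (Q j)) - u (word_map Q \<omega> (Q i))\<bar> \<le> K * contraction ^ length \<omega> * e" for \<omega> i j
    proof -
      have "A (cell_values u \<omega>) \<le> (\<Sum>\<omega>' | length \<omega>' = length \<omega>. A (cell_values u \<omega>'))"
        by (intro member_le_sum A_nonneg) auto
      also have "\<dots> = r ^ length \<omega> * L (length \<omega>) u" using r_pos by (simp add: level_energy_eq)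
      also have "\<dots> \<le> r ^ length \<omega> * en u" using r_pos dom0D(3)[OF u] by (intro mult_left_mono) auto
      finally have "A (cell_values u \<omega>) powr (1 / p) \<le> (r ^ length \<omega> * en u) powr (1 / p)"
        using p_gt_1 A_nonneg by (intro powr_mono2) auto
      also have "\<dots> = contraction ^ length \<omega> * e"
        using r_pos en_nonneg by (simp add: powr_mult e_def contraction_def powr_powr
            flip: powr_realpow)
      finally have "K * A (cell_values u \<omega>) powr (1 / p) \<le> K * (contraction ^ length \<omega> * e)"
        using K(1) by (intro mult_left_mono) auto
      then show ?thesis
        using K(2)[of "cell_values u \<omega>" j i] by (simp add: cell_values_def mult.assoc)
    qed
    have junction: "\<bar>u (word_map Q \<omega> (word_map Q \<eta> (Q j))) - u (word_map Q \<omega> (Q i))\<bar>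
        \<le> K' * contraction ^ length \<omega> * e" for \<eta> \<omega> i j
    proof (induction \<eta> arbitrary: \<omega> i)
      case Nil
      have "K \<le> K'" using K(1) contraction by (simp add: K'_def field_simps)
      then have "K * contraction ^ length \<omega> * e \<le> K' * contraction ^ length \<omega> * e"
        using contraction e by (intro mult_right_mono) auto
      then show ?case using vertex[of \<omega> j i] by simp
    next
      case (Cons l \<eta>)
      have "\<bar>u (word_map Q \<omega> (word_map Q (l # \<eta>) (Q j))) - u (word_map Q \<omega> (Q l))\<bar>
          \<le> K' * contraction ^ Suc (length \<omega>) * e"
        using Cons.IH[of "\<omega> @ [l]" l] by (simp add: gasket_map_vertex)
      moreover have "K' * contraction ^ Suc (length \<omega>) * e + K * contraction ^ length \<omega> * e
          = (K' * contraction + K) * contraction ^ length \<omega> * e"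
        by (simp add: algebra_simps)
      moreover have "K' * contraction + K = K'"
        using contraction by (simp add: K'_def field_simps)
      ultimately show ?case using vertex[of \<omega> l i] by (smt (verit))
    qed
    have "\<bar>u (word_map Q \<omega> x) - u (word_map Q \<omega> (Q i))\<bar> \<le> K' * contraction ^ length \<omega> * e"
    proof (rule continuous_le_on_closure[where S="junction_points Q" and x=x
          and f="\<lambda>x. \<bar>u (word_map Q \<omega> x) - u (word_map Q \<omega> (Q i))\<bar>"])
      have "continuous_on S (\<lambda>x. u (word_map Q \<omega> x))"
        using dom0D(1)[OF u] by (rule continuous_on_compose2[OF _ continuous_on_word_map])
          (auto intro: word_map_in_gasket)
      then show "continuous_on (closure (junction_points Q)) (\<lambda>x. \<bar>u (word_map Q \<omega> x) - u (word_map Q \<omega> (Q i))\<bar>)"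
        unfolding gasket_eq_closure by (intro continuous_intros)
      show "x \<in> closure (junction_points Q)" using x by (simp add: gasket_eq_closure)
      show "\<bar>u (word_map Q \<omega> x) - u (word_map Q \<omega> (Q i))\<bar> \<le> K' * contraction ^ length \<omega> * e"
        if "x \<in> junction_points Q" for x
        using that junction by (auto simp: junction_points_def)
    qed
    then show ?thesis by (simp add: e_def)
  qed
  ultimately show ?thesis using that by blast
qed

lemma sup_bound:
  obtains K where "K > 0" "\<And>u x. u \<in> dom0 \<Longrightarrow> x \<in> S \<Longrightarrow> \<bar>u x\<bar> \<le> K * en u powr (1 / p)"
proof -
  obtain K where K: "K > 0" "\<And>u \<omega> i x. u \<in> dom0 \<Longrightarrow> x \<in> S \<Longrightarrow>
      \<bar>u (word_map Q \<omega> x) - u (word_map Q \<omega> (Q i))\<bar> \<le> K * contraction ^ length \<omega> * en u powr (1 / p)"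
    using cell_oscillation by blast
  have "\<bar>u x\<bar> \<le> K * en u powr (1 / p)" if "u \<in> dom0" "x \<in> S" for u x
    using K(2)[OF that, of "[]" 1] dom0D(2)[OF that(1), of 1] by simp
  then show ?thesis using that K(1) by blast
qed

text \<open>
  Points closer than the least distance between disjoint cells of level \<open>m\<close> lie in two cells
  that meet, and the oscillation over these two cells is small. This gives equicontinuity.
\<close>

lemma disjoint_cells_separated:
  obtains \<delta> where "\<delta> > 0"
    "\<And>\<omega> \<omega>' x y. length \<omega> = m \<Longrightarrow> length \<omega>' = m \<Longrightarrow> word_map Q \<omega> ` S \<inter> word_map Q \<omega>' ` S = {} \<Longrightarrow>
      x \<in> word_map Q \<omega> ` S \<Longrightarrow> y \<in> word_map Q \<omega>' ` S \<Longrightarrow> \<delta> \<le> dist x y"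
proof -
  let ?C = "\<lambda>\<omega>. word_map Q \<omega> ` S"
  have "\<exists>d>0. ?C \<omega> \<inter> ?C \<omega>' = {} \<longrightarrow> (\<forall>x\<in>?C \<omega>. \<forall>y\<in>?C \<omega>'. d \<le> dist x y)" for \<omega> \<omega>'
  proof (cases "?C \<omega> \<inter> ?C \<omega>' = {}")
    case True
    have "compact (?C \<omega>)" for \<omega>
      by (intro compact_continuous_image continuous_on_word_map compact_gasket)
    then show ?thesis using separate_compact_closed[of "?C \<omega>" "?C \<omega>'"] True compact_imp_closed by blast
  qed (auto intro: exI[of _ 1])
  then obtain d where d: "\<And>\<omega> \<omega>'. d \<omega> \<omega>' > 0"
    "\<And>\<omega> \<omega>' x y. ?C \<omega> \<inter> ?C \<omega>' = {} \<Longrightarrow> x \<in> ?C \<omega> \<Longrightarrow> y \<in> ?C \<omega>' \<Longrightarrow> d \<omega> \<omega>' \<le> dist x y"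
    by metis
  define P where "P = {\<omega> :: 3 list. length \<omega> = m} \<times> {\<omega> :: 3 list. length \<omega> = m}"
  have P: "finite P" "P \<noteq> {}" by (auto simp: P_def intro: exI[of _ "replicate m 1"])
  define \<delta> where "\<delta> = Min (case_prod d ` P)"
  have \<delta>_pos: "\<delta> > 0" unfolding \<delta>_def using P d(1) by (subst Min_gr_iff) auto
  have \<delta>_le: "\<delta> \<le> d \<omega> \<omega>'" if "length \<omega> = m" "length \<omega>' = m" for \<omega> \<omega>'
    unfolding \<delta>_def using P(1) that by (intro Min_le) (auto simp: P_def)
  show ?thesis
    by (rule that[OF \<delta>_pos]) (rule order_trans[OF \<delta>_le d(2)], assumption+)
qed

lemma equicontinuous:
  assumes "0 < e"
  obtains \<delta> where "\<delta> > 0"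
    "\<And>u x y. u \<in> dom0 \<Longrightarrow> en u \<le> M \<Longrightarrow> x \<in> S \<Longrightarrow> y \<in> S \<Longrightarrow> dist x y < \<delta> \<Longrightarrow> \<bar>u x - u y\<bar> < e"
proof -
  obtain K where K: "K > 0" "\<And>u \<omega> i x. u \<in> dom0 \<Longrightarrow> x \<in> S \<Longrightarrow>
      \<bar>u (word_map Q \<omega> x) - u (word_map Q \<omega> (Q i))\<bar> \<le> K * contraction ^ length \<omega> * en u powr (1 / p)"
    using cell_oscillation by blast
  have "(\<lambda>m. 4 * (K * contraction ^ m * M powr (1 / p))) \<longlonglongrightarrow> 4 * (K * 0 * M powr (1 / p))"
    using contraction by (intro tendsto_intros LIMSEQ_realpow_zero) auto
  then have "\<forall>\<^sub>F m in sequentially. 4 * (K * contraction ^ m * M powr (1 / p)) < e"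
    using assms by (intro order_tendstoD) auto
  then obtain m where m: "4 * (K * contraction ^ m * M powr (1 / p)) < e"
    by (auto simp: eventually_sequentially)
  obtain \<delta> where \<delta>: "\<delta> > 0"
    "\<And>\<omega> \<omega>' x y. length \<omega> = m \<Longrightarrow> length \<omega>' = m \<Longrightarrow> word_map Q \<omega> ` S \<inter> word_map Q \<omega>' ` S = {} \<Longrightarrow>
      x \<in> word_map Q \<omega> ` S \<Longrightarrow> y \<in> word_map Q \<omega>' ` S \<Longrightarrow> \<delta> \<le> dist x y"
    using disjoint_cells_separated[of m] by blast
  have "\<bar>u x - u y\<bar> < e" if u: "u \<in> dom0" "en u \<le> M" and xy: "x \<in> S" "y \<in> S" "dist x y < \<delta>" for u x y
  proof -
    have osc: "\<bar>u (word_map Q \<omega> x) - u (word_map Q \<omega> y)\<bar> \<le> 2 * (K * contraction ^ m * M powr (1 / p))"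
      if "length \<omega> = m" "x \<in> S" "y \<in> S" for \<omega> x y
    proof -
      have "en u powr (1 / p) \<le> M powr (1 / p)" using u en_nonneg p_gt_1 by (intro powr_mono2) auto
      then have "K * contraction ^ m * en u powr (1 / p) \<le> K * contraction ^ m * M powr (1 / p)"
        using K(1) contraction by (intro mult_left_mono) auto
      then show ?thesis using K(2)[OF u(1), of _ \<omega> 1] that by (smt (verit))
    qed
    obtain \<omega> x' where x': "length \<omega> = m" "x' \<in> S" "x = word_map Q \<omega> x'"
      using gasket_in_cell[OF xy(1)] by blast
    obtain \<omega>' y' where y': "length \<omega>' = m" "y' \<in> S" "y = word_map Q \<omega>' y'"
      using gasket_in_cell[OF xy(2)] by blast
    have "word_map Q \<omega> ` S \<inter> word_map Q \<omega>' ` S \<noteq> {}"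
      using \<delta>(2)[OF x'(1) y'(1), of x y] x' y' xy(3) by fastforce
    then obtain z z' where z: "z \<in> S" "z' \<in> S" "word_map Q \<omega> z = word_map Q \<omega>' z'" by auto
    show ?thesis
      using osc[OF x'(1,2) z(1)] osc[OF y'(1,2) z(2)] m by (simp add: x'(3) y'(3) z(3))
  qed
  then show ?thesis using that \<delta>(1) by blast
qed

lemma compactness:
  assumes w: "\<And>n. w n \<in> dom0" and M: "\<And>n. en (w n) \<le> M"
  obtains k u l where "strict_mono (k :: nat \<Rightarrow> nat)" "u \<in> dom0"
    "\<And>x. x \<in> S \<Longrightarrow> (\<lambda>n. w (k n) x) \<longlonglongrightarrow> u x"
    "(\<lambda>n. en (w (k n))) \<longlonglongrightarrow> l" "en u \<le> l"
proof -
  obtain K where K: "K > 0" "\<And>u x. u \<in> dom0 \<Longrightarrow> x \<in> S \<Longrightarrow> \<bar>u x\<bar> \<le> K * en u powr (1 / p)"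
    using sup_bound by blast
  have "bounded (range (\<lambda>n. en (w n)))"
    using M en_nonneg by (intro boundedI[of _ M]) auto
  then obtain k0 l where k0: "strict_mono k0" "(\<lambda>n. en (w (k0 n))) \<longlonglongrightarrow> l"
    using bounded_imp_convergent_subsequence[of "\<lambda>n. en (w n)"] by (auto simp: o_def)
  obtain u k1 where k1: "continuous_on S u" "strict_mono (k1 :: nat \<Rightarrow> nat)"
    "\<And>e. 0 < e \<Longrightarrow> \<exists>N. \<forall>n x. n \<ge> N \<and> x \<in> S \<longrightarrow> norm (w (k0 (k1 n)) x - u x) < e"
  proof (rule Arzela_Ascoli[OF compact_gasket, of Q "\<lambda>n. w (k0 n)" "K * M powr (1 / p)"])
    show "norm (w (k0 n) x) \<le> K * M powr (1 / p)" if "x \<in> S" for n x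
    proof -
      have "K * en (w (k0 n)) powr (1 / p) \<le> K * M powr (1 / p)"
        using K(1) M en_nonneg p_gt_1 by (intro mult_left_mono powr_mono2) auto
      then show ?thesis using K(2)[OF w that, of "k0 n"] by simp
    qed
    show "\<exists>d>0. \<forall>n y. y \<in> S \<and> norm (x - y) < d \<longrightarrow> norm (w (k0 n) x - w (k0 n) y) < e"
      if x: "x \<in> S" and e: "0 < e" for x e
    proof -
      obtain \<delta> where "\<delta> > 0"
        "\<And>u x y. u \<in> dom0 \<Longrightarrow> en u \<le> M \<Longrightarrow> x \<in> S \<Longrightarrow> y \<in> S \<Longrightarrow> dist x y < \<delta> \<Longrightarrow> \<bar>u x - u y\<bar> < e"
        using equicontinuous[OF e, of M] by blast
      then show ?thesis using w M x by (intro exI[of _ \<delta>]) (simp add: dist_norm)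
    qed
  qed (rule that)
  have lim: "(\<lambda>n. w (k0 (k1 n)) x) \<longlonglongrightarrow> u x" if "x \<in> S" for x
    using k1(3) that by (intro LIMSEQ_I) blast
  have liml: "(\<lambda>n. en (w (k0 (k1 n)))) \<longlonglongrightarrow> l"
    using LIMSEQ_subseq_LIMSEQ[OF k0(2) k1(2)] by (simp add: o_def)
  show ?thesis
  proof (rule that[of "k0 \<circ> k1" u l])
    show "strict_mono (k0 \<circ> k1)" using k0(1) k1(2) by (rule strict_mono_o)
    show "u \<in> dom0" "en u \<le> l"
      using en_lower_semicontinuous[of "\<lambda>n. w (k0 (k1 n))", OF w lim k1(1) liml] by simp_all
  qed (use lim liml in simp_all)
qed

section \<open>Gluing and cut-off functions\<close>

lemma bary_Q: "bary Q i (Q j) = (if i = j then 1 else 0)"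
  by (rule bary_vertex[OF equi])

definition compatible :: "(3 \<Rightarrow> real ^ 2 \<Rightarrow> real) \<Rightarrow> bool" where
  "compatible f \<longleftrightarrow> (\<forall>i j. i \<noteq> j \<longrightarrow> f i (Q j) = f j (Q i))"

text \<open>
  The function that equals \<open>f i\<close>, transported by the \<open>i\<close>-th map, on the \<open>i\<close>-th cell of first
  level. Compatibility makes the value unique at the midpoints, which lie in two cells.
\<close>

definition glue :: "(3 \<Rightarrow> real ^ 2 \<Rightarrow> real) \<Rightarrow> real ^ 2 \<Rightarrow> real" where
  "glue f x = (THE c. \<exists>i y. y \<in> S \<and> x = gasket_map Q i y \<and> c = f i y)"

lemma glue_eq:
  assumes "compatible f" "y \<in> S"
  shows "glue f (gasket_map Q i y) = f i y"
  unfolding glue_def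
proof (rule the_equality)
  show "\<exists>i' y'. y' \<in> S \<and> gasket_map Q i y = gasket_map Q i' y' \<and> f i y = f i' y'"
    using assms(2) by auto
  fix c assume "\<exists>i' y'. y' \<in> S \<and> gasket_map Q i y = gasket_map Q i' y' \<and> c = f i' y'"
  then obtain j z where z: "z \<in> S" "gasket_map Q i y = gasket_map Q j z" "c = f j z" by auto
  show "c = f i y"
  proof (cases "i = j")
    case True
    then have "dist y z = 0" using z(2) dist_gasket_map[of Q j y z] by simp
    then show ?thesis using True z(3) by simp
  next
    case False
    have "y = Q j" "z = Q i"
      using gasket_cells_meet[OF equi False assms(2) z(1,2)]
        gasket_cells_meet[OF equi False[symmetric] z(1) assms(2) z(2)[symmetric]] by auto
    then show ?thesis using z(3) assms(1) False by (simp add: compatible_def)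
  qed
qed

lemma glue_vertex: "compatible f \<Longrightarrow> glue f (Q i) = f i (Q i)"
  using glue_eq[of f "Q i" i] by (simp add: gasket_map_vertex vertex_in_gasket)

lemma continuous_on_glue:
  assumes "compatible f" "\<And>i. continuous_on S (f i)"
  shows "continuous_on S (glue f)"
proof -
  have "continuous_on (\<Union>i\<in>UNIV. gasket_map Q i ` S) (glue f)"
  proof (rule continuous_on_closed_Union)
    show "closed (gasket_map Q i ` S)" for i
      by (intro compact_imp_closed compact_continuous_image continuous_on_gasket_map compact_gasket)
    show "continuous_on (gasket_map Q i ` S) (glue f)" for i
    proof (rule continuous_on_eq)
      have inv: "2 *\<^sub>R gasket_map Q i y - Q i = y" for y
        by (simp add: gasket_map_midpoint midpoint_def)
      show "continuous_on (gasket_map Q i ` S) (\<lambda>x. f i (2 *\<^sub>R x - Q i))"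
        by (rule continuous_on_compose2[OF assms(2)]) (auto intro!: continuous_intros simp: inv)
      show "f i (2 *\<^sub>R x - Q i) = glue f x" if "x \<in> gasket_map Q i ` S" for x
        using that by (auto simp: inv glue_eq[OF assms(1)])
    qed
  qed simp
  then show ?thesis by (simp add: gasket_self_similar)
qed

lemma level_energy_glue:
  assumes "compatible f"
  shows "L (Suc m) (glue f) = (\<Sum>j\<in>UNIV. L m (f j)) / r"
proof -
  have "cell_values (glue f) (j # \<omega>) = cell_values (f j) \<omega>" for j \<omega>
    by (simp add: cell_values_def glue_eq[OF assms] word_map_vertex_in_gasket)
  then show ?thesis
    by (simp add: level_energy_eq sum_words_Cons sum_divide_distrib[symmetric])
qed

text \<open>
  The minimizer need not be unique; any choice serves.
\<close>

definition midpoint_values :: "real ^ 3 \<Rightarrow> real ^ 3" where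
  "midpoint_values a = (SOME b. subdivided_form A a b = r * A a)"

definition child :: "real ^ 3 \<Rightarrow> 3 \<Rightarrow> real ^ 3" where
  "child a j = (let b = midpoint_values a in
     if j = 1 then vector [a $ 1, b $ 3, b $ 2]
     else if j = 2 then vector [b $ 3, a $ 2, b $ 1]
     else vector [b $ 2, b $ 1, a $ 3])"

lemma sum_child: "(\<Sum>j\<in>UNIV. A (child a j)) = r * A a"
proof -
  have "subdivided_form A a (midpoint_values a) = r * A a"
    unfolding midpoint_values_def
    by (rule someI_ex) (use renorm in \<open>simp add: renormalizes_def\<close>)
  then show ?thesis by (simp add: sum_3 child_def Let_def subdivided_form_def)
qed

lemma child_le: "A (child a j) \<le> r * A a"
  unfolding sum_child[symmetric] by (intro member_le_sum A_nonneg) auto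

lemma child_vertex: "child a i $ i = a $ i"
  using exhaust_3[of i] by (auto simp: child_def Let_def vector_3)

lemma child_commute: "child a i $ j = child a j $ i"
  using exhaust_3[of i] exhaust_3[of j] by (auto simp: child_def Let_def vector_3)

text \<open>
  Each of \<open>n\<close> subdivisions takes energy-minimizing values at the new midpoints; inside the cells of
  level \<open>n\<close> the function is affine.
\<close>

fun minimal_approx :: "nat \<Rightarrow> real ^ 3 \<Rightarrow> real ^ 2 \<Rightarrow> real" where
  "minimal_approx 0 a = (\<lambda>x. \<Sum>i\<in>UNIV. bary Q i x * a $ i)"
| "minimal_approx (Suc n) a = glue (\<lambda>j. minimal_approx n (child a j))"

lemma minimal_approx_vertex: "minimal_approx n a (Q i) = a $ i"
  and compatible_minimal_approx: "compatible (\<lambda>j. minimal_approx n (child a j))"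
proof -
  have "\<forall>a i. minimal_approx n a (Q i) = a $ i"
  proof (induction n)
    case 0
    show ?case by (simp add: bary_Q if_distrib[of "\<lambda>c. c * _"] cong: if_cong)
  next
    case (Suc n)
    then have "compatible (\<lambda>j. minimal_approx n (child a j))" for a
      by (simp add: compatible_def child_commute)
    then show ?case using Suc by (simp add: glue_vertex child_vertex)
  qed
  then show "minimal_approx n a (Q i) = a $ i" "compatible (\<lambda>j. minimal_approx n (child a j))"
    by (auto simp: compatible_def child_commute)
qed

lemma continuous_on_minimal_approx: "continuous_on S (minimal_approx n a)"
proof (induction n arbitrary: a)
  case 0
  show ?case unfolding minimal_approx.simps by (intro continuous_intros continuous_on_bary)
next
  case (Suc n)
  show ?case
    unfolding minimal_approx.simps by (rule continuous_on_glue[OF compatible_minimal_approx Suc])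
qed

lemma level_energy_minimal_approx: "m \<le> n \<Longrightarrow> L m (minimal_approx n a) = A a"
proof (induction m arbitrary: n a)
  case 0
  have "cell_values (minimal_approx n a) [] = a"
    by (simp add: cell_values_def minimal_approx_vertex vec_eq_iff)
  then show ?case by (simp add: level_energy_eq)
next
  case (Suc m)
  then obtain n' where n: "n = Suc n'" "m \<le> n'" by (cases n) auto
  have "L (Suc m) (minimal_approx n a) = (\<Sum>j\<in>UNIV. A (child a j)) / r"
    by (simp add: n(1) level_energy_glue[OF compatible_minimal_approx] Suc.IH[OF n(2)])
  then show ?case using r_pos by (simp add: sum_child)
qed

text \<open>
  The energy of a cell shrinks at least by the factor \<open>r\<close> with each level, and it bounds the oscillation
  of the vertex values, hence the change made by refining the interpolation.
\<close>

lemma minimal_approx_step: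
  obtains K where
    "\<And>n a x. x \<in> S \<Longrightarrow>
      \<bar>minimal_approx (Suc n) a x - minimal_approx n a x\<bar> \<le> K * contraction ^ n * A a powr (1 / p)"
proof -
  obtain K where K: "K > 0" "\<And>a i j. \<bar>a $ i - a $ j\<bar> \<le> K * A a powr (1 / p)"
    using oscillation_le by blast
  have child_powr: "A (child a j) powr (1 / p) \<le> contraction * A a powr (1 / p)" for a j
  proof -
    have "A (child a j) powr (1 / p) \<le> (r * A a) powr (1 / p)"
      using p_gt_1 by (intro powr_mono2 child_le A_nonneg) auto
    then show ?thesis using r_pos A_nonneg by (simp add: contraction_def powr_mult)
  qed
  have affine: "\<bar>minimal_approx 0 a x - a $ j\<bar> \<le> K * A a powr (1 / p)" if "x \<in> S" for a x j
  proof -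
    have "minimal_approx 0 a x - a $ j = (\<Sum>i\<in>UNIV. bary Q i x * (a $ i - a $ j))"
      using sum_bary[of Q x]
      by (simp add: right_diff_distrib sum_subtractf sum_distrib_right[symmetric])
    also have "\<bar>\<dots>\<bar> \<le> (\<Sum>i\<in>UNIV. bary Q i x * (K * A a powr (1 / p)))"
      using gasket_bary(1)[OF equi that] K(2)
      by (intro order_trans[OF sum_abs] sum_mono) (simp add: abs_mult mult_left_mono)
    also have "\<dots> = K * A a powr (1 / p)"
      using sum_bary[of Q x] by (simp add: sum_distrib_right[symmetric])
    finally show ?thesis .
  qed
  have "\<bar>minimal_approx (Suc n) a x - minimal_approx n a x\<bar> \<le> 2 * K * contraction ^ n * A a powr (1 / p)"
    if "x \<in> S" for n a x
    using that
  proof (induction n arbitrary: a x)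
    case 0
    obtain j y where y: "y \<in> S" "x = gasket_map Q j y" using gasket_cases[OF 0] .
    have "minimal_approx (Suc 0) a x = minimal_approx 0 (child a j) y"
      unfolding minimal_approx.simps(2) y(2) by (rule glue_eq[OF compatible_minimal_approx y(1)])
    moreover have "\<bar>minimal_approx 0 (child a j) y - a $ j\<bar> \<le> K * A (child a j) powr (1 / p)"
      using affine[OF y(1), of "child a j" j] by (simp only: child_vertex)
    moreover have "K * A (child a j) powr (1 / p) \<le> K * A a powr (1 / p)"
    proof -
      have "contraction * A a powr (1 / p) \<le> 1 * A a powr (1 / p)"
        using contraction by (intro mult_right_mono) auto
      then show ?thesis using child_powr[of a j] K(1) by (intro mult_left_mono) auto
    qed
    ultimately show ?case using affine[OF 0, of a j] by simp
  next
    case (Suc n)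
    obtain j y where y: "y \<in> S" "x = gasket_map Q j y" using gasket_cases[OF Suc.prems] .
    have "minimal_approx (Suc n) a x = minimal_approx n (child a j) y" for n
      unfolding minimal_approx.simps(2) y(2) by (rule glue_eq[OF compatible_minimal_approx y(1)])
    then have "\<bar>minimal_approx (Suc (Suc n)) a x - minimal_approx (Suc n) a x\<bar>
        = \<bar>minimal_approx (Suc n) (child a j) y - minimal_approx n (child a j) y\<bar>" by (simp only:)
    also have "\<dots> \<le> 2 * K * contraction ^ n * A (child a j) powr (1 / p)" by (rule Suc.IH[OF y(1)])
    also have "\<dots> \<le> 2 * K * contraction ^ n * (contraction * A a powr (1 / p))"
      using K(1) contraction child_powr by (intro mult_left_mono) auto
    finally show ?case by (simp add: mult_ac)
  qed
  then show ?thesis using that by blast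
qed

text \<open>
  The source of nonconstant functions of finite energy: the approximations keep their energy at
  all levels up to their own, so it passes to the uniform limit level by level.
\<close>

lemma minimal_function:
  obtains u where "continuous_on S u" "\<And>i. u (Q i) = a $ i" "\<And>m. L m u = A a"
proof -
  obtain K where K: "\<And>n a x. x \<in> S \<Longrightarrow>
      \<bar>minimal_approx (Suc n) a x - minimal_approx n a x\<bar> \<le> K * contraction ^ n * A a powr (1 / p)"
    using minimal_approx_step by blast
  let ?d = "\<lambda>n x. minimal_approx (Suc n) a x - minimal_approx n a x"
  define v where "v x = (\<Sum>n. ?d n x)" for x
  define u where "u x = minimal_approx 0 a x + v x" for x
  have unif: "uniform_limit S (\<lambda>n x. \<Sum>i<n. ?d i x) v sequentially"
    unfolding v_def
  proof (rule Weierstrass_m_test)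
    show "norm (?d n x) \<le> K * contraction ^ n * A a powr (1 / p)" if "x \<in> S" for n x
      using K[OF that] by simp
    show "summable (\<lambda>n. K * contraction ^ n * A a powr (1 / p))"
      using contraction by (intro summable_mult summable_mult2 summable_geometric) auto
  qed
  have telescope: "minimal_approx n a x = minimal_approx 0 a x + (\<Sum>i<n. ?d i x)" for n x
    by (induction n) (simp_all del: minimal_approx.simps)
  have "continuous_on S v"
    by (rule uniform_limit_theorem[OF _ unif])
      (auto intro!: always_eventually continuous_intros continuous_on_minimal_approx
        simp del: minimal_approx.simps)
  then have cont: "continuous_on S u"
    unfolding u_def by (intro continuous_on_add continuous_on_minimal_approx)
  have lim: "(\<lambda>n. minimal_approx n a x) \<longlonglongrightarrow> u x" if "x \<in> S" for x
    unfolding u_def using tendsto_uniform_limitI[OF unif that]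
    by (subst telescope) (intro tendsto_add tendsto_const)
  have "u (Q i) = a $ i" for i
    using lim[OF vertex_in_gasket, of i] by (simp add: minimal_approx_vertex LIMSEQ_const_iff)
  moreover have "L m u = A a" for m
  proof (rule LIMSEQ_unique)
    show "(\<lambda>n. L m (minimal_approx n a)) \<longlonglongrightarrow> L m u" by (rule level_energy_tendsto[OF lim])
    show "(\<lambda>n. L m (minimal_approx n a)) \<longlonglongrightarrow> A a"
      by (rule tendsto_eventually)
        (auto simp: eventually_sequentially intro!: exI[of _ m] level_energy_minimal_approx)
  qed
  ultimately show ?thesis using that cont by blast
qed

text \<open>
  Starting from a function with value \<open>0\<close> at one vertex and \<open>1\<close> at the others, the construction
  repeatedly shrinks it into the cell at that vertex and continues it by \<open>1\<close>.
\<close>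

lemma corner_function:
  assumes D: "\<And>x. x \<in> S \<Longrightarrow> dist x (Q i) < D"
  obtains u c where "continuous_on S u" "\<And>j. u (Q j) = (if j = i then 0 else 1)" "\<And>m. L m u \<le> c"
    "\<And>x. x \<in> S \<Longrightarrow> D / 2 ^ n \<le> dist x (Q i) \<Longrightarrow> u x = 1"
proof -
  have "\<exists>u. continuous_on S u \<and> (\<forall>j. u (Q j) = (if j = i then 0 else 1)) \<and> (\<exists>c. \<forall>m. L m u \<le> c) \<and>
      (\<forall>x\<in>S. D / 2 ^ n \<le> dist x (Q i) \<longrightarrow> u x = 1)"
  proof (induction n)
    case 0
    obtain u where u: "continuous_on S u" "\<And>j. u (Q j) = (\<chi> j. if j = i then 0 else 1) $ j"
      "\<And>m. L m u = A (\<chi> j. if j = i then 0 else 1)"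
      using minimal_function[of "\<chi> j. if j = i then 0 else 1"] by blast
    then show ?case using D by (intro exI[of _ u]) (auto dest: leD)
  next
    case (Suc n)
    then obtain u c where u: "continuous_on S u" "\<And>j. u (Q j) = (if j = i then 0 else 1)"
      "\<And>m. L m u \<le> c" "\<And>x. x \<in> S \<Longrightarrow> D / 2 ^ n \<le> dist x (Q i) \<Longrightarrow> u x = 1" by auto
    define f where "f j = (if j = i then u else (\<lambda>x. 1))" for j
    have f: "compatible f" by (auto simp: compatible_def f_def u(2))
    have "L m (glue f) \<le> L 0 (glue f) + 3 * \<bar>c\<bar> / r" for m
    proof (cases m)
      case (Suc m')
      have "L m' (\<lambda>x. 1) = 0"
      proof -
        have "A (cell_values (\<lambda>x. 1) \<omega>) = 0" for \<omega> by (auto simp: A_eq_0_iff cell_values_def)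
        then show ?thesis by (simp add: level_energy_eq)
      qed
      then have "L m' (f j) \<le> \<bar>c\<bar>" for j using u(3)[of m'] by (auto simp: f_def)
      then have "(\<Sum>j\<in>UNIV. L m' (f j)) \<le> of_nat (card (UNIV :: 3 set)) * \<bar>c\<bar>"
        by (intro sum_bounded_above) auto
      then have "L m (glue f) \<le> 3 * \<bar>c\<bar> / r"
        using r_pos by (simp add: Suc level_energy_glue[OF f] divide_right_mono)
      then show ?thesis using level_energy_nonneg[of 0 "glue f"] by linarith
    qed (use r_pos in simp)
    moreover have "continuous_on S (glue f)"
      using u(1) by (intro continuous_on_glue[OF f]) (auto simp: f_def)
    moreover have "glue f (Q j) = (if j = i then 0 else 1)" for j
      by (simp add: glue_vertex[OF f] f_def u(2))
    moreover have "glue f x = 1" if x: "x \<in> S" "D / 2 ^ Suc n \<le> dist x (Q i)" for x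
    proof -
      obtain j y where y: "y \<in> S" "x = gasket_map Q j y" using gasket_cases[OF x(1)] .
      show ?thesis
      proof (cases "j = i")
        case True
        have "dist x (Q i) = dist y (Q i) / 2"
          using dist_gasket_map[of Q i y "Q i"] by (simp add: y(2) True gasket_map_vertex)
        then have "u y = 1" using x(2) by (intro u(4)[OF y(1)]) simp
        then show ?thesis by (simp add: y(2) glue_eq[OF f y(1)] f_def True)
      qed (simp add: y(2) glue_eq[OF f y(1)] f_def)
    qed
    ultimately show ?case by blast
  qed
  then show ?thesis using that by blast
qed

lemma cutoff_function:
  assumes "\<delta> > 0"
  obtains u where "u \<in> dom0" "\<And>x. 0 \<le> u x" "\<And>x. x \<in> S \<Longrightarrow> (\<And>i. \<delta> \<le> dist x (Q i)) \<Longrightarrow> u x = 1"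
proof -
  obtain B where B: "\<And>x. x \<in> S \<Longrightarrow> norm x \<le> B"
    using compact_imp_bounded[OF compact_gasket[of Q]] unfolding bounded_iff by blast
  define D where "D = 2 * B + 1"
  have D: "dist x (Q i) < D" if "x \<in> S" for x i
    using norm_triangle_ineq4[of x "Q i"] B[OF that] B[OF vertex_in_gasket, of i] by (simp add: D_def dist_norm)
  have "(\<lambda>n. D / 2 ^ Suc n) \<longlonglongrightarrow> 0" by real_asymp
  then have "\<forall>\<^sub>F n in sequentially. D / 2 ^ Suc n < \<delta>" using assms by (rule order_tendstoD)
  then obtain n where n: "D / 2 ^ Suc n < \<delta>" by (auto simp: eventually_sequentially)
  have "\<exists>u c. continuous_on S u \<and> (\<forall>j. u (Q j) = (if j = i then 0 else 1)) \<and> (\<forall>m. L m u \<le> c) \<and>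
      (\<forall>x. x \<in> S \<longrightarrow> D / 2 ^ n \<le> dist x (Q i) \<longrightarrow> u x = 1)" for i
    using corner_function[of i D n] D by metis
  then obtain f c where f: "\<And>i. continuous_on S (f i)" "\<And>i j. f i (Q j) = (if j = i then 0 else 1)"
    "\<And>i m. L m (f i) \<le> c i" "\<And>i x. x \<in> S \<Longrightarrow> D / 2 ^ n \<le> dist x (Q i) \<Longrightarrow> f i x = 1"
    by metis
  have comp: "compatible f" by (auto simp: compatible_def f(2))
  have "L m (glue f) \<le> (\<Sum>j\<in>UNIV. c j) / r" for m
  proof -
    have "L m (glue f) \<le> L (Suc m) (glue f)" by (rule level_energy_Suc)
    also have "\<dots> \<le> (\<Sum>j\<in>UNIV. c j) / r"
      unfolding level_energy_glue[OF comp] using r_pos f(3) by (intro divide_right_mono sum_mono) auto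
    finally show ?thesis .
  qed
  then have dom: "glue f \<in> dom0"
    using f(1) by (intro dom0I(1) continuous_on_glue[OF comp]) (auto simp: glue_vertex[OF comp] f(2))
  have one: "glue f x = 1" if x: "x \<in> S" "\<And>i. \<delta> \<le> dist x (Q i)" for x
  proof -
    obtain j y where y: "y \<in> S" "x = gasket_map Q j y" using gasket_cases[OF x(1)] .
    have "dist x (Q j) = dist y (Q j) / 2"
      using dist_gasket_map[of Q j y "Q j"] by (simp add: y(2) gasket_map_vertex)
    then have "D / 2 ^ n \<le> dist y (Q j)" using x(2)[of j] n by simp
    then show ?thesis by (simp add: y(2) glue_eq[OF comp y(1)] f(4)[OF y(1)])
  qed
  show ?thesis
    by (rule that[of "\<lambda>x. max 0 (glue f x)"]) (use max_0_in_dom0[OF dom] one in auto)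
qed

text \<open>
  The sets where the cut-off functions equal \<open>1\<close> exhaust the gasket except for the three
  vertices, and these form a null set.
\<close>

lemma function_detecting_weight:
  assumes "\<not> (AE x in gasket_measure Q. h x = (0 :: real))"
  obtains u where "u \<in> dom0" "\<And>x. 0 \<le> u x" "\<not> (AE x in gasket_measure Q. u x = 1 \<longrightarrow> h x = 0)"
proof (rule ccontr)
  assume no: "\<not> thesis"
  have "\<exists>u. u \<in> dom0 \<and> (\<forall>x. 0 \<le> u x) \<and> (\<forall>x\<in>S. (\<forall>i. 1 / real (Suc n) \<le> dist x (Q i)) \<longrightarrow> u x = 1)" for n
    using cutoff_function[of "1 / real (Suc n)"] by (metis of_nat_0_less_iff zero_less_Suc zero_less_divide_1_iff)
  then obtain u where u: "\<And>n. u n \<in> dom0" "\<And>n x. 0 \<le> u n x"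
    "\<And>n x. x \<in> S \<Longrightarrow> (\<And>i. 1 / real (Suc n) \<le> dist x (Q i)) \<Longrightarrow> u n x = 1" by metis
  have "AE x in gasket_measure Q. u n x = 1 \<longrightarrow> h x = 0" for n
    using no that[OF u(1,2)] by blast
  then have "AE x in gasket_measure Q. \<forall>n. u n x = 1 \<longrightarrow> h x = 0"
    unfolding AE_all_countable by (intro allI)
  moreover have "AE x in gasket_measure Q. \<forall>i. x \<noteq> Q i"
    by (simp add: AE_all_countable AE_gasket_measure_neq vertex_in_gasket)
  ultimately have "AE x in gasket_measure Q. h x = 0"
    using AE_space
  proof eventually_elim
    case (elim x)
    define d where "d = Min (range (\<lambda>i. dist x (Q i)))"
    have "d > 0" unfolding d_def using elim(2) by (subst Min_gr_iff) auto
    then obtain n where n: "1 / real (Suc n) < d" using nat_approx_posE by blast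
    have "d \<le> dist x (Q i)" for i unfolding d_def by (intro Min_le) auto
    then have "1 / real (Suc n) \<le> dist x (Q i)" for i using n by (meson less_imp_le order_trans)
    then have "u n x = 1" using elim(3) by (intro u(3)) (auto simp: space_gasket_measure)
    then show ?case using elim(1) by blast
  qed
  then show False using assms by blast
qed

section \<open>Derivatives of the integral terms\<close>

abbreviation "\<mu> \<equiv> gasket_measure Q"

lemma dom0_measurable: "u \<in> dom0 \<Longrightarrow> u \<in> borel_measurable \<mu>"
  by (intro measurable_gasket_measure dom0D)

lemma dom0_bounded:
  assumes "u \<in> dom0"
  obtains B where "0 \<le> B" "\<And>x. x \<in> S \<Longrightarrow> \<bar>u x\<bar> \<le> B"
  using sup_bound[of thesis] assms by (metis less_imp_le mult_nonneg_nonneg powr_ge_zero)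

lemma perturbation_bounded:
  assumes "u \<in> dom0" "\<phi> \<in> dom0"
  obtains R where "0 \<le> R" "\<And>x. x \<in> S \<Longrightarrow> \<bar>\<phi> x\<bar> \<le> R" "\<And>x. x \<in> S \<Longrightarrow> \<bar>u x\<bar> \<le> R"
    "\<And>x n. x \<in> S \<Longrightarrow> \<bar>u x + eps n * \<phi> x\<bar> \<le> R"
proof -
  obtain B1 where B1: "0 \<le> B1" "\<And>x. x \<in> S \<Longrightarrow> \<bar>u x\<bar> \<le> B1" using dom0_bounded[OF assms(1)] by blast
  obtain B2 where B2: "0 \<le> B2" "\<And>x. x \<in> S \<Longrightarrow> \<bar>\<phi> x\<bar> \<le> B2" using dom0_bounded[OF assms(2)] by blast
  show ?thesis
  proof (rule that[of "B1 + B2"])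
    fix x n assume x: "x \<in> S"
    have "\<bar>eps n * \<phi> x\<bar> \<le> 1 * B2"
      unfolding abs_mult using eps[of n] B2(2)[OF x] by (intro mult_mono) auto
    then show "\<bar>u x + eps n * \<phi> x\<bar> \<le> B1 + B2" using B1(2)[OF x] by simp
  qed (use B1 B2 in \<open>auto intro: add_increasing add_increasing2\<close>)
qed

lemma integrable_mult_bounded:
  assumes k: "integrable \<mu> k" and w: "w \<in> borel_measurable \<mu>" "\<And>x. x \<in> S \<Longrightarrow> \<bar>w x\<bar> \<le> B"
  shows "integrable \<mu> (\<lambda>x. k x * w x :: real)"
proof (rule Bochner_Integration.integrable_bound)
  show "integrable \<mu> (\<lambda>x. k x * B)" using k by simp
  show "(\<lambda>x. k x * w x) \<in> borel_measurable \<mu>" using k w(1) by measurable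
  show "AE x in \<mu>. norm (k x * w x) \<le> norm (k x * B)"
    using AE_space
  proof eventually_elim
    case (elim x)
    then have "\<bar>w x\<bar> \<le> \<bar>B\<bar>" using w(2)[of x] by (simp add: space_gasket_measure)
    then show ?case by (simp add: abs_mult mult_left_mono)
  qed
qed

lemma integral_mult_tendsto:
  assumes k: "integrable \<mu> k" and w: "\<And>n. w n \<in> borel_measurable \<mu>" "u \<in> borel_measurable \<mu>"
    and bound: "\<And>n x. x \<in> S \<Longrightarrow> \<bar>w n x\<bar> \<le> B" and lim: "\<And>x. x \<in> S \<Longrightarrow> (\<lambda>n. w n x) \<longlonglongrightarrow> u x"
  shows "(\<lambda>n. \<integral>x. k x * w n x \<partial>\<mu>) \<longlonglongrightarrow> (\<integral>x. k x * u x \<partial>\<mu> :: real)"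
proof (rule integral_dominated_convergence[where w="\<lambda>x. \<bar>k x\<bar> * \<bar>B\<bar>"])
  show "(\<lambda>x. k x * u x) \<in> borel_measurable \<mu>" "(\<lambda>x. k x * w n x) \<in> borel_measurable \<mu>" for n
    using k w by measurable
  show "integrable \<mu> (\<lambda>x. \<bar>k x\<bar> * \<bar>B\<bar>)" using k by simp
  show "AE x in \<mu>. (\<lambda>n. k x * w n x) \<longlonglongrightarrow> k x * u x"
    using AE_space by eventually_elim (auto simp: space_gasket_measure intro!: tendsto_intros lim)
  show "AE x in \<mu>. norm (k x * w n x) \<le> \<bar>k x\<bar> * \<bar>B\<bar>" for n
    using AE_space
  proof eventually_elim
    case (elim x)
    then have "\<bar>w n x\<bar> \<le> \<bar>B\<bar>" using bound[of x n] by (simp add: space_gasket_measure)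
    then show ?case by (simp add: abs_mult mult_left_mono)
  qed
qed

abbreviation pairing :: "real \<Rightarrow> (real ^ 2 \<Rightarrow> real) \<Rightarrow> (real ^ 2 \<Rightarrow> real) \<Rightarrow> (real ^ 2 \<Rightarrow> real) \<Rightarrow> real" where
  "pairing s k u \<phi> \<equiv> \<integral>x. k x * \<bar>u x\<bar> powr (s - 2) * u x * \<phi> x \<partial>\<mu>"

definition weighted :: "real \<Rightarrow> (real ^ 2 \<Rightarrow> real) \<Rightarrow> (real ^ 2 \<Rightarrow> real) \<Rightarrow> real" where
  "weighted s k u = (\<integral>x. k x * \<bar>u x\<bar> powr s \<partial>\<mu>)"

lemma weighted_deriv:
  assumes k: "integrable \<mu> k" and dom: "u \<in> dom0" "\<phi> \<in> dom0" and s: "1 < s"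
  shows "(\<lambda>n. (weighted s k (\<lambda>x. u x + eps n * \<phi> x) - weighted s k u) / eps n)
    \<longlonglongrightarrow> s * pairing s k u \<phi>"
    and "integrable \<mu> (\<lambda>x. k x * \<bar>u x\<bar> powr (s - 2) * u x * \<phi> x)"
proof -
  note [measurable] = dom0_measurable[OF dom(1)] dom0_measurable[OF dom(2)]
  obtain R where R: "0 \<le> R" "\<And>x. x \<in> S \<Longrightarrow> \<bar>\<phi> x\<bar> \<le> R"
    and uR: "\<And>x. x \<in> S \<Longrightarrow> \<bar>u x\<bar> \<le> R" "\<And>x n. x \<in> S \<Longrightarrow> \<bar>u x + eps n * \<phi> x\<bar> \<le> R"
    using perturbation_bounded[OF dom] by blast
  define w where "w n x = (\<bar>u x + eps n * \<phi> x\<bar> powr s - \<bar>u x\<bar> powr s) / eps n" for n x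
  have bound: "\<bar>w n x\<bar> \<le> s * R powr (s - 1) * R" if "x \<in> S" for n x
  proof -
    have "\<bar>\<bar>u x + eps n * \<phi> x\<bar> powr s - \<bar>u x\<bar> powr s\<bar> \<le> s * R powr (s - 1) * \<bar>\<bar>u x + eps n * \<phi> x\<bar> - \<bar>u x\<bar>\<bar>"
      using s uR[OF that] by (intro powr_diff_le) auto
    also have "\<dots> \<le> s * R powr (s - 1) * (eps n * R)"
    proof (intro mult_left_mono)
      have "\<bar>\<bar>u x + eps n * \<phi> x\<bar> - \<bar>u x\<bar>\<bar> \<le> \<bar>eps n * \<phi> x\<bar>" by linarith
      also have "\<dots> \<le> eps n * R"
        unfolding abs_mult using eps[of n] R(2)[OF that] by (intro mult_mono) auto
      finally show "\<bar>\<bar>u x + eps n * \<phi> x\<bar> - \<bar>u x\<bar>\<bar> \<le> eps n * R" .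
    qed (use s in auto)
    finally show ?thesis using eps[of n] by (simp add: w_def abs_mult field_simps)
  qed
  have lim: "(\<lambda>n. w n x) \<longlonglongrightarrow> s * \<bar>u x\<bar> powr (s - 2) * u x * \<phi> x" for x
    unfolding w_def by (rule tendsto_eps[OF abs_powr_deriv[OF s]])
  have "(\<lambda>n. \<integral>x. k x * w n x \<partial>\<mu>) \<longlonglongrightarrow> (\<integral>x. k x * (s * \<bar>u x\<bar> powr (s - 2) * u x * \<phi> x) \<partial>\<mu>)"
    by (rule integral_mult_tendsto[OF k _ _ bound lim]) (auto simp: w_def)
  moreover have "(\<integral>x. k x * w n x \<partial>\<mu>)
      = (weighted s k (\<lambda>x. u x + eps n * \<phi> x) - weighted s k u) / eps n" for n
  proof -
    have 1: "integrable \<mu> (\<lambda>x. k x * \<bar>u x + eps n * \<phi> x\<bar> powr s)"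
      using uR s by (intro integrable_mult_bounded[OF k, of _ "R powr s"]) (auto intro!: powr_mono2)
    have 2: "integrable \<mu> (\<lambda>x. k x * \<bar>u x\<bar> powr s)"
      using uR s by (intro integrable_mult_bounded[OF k, of _ "R powr s"]) (auto intro!: powr_mono2)
    show ?thesis unfolding weighted_def w_def
      using 1 2 by (simp add: right_diff_distrib)
  qed
  moreover have "(\<integral>x. k x * (s * \<bar>u x\<bar> powr (s - 2) * u x * \<phi> x) \<partial>\<mu>)
      = s * pairing s k u \<phi>"
    by (subst integral_mult_right_zero[symmetric]) (simp add: mult_ac)
  ultimately show "(\<lambda>n. (weighted s k (\<lambda>x. u x + eps n * \<phi> x) - weighted s k u) / eps n)
    \<longlonglongrightarrow> s * pairing s k u \<phi>" by simp
  have "\<bar>s * \<bar>u x\<bar> powr (s - 2) * u x * \<phi> x\<bar> \<le> s * R powr (s - 1) * R" if "x \<in> S" for x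
    using lim bound[OF that] by (intro LIMSEQ_le_const2[OF tendsto_rabs[OF lim]]) auto
  then have "integrable \<mu> (\<lambda>x. k x * (s * \<bar>u x\<bar> powr (s - 2) * u x * \<phi> x))"
    by (intro integrable_mult_bounded[OF k]) auto
  then have "integrable \<mu> (\<lambda>x. s * (k x * \<bar>u x\<bar> powr (s - 2) * u x * \<phi> x))"
    by (simp add: mult_ac)
  then show "integrable \<mu> (\<lambda>x. k x * \<bar>u x\<bar> powr (s - 2) * u x * \<phi> x)" using s by simp
qed

definition pos_weighted :: "real \<Rightarrow> (real ^ 2 \<Rightarrow> real) \<Rightarrow> (real ^ 2 \<Rightarrow> real) \<Rightarrow> real" where
  "pos_weighted s k u = (\<integral>x. k x * max 0 (u x) powr s \<partial>\<mu>)"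

lemma pos_weighted_integrable:
  assumes k: "integrable \<mu> k" and u: "u \<in> dom0" and s: "0 \<le> s"
  shows "integrable \<mu> (\<lambda>x. k x * max 0 (u x) powr s)"
proof -
  note [measurable] = dom0_measurable[OF u]
  obtain B where B: "0 \<le> B" "\<And>x. x \<in> S \<Longrightarrow> \<bar>u x\<bar> \<le> B" using dom0_bounded[OF u] by blast
  have "\<bar>max 0 (u x) powr s\<bar> \<le> B powr s" if "x \<in> S" for x
    using B(2)[OF that] B(1) s by (auto intro!: powr_mono2)
  then show ?thesis by (intro integrable_mult_bounded[OF k]) auto
qed

lemma pos_weighted_quotient:
  assumes k: "integrable \<mu> k" and dom: "u \<in> dom0" "\<phi> \<in> dom0" and s: "0 < s"
  defines "w \<equiv> \<lambda>n x. k x * ((max 0 (u x + eps n * \<phi> x) powr s - max 0 (u x) powr s) / eps n)"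
  shows "integrable \<mu> (w n)"
    and "integral\<^sup>L \<mu> (w n) = (pos_weighted s k (\<lambda>x. u x + eps n * \<phi> x) - pos_weighted s k u) / eps n"
proof -
  have 1: "integrable \<mu> (\<lambda>x. k x * max 0 (u x + eps n * \<phi> x) powr s)"
    using s by (intro pos_weighted_integrable k add_in_dom0 dom) auto
  have 2: "integrable \<mu> (\<lambda>x. k x * max 0 (u x) powr s)"
    using s by (intro pos_weighted_integrable k dom) auto
  have eq: "w n = (\<lambda>x. (k x * max 0 (u x + eps n * \<phi> x) powr s - k x * max 0 (u x) powr s) / eps n)"
    by (auto simp: w_def right_diff_distrib)
  show "integrable \<mu> (w n)" unfolding eq using 1 2 by simp
  show "integral\<^sup>L \<mu> (w n) = (pos_weighted s k (\<lambda>x. u x + eps n * \<phi> x) - pos_weighted s k u) / eps n"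
    unfolding eq pos_weighted_def using 1 2 by simp
qed

text \<open>
  For \<open>s < 1\<close> the derivative \<open>u\<^sup>s\<^sup>-\<^sup>1 \<phi>\<close> of the integrand is singular where \<open>u\<close> vanishes, and its
  integrability is not automatic. It follows from Fatou's lemma when the difference quotients
  of the integrals are bounded, as they are at a minimizer.
\<close>

lemma pos_weighted_integrable_deriv:
  assumes k: "integrable \<mu> k" "\<And>x. x \<in> S \<Longrightarrow> 0 \<le> k x"
    and dom: "u \<in> dom0" "\<phi> \<in> dom0" and nonneg: "\<And>x. 0 \<le> u x" "\<And>x. 0 \<le> \<phi> x" and s: "0 < s"
    and bound: "\<forall>\<^sub>F n in sequentially. (pos_weighted s k (\<lambda>x. u x + eps n * \<phi> x) - pos_weighted s k u) / eps n \<le> M"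
  shows "integrable \<mu> (\<lambda>x. k x * \<bar>u x\<bar> powr (s - 2) * u x * \<phi> x)"
proof -
  note [measurable] = dom0_measurable[OF dom(1)] dom0_measurable[OF dom(2)] borel_measurable_integrable[OF k(1)]
  define w where "w n x = k x * ((max 0 (u x + eps n * \<phi> x) powr s - max 0 (u x) powr s) / eps n)" for n x
  define f where "f x = s * (k x * \<bar>u x\<bar> powr (s - 2) * u x * \<phi> x)" for x
  have w_meas [measurable]: "w n \<in> borel_measurable \<mu>" for n unfolding w_def by measurable
  have w_nonneg: "0 \<le> w n x" if "x \<in> S" for n x
    using k(2)[OF that] nonneg eps[of n] s
    by (auto simp: w_def intro!: mult_nonneg_nonneg divide_nonneg_pos powr_mono2)
  have w_int: "integrable \<mu> (w n)" "integral\<^sup>L \<mu> (w n)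
      = (pos_weighted s k (\<lambda>x. u x + eps n * \<phi> x) - pos_weighted s k u) / eps n" for n
    unfolding w_def[abs_def] by (rule pos_weighted_quotient[OF k(1) dom s])+
  have point: "ennreal (f x) \<le> liminf (\<lambda>n. ennreal (w n x))" if "x \<in> S" for x
  proof (cases "u x = 0")
    case False
    then have u: "0 < u x" using nonneg(1)[of x] by simp
    have "(\<lambda>n. w n x) \<longlonglongrightarrow> k x * (s * u x powr (s - 1) * \<phi> x)"
      unfolding w_def max_absorb2[OF less_imp_le[OF u]]
      by (intro tendsto_mult_left tendsto_eps[OF powr_deriv_pos[OF u]])
    moreover have "k x * (s * u x powr (s - 1) * \<phi> x) = f x"
      using u powr_add[of "u x" "s - 2" 1] by (simp add: f_def)
    ultimately have "(\<lambda>n. ennreal (w n x)) \<longlonglongrightarrow> ennreal (f x)" by (simp add: tendsto_ennrealI)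
    then show ?thesis by (simp add: lim_imp_Liminf)
  qed (simp add: f_def)
  have "(\<integral>\<^sup>+x. ennreal (f x) \<partial>\<mu>) \<le> (\<integral>\<^sup>+x. liminf (\<lambda>n. ennreal (w n x)) \<partial>\<mu>)"
    using point by (intro nn_integral_mono) (simp add: space_gasket_measure)
  also have "\<dots> \<le> liminf (\<lambda>n. \<integral>\<^sup>+x. ennreal (w n x) \<partial>\<mu>)"
    by (intro nn_integral_liminf) measurable
  also have "\<dots> = liminf (\<lambda>n. ennreal (integral\<^sup>L \<mu> (w n)))"
  proof -
    have "(\<integral>\<^sup>+x. ennreal (w n x) \<partial>\<mu>) = ennreal (integral\<^sup>L \<mu> (w n))" for n
      using w_int(1) w_nonneg by (intro nn_integral_eq_integral) (auto simp: space_gasket_measure intro!: AE_I2)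
    then show ?thesis by simp
  qed
  also have "\<dots> \<le> liminf (\<lambda>n. ennreal M)"
    using bound by (intro Liminf_mono) (auto simp: w_int(2) elim!: eventually_mono intro: ennreal_leI)
  also have "\<dots> = ennreal M" by (simp add: Liminf_const)
  finally have "(\<integral>\<^sup>+x. ennreal (f x) \<partial>\<mu>) < \<infinity>" by (rule order_le_less_trans) simp
  moreover have "AE x in \<mu>. 0 \<le> f x"
    using k(2) nonneg s by (intro AE_I2) (auto simp: f_def space_gasket_measure)
  moreover have "f \<in> borel_measurable \<mu>" unfolding f_def by measurable
  ultimately have "integrable \<mu> f" by (intro integrableI_nonneg)
  then show ?thesis unfolding f_def using s by simp
qed

text \<open>
  Points where \<open>u\<close> vanishes can only increase the difference quotient, so the set where \<open>u\<close> is
  positive yields a lower bound for it, and there dominated convergence applies.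
\<close>

lemma pos_weighted_deriv_le:
  assumes k: "integrable \<mu> k" "\<And>x. x \<in> S \<Longrightarrow> 0 \<le> k x"
    and dom: "u \<in> dom0" "\<phi> \<in> dom0" and nonneg: "\<And>x. 0 \<le> u x" and s: "0 < s"
    and int: "integrable \<mu> (\<lambda>x. k x * \<bar>u x\<bar> powr (s - 2) * u x * \<bar>\<phi> x\<bar>)"
    and le: "\<forall>\<^sub>F n in sequentially. (pos_weighted s k (\<lambda>x. u x + eps n * \<phi> x) - pos_weighted s k u) / eps n \<le> X n"
    and X: "X \<longlonglongrightarrow> X'"
  shows "s * pairing s k u \<phi> \<le> X'"
proof -
  note [measurable] = dom0_measurable[OF dom(1)] dom0_measurable[OF dom(2)] borel_measurable_integrable[OF k(1)]
  obtain R where R: "0 \<le> R" "\<And>x. x \<in> S \<Longrightarrow> \<bar>\<phi> x\<bar> \<le> R"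
    and uR: "\<And>x. x \<in> S \<Longrightarrow> \<bar>u x\<bar> \<le> R" "\<And>x n. x \<in> S \<Longrightarrow> \<bar>u x + eps n * \<phi> x\<bar> \<le> R"
    using perturbation_bounded[OF dom] by blast
  define w where "w n x = k x * ((max 0 (u x + eps n * \<phi> x) powr s - max 0 (u x) powr s) / eps n)" for n x
  define y where "y n x = (if 0 < u x then w n x else 0)" for n x
  define f where "f x = s * (k x * \<bar>u x\<bar> powr (s - 2) * u x * \<phi> x)" for x
  have [measurable]: "w n \<in> borel_measurable \<mu>" for n unfolding w_def by measurable
  have [measurable]: "y n \<in> borel_measurable \<mu>" for n unfolding y_def by measurable
  have [measurable]: "f \<in> borel_measurable \<mu>" unfolding f_def by measurable
  have w_int: "integrable \<mu> (w n)" "integral\<^sup>L \<mu> (w n)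
      = (pos_weighted s k (\<lambda>x. u x + eps n * \<phi> x) - pos_weighted s k u) / eps n" for n
    unfolding w_def[abs_def] by (rule pos_weighted_quotient[OF k(1) dom s])+
  define C where "C = s * R powr (s - 1) * R"
  have C: "0 \<le> C" using s R(1) by (simp add: C_def)
  define g where "g x = k x * \<bar>u x\<bar> powr (s - 2) * u x * \<bar>\<phi> x\<bar> + k x * C" for x
  have g_int: "integrable \<mu> g" unfolding g_def using int k(1) by simp
  have y_bound: "\<bar>y n x\<bar> \<le> g x" if x: "x \<in> S" for n x
  proof (cases "0 < u x")
    case False
    then show ?thesis using k(2)[OF x] C nonneg[of x] by (simp add: y_def g_def)
  next
    case True
    let ?z = "max 0 (u x + eps n * \<phi> x)"
    have u1: "\<bar>u x\<bar> powr (s - 2) * u x = u x powr (s - 1)"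
      using True powr_add[of "u x" "s - 2" 1] by simp
    have zu: "\<bar>?z - u x\<bar> \<le> eps n * \<bar>\<phi> x\<bar>"
    proof -
      have "\<bar>?z - u x\<bar> \<le> \<bar>eps n * \<phi> x\<bar>" using True by linarith
      then show ?thesis using eps[of n] by (simp add: abs_mult)
    qed
    have "\<bar>?z powr s - u x powr s\<bar> \<le> eps n * (u x powr (s - 1) * \<bar>\<phi> x\<bar> + C)"
    proof (cases "s \<le> 1")
      case True
      have "\<bar>?z powr s - u x powr s\<bar> \<le> u x powr (s - 1) * \<bar>?z - u x\<bar>"
        using \<open>0 < u x\<close> True s by (intro powr_diff_le_singular) auto
      also have "\<dots> \<le> u x powr (s - 1) * (eps n * \<bar>\<phi> x\<bar>)" using zu by (intro mult_left_mono) auto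
      also have "\<dots> \<le> eps n * (u x powr (s - 1) * \<bar>\<phi> x\<bar> + C)"
        using C eps[of n] by (simp add: algebra_simps)
      finally show ?thesis .
    next
      case False
      have "\<bar>?z powr s - u x powr s\<bar> \<le> s * R powr (s - 1) * \<bar>?z - u x\<bar>"
        using \<open>0 < u x\<close> False R(1) uR(1)[OF x] uR(2)[OF x, of n] by (intro powr_diff_le) auto
      also have "\<dots> \<le> s * R powr (s - 1) * (eps n * R)"
        using zu R(2)[OF x] eps[of n] s
        by (intro mult_left_mono order_trans[OF zu] mult_nonneg_nonneg) auto
      also have "\<dots> \<le> eps n * (u x powr (s - 1) * \<bar>\<phi> x\<bar> + C)"
        using eps[of n] by (simp add: algebra_simps C_def)
      finally show ?thesis .
    qed
    then have "\<bar>(?z powr s - u x powr s) / eps n\<bar> \<le> u x powr (s - 1) * \<bar>\<phi> x\<bar> + C"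
      using eps[of n] by (simp add: abs_divide pos_divide_le_eq mult.commute)
    then have "k x * \<bar>(?z powr s - u x powr s) / eps n\<bar> \<le> k x * (u x powr (s - 1) * \<bar>\<phi> x\<bar> + C)"
      using k(2)[OF x] by (intro mult_left_mono)
    then have "\<bar>w n x\<bar> \<le> k x * (u x powr (s - 1) * \<bar>\<phi> x\<bar> + C)"
      using True k(2)[OF x] by (simp add: w_def abs_mult)
    also have "\<dots> = g x" by (simp add: g_def u1[symmetric] algebra_simps)
    finally show ?thesis using True by (simp add: y_def)
  qed
  have y_lim: "(\<lambda>n. y n x) \<longlonglongrightarrow> f x" for x
  proof (cases "0 < u x")
    case True
    have "(\<lambda>n. w n x) \<longlonglongrightarrow> k x * (s * u x powr (s - 1) * \<phi> x)"
      unfolding w_def max_absorb2[OF less_imp_le[OF True]]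
      by (intro tendsto_mult_left tendsto_eps[OF powr_deriv_pos[OF True]])
    moreover have "k x * (s * u x powr (s - 1) * \<phi> x) = f x"
      using True powr_add[of "u x" "s - 2" 1] by (simp add: f_def)
    ultimately show ?thesis using True by (simp add: y_def)
  next
    case False
    then show ?thesis using nonneg[of x] by (simp add: y_def f_def)
  qed
  have "(\<lambda>n. integral\<^sup>L \<mu> (y n)) \<longlonglongrightarrow> integral\<^sup>L \<mu> f"
    using y_lim y_bound
    by (intro integral_dominated_convergence[where w=g]) (auto simp: g_int space_gasket_measure intro!: AE_I2)
  moreover have "\<forall>\<^sub>F n in sequentially. integral\<^sup>L \<mu> (y n) \<le> X n"
    using le
  proof eventually_elim
    case (elim n)
    have "integral\<^sup>L \<mu> (y n) \<le> integral\<^sup>L \<mu> (w n)"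
    proof (rule integral_mono)
      show "integrable \<mu> (y n)"
        by (rule Bochner_Integration.integrable_bound[OF g_int])
          (use y_bound in \<open>auto simp: space_gasket_measure intro!: AE_I2 order_trans[OF _ abs_ge_self]\<close>)
      show "y n x \<le> w n x" if "x \<in> space \<mu>" for x
        using that k(2)[of x] nonneg[of x] eps[of n] s by (auto simp: y_def w_def space_gasket_measure)
    qed (rule w_int)
    then show ?case using elim by (simp add: w_int(2))
  qed
  ultimately have "integral\<^sup>L \<mu> f \<le> X'"
    using X by (intro tendsto_le[OF _ X]) auto
  moreover have "integral\<^sup>L \<mu> f = s * pairing s k u \<phi>"
    unfolding f_def[abs_def] by (rule integral_mult_right_zero)
  ultimately show ?thesis by simp
qed

section \<open>The energy form at a minimizer\<close>

lemma energy_upper_tendsto: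
  assumes "u \<in> dom0" "\<phi> \<in> dom0"
  shows "(\<lambda>n. (en (\<lambda>x. u x + eps n * \<phi> x) - en u) / eps n) \<longlonglongrightarrow> p * energy_upper Q r A p u \<phi>"
proof -
  have "((\<lambda>t. (en (\<lambda>x. u x + t * \<phi> x) - en (\<lambda>x. u x + 0 * \<phi> x)) / t)
      \<longlongrightarrow> vector_derivative (\<lambda>t. en (\<lambda>x. u x + t * \<phi> x)) (at_right 0)) (at_right 0)"
    by (rule convex_right_derivative[OF convex_on_en[OF assms]])
  moreover have "vector_derivative (\<lambda>t. en (\<lambda>x. u x + t * \<phi> x)) (at_right 0) = p * energy_upper Q r A p u \<phi>"
    using p_gt_1 by (simp add: energy_upper_def en_def)
  ultimately show ?thesis using tendsto_eps by fastforce
qed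

lemma energy_lower_eq:
  assumes "u \<in> dom0" "\<phi> \<in> dom0"
  shows "energy_lower Q r A p u \<phi> = - energy_upper Q r A p u (\<lambda>x. - \<phi> x)"
proof -
  have minus: "(\<lambda>x. - \<phi> x) \<in> dom0" using scale_in_dom0[OF assms(2), of "-1"] by simp
  let ?f = "\<lambda>t. en (\<lambda>x. u x + t * \<phi> x)"
  have eq: "?f (- t) = en (\<lambda>x. u x + t * (- \<phi> x))" for t by simp
  have "convex_on UNIV (\<lambda>t. ?f (- t))"
    unfolding eq by (rule convex_on_en[OF assms(1) minus])
  then have "vector_derivative ?f (at_left 0) = - vector_derivative (\<lambda>t. ?f (- t)) (at_right 0)"
    by (rule convex_left_derivative)
  then show ?thesis unfolding eq by (simp add: energy_lower_def energy_upper_def en_def)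
qed

text \<open>
  Criterion for membership in the energy form by upper bounds alone: the lower bound for \<open>\<phi>\<close> is
  the upper bound for \<open>-\<phi>\<close>.
\<close>

lemma energy_formI:
  assumes "u \<in> dom0" "\<phi> \<in> dom0" and upper: "\<And>\<phi>. \<phi> \<in> dom0 \<Longrightarrow> X \<phi> \<le> energy_upper Q r A p u \<phi>"
    and odd: "X (\<lambda>x. - \<phi> x) = - X \<phi>"
  shows "X \<phi> \<in> energy_form Q r A p u \<phi>"
proof -
  have "(\<lambda>x. - \<phi> x) \<in> dom0" using scale_in_dom0[OF assms(2), of "-1"] by simp
  then have "X (\<lambda>x. - \<phi> x) \<le> energy_upper Q r A p u (\<lambda>x. - \<phi> x)" by (rule upper)
  then show ?thesis
    using upper[OF assms(2)] energy_lower_eq[OF assms(1,2)] odd by (simp add: energy_form_def)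
qed

section \<open>Minimizers\<close>

lemma integral_mult_le:
  assumes k: "integrable \<mu> k" "\<And>x. x \<in> S \<Longrightarrow> 0 \<le> k x"
    and w: "w \<in> borel_measurable \<mu>" "\<And>x. x \<in> S \<Longrightarrow> \<bar>w x\<bar> \<le> B"
  shows "(\<integral>x. k x * w x \<partial>\<mu>) \<le> (\<integral>x. k x \<partial>\<mu>) * (B :: real)"
proof -
  have "(\<integral>x. k x * w x \<partial>\<mu>) \<le> (\<integral>x. k x * B \<partial>\<mu>)"
  proof (rule integral_mono)
    show "integrable \<mu> (\<lambda>x. k x * w x)" by (rule integrable_mult_bounded[OF k(1) w])
    show "k x * w x \<le> k x * B" if "x \<in> space \<mu>" for x
      using that k(2)[of x] w(2)[of x] by (intro mult_left_mono) (auto simp: space_gasket_measure)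
  qed (use k in simp)
  then show ?thesis by simp
qed

lemma weighted_integrable:
  assumes "integrable \<mu> k" "u \<in> dom0" "0 \<le> s"
  shows "integrable \<mu> (\<lambda>x. k x * \<bar>u x\<bar> powr s)"
proof -
  note [measurable] = dom0_measurable[OF assms(2)]
  obtain B where B: "0 \<le> B" "\<And>x. x \<in> S \<Longrightarrow> \<bar>u x\<bar> \<le> B" using dom0_bounded[OF assms(2)] by blast
  then show ?thesis
    using assms(3) by (intro integrable_mult_bounded[OF assms(1), of _ "B powr s"]) (auto intro!: powr_mono2)
qed

lemma weighted_nonneg:
  assumes "\<And>x. x \<in> S \<Longrightarrow> 0 \<le> k x"
  shows "0 \<le> weighted s k u"
  unfolding weighted_def using assms by (intro integral_nonneg_AE AE_I2) (auto simp: space_gasket_measure)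

lemma weighted_scale: "weighted s k (\<lambda>x. c * u x) = \<bar>c\<bar> powr s * weighted s k u"
  unfolding weighted_def
  by (subst integral_mult_right_zero[symmetric]) (simp add: abs_mult powr_mult mult_ac)

lemma weighted_max_0_le:
  assumes k: "integrable \<mu> k" "\<And>x. x \<in> S \<Longrightarrow> 0 \<le> k x" and u: "u \<in> dom0" and s: "0 < s"
  shows "weighted s k (\<lambda>x. max 0 (u x)) \<le> weighted s k u"
  unfolding weighted_def
proof (rule integral_mono)
  show "integrable \<mu> (\<lambda>x. k x * \<bar>max 0 (u x)\<bar> powr s)"
    using s by (intro weighted_integrable k max_0_in_dom0 u) auto
  show "integrable \<mu> (\<lambda>x. k x * \<bar>u x\<bar> powr s)"
    using s by (intro weighted_integrable k u) auto
  show "k x * \<bar>max 0 (u x)\<bar> powr s \<le> k x * \<bar>u x\<bar> powr s" if "x \<in> space \<mu>" for x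
    using that k(2)[of x] s by (intro mult_left_mono powr_mono2) (auto simp: space_gasket_measure)
qed

lemma weighted_tendsto:
  assumes k: "integrable \<mu> k" and s: "0 < s" and w: "\<And>n. w n \<in> dom0" "\<And>n. en (w n) \<le> M" and u: "u \<in> dom0"
    and lim: "\<And>x. x \<in> S \<Longrightarrow> (\<lambda>n. w n x) \<longlonglongrightarrow> u x"
  shows "(\<lambda>n. weighted s k (w n)) \<longlonglongrightarrow> weighted s k u"
proof -
  obtain K where K: "K > 0" "\<And>u x. u \<in> dom0 \<Longrightarrow> x \<in> S \<Longrightarrow> \<bar>u x\<bar> \<le> K * en u powr (1 / p)"
    using sup_bound by blast
  have bound: "\<bar>w n x\<bar> \<le> K * M powr (1 / p)" if "x \<in> S" for n x
    using K(2)[OF w(1) that, of n] K(1) w(2)[of n] en_nonneg[of "w n"] p_gt_1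
    by (smt (verit) mult_left_mono powr_mono2 divide_nonneg_nonneg)
  note [measurable] = dom0_measurable[OF w(1)] dom0_measurable[OF u]
  show ?thesis
    unfolding weighted_def
  proof (rule integral_mult_tendsto[OF k])
    show "\<bar>\<bar>w n x\<bar> powr s\<bar> \<le> (K * M powr (1 / p)) powr s" if "x \<in> S" for n x
      using bound[OF that, of n] s by (auto intro!: powr_mono2)
    show "(\<lambda>n. \<bar>w n x\<bar> powr s) \<longlonglongrightarrow> \<bar>u x\<bar> powr s" if "x \<in> S" for x
      using s by (intro tendsto_powr' tendsto_rabs lim[OF that] tendsto_const) auto
  qed measurable
qed

subsection \<open>One component vanishes\<close>

text \<open>
  For a single equation with a nonnegative weight the functional is coercive because \<open>q < p\<close>,
  and it takes negative values close to \<open>0\<close> because the term of order \<open>q\<close> dominates there.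
\<close>

lemma semitrivial_minimizer:
  assumes k: "integrable \<mu> k" "\<And>x. x \<in> S \<Longrightarrow> 0 \<le> k x" "\<not> (AE x in \<mu>. k x = 0)" and q: "1 < q" "q < p"
  obtains u where "u \<in> dom0" "\<exists>x\<in>S. u x \<noteq> 0"
    "\<And>\<phi>. \<phi> \<in> dom0 \<Longrightarrow> pairing q k u \<phi> \<le> energy_upper Q r A p u \<phi>"
proof -
  define J where "J u = en u / p - weighted q k u / q" for u
  obtain K where K: "K > 0" "\<And>u x. u \<in> dom0 \<Longrightarrow> x \<in> S \<Longrightarrow> \<bar>u x\<bar> \<le> K * en u powr (1 / p)"
    using sup_bound by blast
  define N where "N = (\<integral>x. k x \<partial>\<mu>)"
  have N: "0 \<le> N" unfolding N_def using k(2) by (intro integral_nonneg_AE AE_I2) (auto simp: space_gasket_measure)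
  have growth: "weighted q k u \<le> N * K powr q * en u powr (q / p)" if "u \<in> dom0" for u
  proof -
    note [measurable] = dom0_measurable[OF that]
    have "weighted q k u \<le> N * (K * en u powr (1 / p)) powr q"
      unfolding weighted_def N_def using K(2)[OF that] q
      by (intro integral_mult_le k) (auto intro!: powr_mono2)
    then show ?thesis using K(1) by (simp add: powr_mult powr_powr mult_ac)
  qed
  define C where "C = (p * N * K powr q / q) powr (p / (p - q))"
  have sublevel: "en u \<le> C" if "u \<in> dom0" "J u \<le> 0" for u
  proof (cases "en u = 0")
    case False
    then have e: "0 < en u" using en_nonneg[of u] by simp
    have "en u / p \<le> N * K powr q * en u powr (q / p) / q"
      using that(2) divide_right_mono[OF growth[OF that(1)], of q] q by (simp add: J_def)
    then have "en u \<le> (p * N * K powr q / q) * en u powr (q / p)"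
      using p_gt_1 by (simp add: field_simps)
    moreover have "en u = en u powr (1 - q / p) * en u powr (q / p)"
      using e by (simp flip: powr_add)
    ultimately have "en u powr (1 - q / p) \<le> p * N * K powr q / q"
      using e by (metis mult_le_cancel_right_pos powr_gt_zero less_irrefl)
    then have "(en u powr (1 - q / p)) powr (p / (p - q)) \<le> C"
      unfolding C_def using q by (intro powr_mono2) auto
    moreover have "(1 - q / p) * (p / (p - q)) = 1" using q by (simp add: field_simps)
    then have "(en u powr (1 - q / p)) powr (p / (p - q)) = en u" unfolding powr_powr using e p_gt_1 by simp
    ultimately show ?thesis by simp
  qed (simp add: C_def)
  \<comment> \<open>Outside this sublevel set \<open>J\<close> exceeds its value at \<open>0\<close>, so it contains every minimizer.\<close>
  define F where "F = {u \<in> dom0. J u \<le> 0}"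
  have zeroF: "(\<lambda>x. 0) \<in> F"
    using zero_in_dom0 en_zero by (simp add: F_def J_def weighted_def)
  have below: "bdd_below (J ` F)"
  proof (rule bdd_belowI2)
    fix u assume u: "u \<in> F"
    then have "weighted q k u \<le> N * K powr q * en u powr (q / p)" by (intro growth) (simp add: F_def)
    also have "\<dots> \<le> N * K powr q * C powr (q / p)"
      using u N sublevel[of u] en_nonneg[of u] q by (intro mult_left_mono powr_mono2) (auto simp: F_def)
    finally have "weighted q k u / q \<le> N * K powr q * C powr (q / p) / q"
      using q by (intro divide_right_mono) auto
    moreover have "0 \<le> en u / p" using en_nonneg p_gt_1 by simp
    ultimately show "- (N * K powr q * C powr (q / p) / q) \<le> J u" unfolding J_def by linarith
  qed
  define c where "c = Inf (J ` F)"
  have "\<exists>u\<in>F. J u < c + eps n" for n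
  proof -
    have "c < c + eps n" using eps by simp
    then show ?thesis unfolding c_def using zeroF below by (subst (asm) cInf_less_iff) auto
  qed
  then obtain w where w: "\<And>n. w n \<in> F" "\<And>n. J (w n) < c + eps n" by metis
  have wd: "w n \<in> dom0" "en (w n) \<le> C" for n using w(1)[of n] sublevel by (auto simp: F_def)
  obtain \<sigma> u l where \<sigma>: "strict_mono (\<sigma> :: nat \<Rightarrow> nat)" "u \<in> dom0"
    "\<And>x. x \<in> S \<Longrightarrow> (\<lambda>n. w (\<sigma> n) x) \<longlonglongrightarrow> u x" "(\<lambda>n. en (w (\<sigma> n))) \<longlonglongrightarrow> l" "en u \<le> l"
    using compactness[of w C] wd by blast
  have "(\<lambda>n. J (w (\<sigma> n))) \<longlonglongrightarrow> l / p - weighted q k u / q"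
    unfolding J_def using q p_gt_1 wd \<sigma>
    by (intro tendsto_intros weighted_tendsto[OF k(1), where M=C]) auto
  moreover have "(\<lambda>n. c + eps (\<sigma> n)) \<longlonglongrightarrow> c + 0"
    using LIMSEQ_subseq_LIMSEQ[OF eps_tendsto_0 \<sigma>(1)] by (intro tendsto_intros) (simp add: o_def)
  ultimately have "l / p - weighted q k u / q \<le> c + 0"
    by (rule LIMSEQ_le) (use w(2) less_imp_le in blast)
  then have Ju: "J u \<le> c" using \<sigma>(5) p_gt_1 by (smt (verit) J_def divide_right_mono)
  have minimal: "J u \<le> J v" if "v \<in> dom0" for v
  proof (cases "J v \<le> 0")
    case True
    then have "c \<le> J v" unfolding c_def using that by (intro cINF_lower below) (auto simp: F_def)
    then show ?thesis using Ju by simp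
  next
    case False
    have "c \<le> J (\<lambda>x. 0)" unfolding c_def by (intro cINF_lower below zeroF)
    then show ?thesis using Ju False zeroF by (simp add: F_def)
  qed
  have "\<exists>x\<in>S. u x \<noteq> 0"
  proof (rule ccontr)
    assume "\<not> ?thesis"
    then have "weighted q k u = 0"
      unfolding weighted_def by (intro integral_eq_zero_AE AE_I2) (auto simp: space_gasket_measure)
    then have J0: "0 \<le> J u" using en_nonneg[of u] p_gt_1 by (simp add: J_def)
    obtain \<phi> where \<phi>: "\<phi> \<in> dom0" "\<And>x. 0 \<le> \<phi> x" "\<not> (AE x in \<mu>. \<phi> x = 1 \<longrightarrow> k x = 0)"
      using function_detecting_weight[OF k(3)] by blast
    define e where "e = en \<phi>"
    define d where "d = weighted q k \<phi>"
    have "d \<noteq> 0"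
    proof
      assume "d = 0"
      then have "AE x in \<mu>. k x * \<bar>\<phi> x\<bar> powr q = 0"
        unfolding d_def weighted_def using q k(2)
        by (subst (asm) integral_nonneg_eq_0_iff_AE) (auto intro!: weighted_integrable[OF k(1) \<phi>(1)] AE_I2
            simp: space_gasket_measure)
      then have "AE x in \<mu>. \<phi> x = 1 \<longrightarrow> k x = 0" by eventually_elim auto
      then show False using \<phi>(3) by blast
    qed
    then have d: "0 < d" using weighted_nonneg[where k=k and s=q and u=\<phi>, OF k(2)] by (simp add: d_def)
    have e: "0 \<le> e" by (simp add: e_def en_nonneg)
    \<comment> \<open>The factor \<open>t\<close> is chosen so that the energy term of \<open>J (t \<phi>)\<close> is at most half the weighted term.\<close>
    define e1 where "e1 = e + 1"
    have e1: "0 < e1" "e / e1 \<le> 1" using e by (simp_all add: e1_def)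
    define t where "t = (d * p / (2 * q * e1)) powr (1 / (p - q))"
    have t: "0 < t" using d e1 p_gt_1 q by (simp add: t_def)
    have "t powr (p - q) = d * p / (2 * q * e1)"
      using d e1 p_gt_1 q by (simp add: t_def powr_powr)
    then have "t powr (p - q) * e / p = d * (e / e1) / (2 * q)"
      using p_gt_1 q e1(1) by (simp add: field_simps)
    also have "\<dots> \<le> d * 1 / (2 * q)"
      using d e1 q by (intro divide_right_mono mult_left_mono) auto
    also have "\<dots> < d / q" using d q by (simp add: field_simps)
    finally have "t powr q * (t powr (p - q) * e / p) < t powr q * (d / q)"
      using t by (intro mult_strict_left_mono) auto
    moreover have "t powr p = t powr q * t powr (p - q)" by (simp flip: powr_add)
    ultimately have "t powr p * e / p - t powr q * d / q < 0" by (simp add: mult.assoc)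
    moreover have "J (\<lambda>x. t * \<phi> x) = t powr p * e / p - t powr q * d / q"
      using t by (simp add: J_def en_scale[OF \<phi>(1)] weighted_scale e_def d_def)
    ultimately show False using minimal[OF scale_in_dom0[OF \<phi>(1)], of t] J0 by simp
  qed
  moreover have "pairing q k u \<phi> \<le> energy_upper Q r A p u \<phi>"
    if \<phi>: "\<phi> \<in> dom0" for \<phi>
  proof -
    let ?D = "\<lambda>n. (weighted q k (\<lambda>x. u x + eps n * \<phi> x) - weighted q k u) / eps n"
    let ?E = "\<lambda>n. (en (\<lambda>x. u x + eps n * \<phi> x) - en u) / eps n"
    have "(\<lambda>n. ?D n / q) \<longlonglongrightarrow> q * pairing q k u \<phi> / q"
      using q by (intro tendsto_divide weighted_deriv(1) k \<sigma> \<phi> tendsto_const) auto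
    moreover have "(\<lambda>n. ?E n / p) \<longlonglongrightarrow> p * energy_upper Q r A p u \<phi> / p"
      using p_gt_1 by (intro tendsto_divide energy_upper_tendsto \<sigma> \<phi> tendsto_const) auto
    moreover have "?D n / q \<le> ?E n / p" for n
    proof -
      have "J u \<le> J (\<lambda>x. u x + eps n * \<phi> x)" by (intro minimal add_in_dom0 \<sigma> \<phi>)
      then have "(weighted q k (\<lambda>x. u x + eps n * \<phi> x) - weighted q k u) / q
          \<le> (en (\<lambda>x. u x + eps n * \<phi> x) - en u) / p"
        by (simp add: J_def diff_divide_distrib)
      from divide_right_mono[OF this, of "eps n"] show ?thesis
        using eps(1)[of n] by (simp add: divide_divide_eq_left mult.commute)
    qed
    ultimately have "q * pairing q k u \<phi> / q \<le> p * energy_upper Q r A p u \<phi> / p"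
      by (intro LIMSEQ_le) auto
    then show ?thesis using q p_gt_1 by simp
  qed
  ultimately show ?thesis using that \<sigma>(2) by blast
qed

subsection \<open>The Nehari set\<close>

text \<open>
  Positive parts instead of absolute values: a minimizer can then be replaced by its positive
  part, and the integrand near a nonnegative function needs to be compared only where the
  function is positive.
\<close>

definition coupling :: "(real ^ 2 \<Rightarrow> real) \<Rightarrow> real \<Rightarrow> real \<Rightarrow> (real ^ 2 \<Rightarrow> real) \<Rightarrow> (real ^ 2 \<Rightarrow> real) \<Rightarrow> real" where
  "coupling h \<alpha> \<beta> u v = (\<integral>x. h x * max 0 (v x) powr \<beta> * max 0 (u x) powr \<alpha> \<partial>\<mu>)"

lemma coupling_commute: "coupling h \<alpha> \<beta> u v = coupling h \<beta> \<alpha> v u"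
  unfolding coupling_def by (simp add: mult_ac)

lemma coupling_eq_pos_weighted:
  "coupling h \<alpha> \<beta> u v = pos_weighted \<alpha> (\<lambda>x. h x * max 0 (v x) powr \<beta>) u"
  by (simp add: coupling_def pos_weighted_def)

lemma coupling_scale:
  assumes "0 < t"
  shows "coupling h \<alpha> \<beta> (\<lambda>x. t * u x) (\<lambda>x. t * v x) = t powr (\<alpha> + \<beta>) * coupling h \<alpha> \<beta> u v"
proof -
  have "max 0 (t * y) = t * max 0 y" for y using assms by (simp add: max_mult_distrib_left)
  note mx = this
  show ?thesis unfolding coupling_def mx using assms
    by (subst integral_mult_right_zero[symmetric], simp only: powr_mult powr_add) (simp add: mult_ac)
qed

text \<open>
  The value of \<open>J\<close> on the Nehari set, with the coupling term eliminated.
\<close>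

definition reduced :: "real \<Rightarrow> real \<Rightarrow> (real ^ 2 \<Rightarrow> real) \<Rightarrow> (real ^ 2 \<Rightarrow> real) \<Rightarrow> (real ^ 2 \<Rightarrow> real) \<Rightarrow> (real ^ 2 \<Rightarrow> real) \<Rightarrow> real" where
  "reduced s q a b u v = (1 / p - 1 / s) * (en u + en v) + (1 / q - 1 / s) * (weighted q a u + weighted q b v)"

text \<open>
  The competitors satisfy the constraint as an inequality, which survives the limit of a
  minimizing sequence, where the energy may drop. The minimizer itself satisfies it as an
  equation.
\<close>

definition nehari_minimizer where
  "nehari_minimizer a b h \<alpha> \<beta> q u v \<longleftrightarrow> u \<in> dom0 \<and> v \<in> dom0 \<and> (\<forall>x. 0 \<le> u x) \<and> (\<forall>x. 0 \<le> v x) \<and>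
     0 < coupling h \<alpha> \<beta> u v \<and> en u + en v + (weighted q a u + weighted q b v) = coupling h \<alpha> \<beta> u v \<and> 0 < en u + en v \<and>
     (\<forall>u'\<in>dom0. \<forall>v'\<in>dom0. 0 < coupling h \<alpha> \<beta> u' v' \<longrightarrow>
        en u' + en v' + (weighted q a u' + weighted q b v') \<le> coupling h \<alpha> \<beta> u' v' \<longrightarrow>
        reduced (\<alpha> + \<beta>) q a b u v \<le> reduced (\<alpha> + \<beta>) q a b u' v')"

lemma nehari_minimizer_commute:
  assumes "nehari_minimizer a b h \<alpha> \<beta> q u v"
  shows "nehari_minimizer b a h \<beta> \<alpha> q v u"
proof -
  have "reduced (\<beta> + \<alpha>) q b a v u = reduced (\<alpha> + \<beta>) q a b u v" for u v
    by (simp add: reduced_def add.commute)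
  moreover have "en v + en u + (weighted q b v + weighted q a u) = en u + en v + (weighted q a u + weighted q b v)" for u v
    by simp
  ultimately show ?thesis
    using assms unfolding nehari_minimizer_def
    by (simp add: coupling_commute[of h \<beta> \<alpha>])
qed

lemma coupling_bound:
  assumes h: "integrable \<mu> h" "\<And>x. x \<in> S \<Longrightarrow> 0 \<le> h x" and exps: "0 < \<alpha>" "0 < \<beta>"
  obtains C where "0 < C" "\<And>u v. u \<in> dom0 \<Longrightarrow> v \<in> dom0 \<Longrightarrow>
    coupling h \<alpha> \<beta> u v \<le> C * (en u + en v) powr ((\<alpha> + \<beta>) / p)"
proof -
  obtain K where K: "K > 0" "\<And>u x. u \<in> dom0 \<Longrightarrow> x \<in> S \<Longrightarrow> \<bar>u x\<bar> \<le> K * en u powr (1 / p)"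
    using sup_bound by blast
  define N where "N = (\<integral>x. h x \<partial>\<mu>)"
  have N: "0 \<le> N" unfolding N_def using h(2) by (intro integral_nonneg_AE AE_I2) (auto simp: space_gasket_measure)
  have "coupling h \<alpha> \<beta> u v \<le> (N * K powr (\<alpha> + \<beta>) + 1) * (en u + en v) powr ((\<alpha> + \<beta>) / p)"
    if uv: "u \<in> dom0" "v \<in> dom0" for u v
  proof -
    note [measurable] = dom0_measurable[OF uv(1)] dom0_measurable[OF uv(2)]
    define m where "m = K * (en u + en v) powr (1 / p)"
    have "K * en u powr (1 / p) \<le> m" "K * en v powr (1 / p) \<le> m"
      unfolding m_def using K(1) en_nonneg p_gt_1 by (auto intro!: mult_left_mono powr_mono2 simp: add_increasing add_increasing2)
    then have bd: "\<bar>u x\<bar> \<le> m" "\<bar>v x\<bar> \<le> m" if "x \<in> S" for x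
      using K(2)[OF uv(1) that] K(2)[OF uv(2) that] by auto
    have "coupling h \<alpha> \<beta> u v = (\<integral>x. h x * (max 0 (v x) powr \<beta> * max 0 (u x) powr \<alpha>) \<partial>\<mu>)"
      by (simp add: coupling_def mult.assoc)
    also have "\<dots> \<le> N * (m powr \<beta> * m powr \<alpha>)"
      unfolding N_def
    proof (rule integral_mult_le[OF h])
      fix x assume "x \<in> S"
      then have "max 0 (v x) \<le> m" "max 0 (u x) \<le> m" using bd[of x] by auto
      then have "max 0 (v x) powr \<beta> * max 0 (u x) powr \<alpha> \<le> m powr \<beta> * m powr \<alpha>"
        using exps by (intro mult_mono powr_mono2) auto
      then show "\<bar>max 0 (v x) powr \<beta> * max 0 (u x) powr \<alpha>\<bar> \<le> m powr \<beta> * m powr \<alpha>" by simp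
    qed measurable
    also have "m powr \<beta> * m powr \<alpha> = K powr (\<alpha> + \<beta>) * (en u + en v) powr ((\<alpha> + \<beta>) / p)"
    proof -
      have "m powr \<beta> * m powr \<alpha> = m powr (\<alpha> + \<beta>)" by (simp add: powr_add mult.commute)
      also have "\<dots> = K powr (\<alpha> + \<beta>) * (en u + en v) powr ((\<alpha> + \<beta>) / p)"
        unfolding m_def using K(1) by (simp add: powr_mult powr_powr)
      finally show ?thesis .
    qed
    also have "N * (K powr (\<alpha> + \<beta>) * (en u + en v) powr ((\<alpha> + \<beta>) / p))
        \<le> (N * K powr (\<alpha> + \<beta>) + 1) * (en u + en v) powr ((\<alpha> + \<beta>) / p)"
      by (simp add: algebra_simps)
    finally show ?thesis .
  qed
  moreover have "0 < N * K powr (\<alpha> + \<beta>) + 1" using N by (simp add: add_nonneg_pos)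
  ultimately show ?thesis using that by blast
qed

lemma coupling_tendsto:
  assumes h: "integrable \<mu> h" and exps: "0 < \<alpha>" "0 < \<beta>"
    and w: "\<And>n. w n \<in> dom0" "\<And>n. z n \<in> dom0" and bd: "\<And>n x. x \<in> S \<Longrightarrow> \<bar>w n x\<bar> \<le> B" "\<And>n x. x \<in> S \<Longrightarrow> \<bar>z n x\<bar> \<le> B"
    and uv: "u \<in> dom0" "v \<in> dom0"
    and lim: "\<And>x. x \<in> S \<Longrightarrow> (\<lambda>n. w n x) \<longlonglongrightarrow> u x" "\<And>x. x \<in> S \<Longrightarrow> (\<lambda>n. z n x) \<longlonglongrightarrow> v x"
  shows "(\<lambda>n. coupling h \<alpha> \<beta> (w n) (z n)) \<longlonglongrightarrow> coupling h \<alpha> \<beta> u v"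
  unfolding coupling_def mult.assoc
proof (rule integral_mult_tendsto[OF h])
  note [measurable] = dom0_measurable[OF uv(1)] dom0_measurable[OF uv(2)] dom0_measurable[OF w(1)] dom0_measurable[OF w(2)]
  show "(\<lambda>x. max 0 (z n x) powr \<beta> * max 0 (w n x) powr \<alpha>) \<in> borel_measurable \<mu>"
    "(\<lambda>x. max 0 (v x) powr \<beta> * max 0 (u x) powr \<alpha>) \<in> borel_measurable \<mu>" for n by measurable
  fix x assume x: "x \<in> S"
  show "(\<lambda>n. max 0 (z n x) powr \<beta> * max 0 (w n x) powr \<alpha>) \<longlonglongrightarrow> max 0 (v x) powr \<beta> * max 0 (u x) powr \<alpha>"
    using exps by (intro tendsto_mult tendsto_powr' tendsto_max tendsto_const lim[OF x]) auto
  show "\<bar>max 0 (z n x) powr \<beta> * max 0 (w n x) powr \<alpha>\<bar> \<le> B powr \<beta> * B powr \<alpha>" for n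
  proof -
    have "max 0 (z n x) \<le> B" "max 0 (w n x) \<le> B" using bd(1)[OF x, of n] bd(2)[OF x, of n] by auto
    then have "max 0 (z n x) powr \<beta> * max 0 (w n x) powr \<alpha> \<le> B powr \<beta> * B powr \<alpha>"
      using exps by (intro mult_mono powr_mono2) auto
    then show ?thesis by simp
  qed
qed

definition weight :: "(real ^ 2 \<Rightarrow> real) \<Rightarrow> bool" where
  "weight k \<longleftrightarrow> integrable \<mu> k \<and> (\<forall>x\<in>S. 0 \<le> k x)"

lemma weight_integrable: "weight k \<Longrightarrow> integrable \<mu> k"
  and weight_nonneg: "weight k \<Longrightarrow> x \<in> S \<Longrightarrow> 0 \<le> k x"
  by (auto simp: weight_def)

lemma weighted_weight_nonneg: "weight k \<Longrightarrow> 0 \<le> weighted s k u"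
  by (intro weighted_nonneg weight_nonneg)

text \<open>
  On the constraint set the coupling is at most a multiple of \<open>E\<^sup>s\<^sup>/\<^sup>p\<close> and at least \<open>E\<close>. Since
  \<open>s > p\<close> this keeps \<open>E\<close> and the coupling away from \<open>0\<close>, so a minimizing sequence cannot converge
  to the trivial pair.
\<close>

lemma nehari_minimizer_exists:
  assumes a: "weight a" and b: "weight b"
    and h: "weight h" "\<not> (AE x in \<mu>. h x = 0)"
    and exps: "0 < \<alpha>" "0 < \<beta>" "1 < q" "q < p" "p < \<alpha> + \<beta>"
  obtains u v where "nehari_minimizer a b h \<alpha> \<beta> q u v"
proof -
  define s where "s = \<alpha> + \<beta>"
  have s: "p < s" "q < s" "0 < s" using exps by (auto simp: s_def)
  define D where "D u v = weighted q a u + weighted q b v" for u v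
  define E where "E u v = en u + en v" for u v
  define B where "B = coupling h \<alpha> \<beta>"
  define I where "I = reduced s q a b"
  define c1 where "c1 = 1 / p - 1 / s"
  define c2 where "c2 = 1 / q - 1 / s"
  have c: "0 < c1" "0 < c2" using s exps p_gt_1 by (auto simp: c1_def c2_def field_simps)
  have I: "I u v = c1 * E u v + c2 * D u v" for u v
    by (simp add: I_def reduced_def c1_def c2_def E_def D_def)
  have D_nonneg: "0 \<le> D u v" for u v 
    using weighted_weight_nonneg[OF a] weighted_weight_nonneg[OF b] by (simp add: D_def)
  have E_nonneg: "0 \<le> E u v" for u v using en_nonneg by (simp add: E_def)
  have scale: "E (\<lambda>x. t * u x) (\<lambda>x. t * v x) = t powr p * E u v"
    "D (\<lambda>x. t * u x) (\<lambda>x. t * v x) = t powr q * D u v"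
    "B (\<lambda>x. t * u x) (\<lambda>x. t * v x) = t powr s * B u v" if "0 < t" "u \<in> dom0" "v \<in> dom0" for t u v
    using that by (simp_all add: E_def D_def B_def s_def en_scale weighted_scale coupling_scale algebra_simps)
  define F where "F = {(u, v). u \<in> dom0 \<and> v \<in> dom0 \<and> 0 < B u v \<and> E u v + D u v \<le> B u v}"
  \<comment> \<open>Since \<open>s\<close> is the largest exponent, every direction with positive coupling enters the set when stretched.\<close>
  have "F \<noteq> {}"
  proof -
    obtain \<phi> where \<phi>: "\<phi> \<in> dom0" "\<And>x. 0 \<le> \<phi> x" "\<not> (AE x in \<mu>. \<phi> x = 1 \<longrightarrow> h x = 0)"
      using function_detecting_weight[OF h(2)] by blast
    have B_eq: "B \<phi> \<phi> = weighted s h \<phi>"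
    proof -
      have eq: "h x * max 0 (\<phi> x) powr \<beta> * max 0 (\<phi> x) powr \<alpha> = h x * \<bar>\<phi> x\<bar> powr s" for x
        using \<phi>(2)[of x] by (simp add: s_def powr_add max_absorb2 mult_ac)
      show ?thesis unfolding B_def coupling_def weighted_def eq ..
    qed
    have "B \<phi> \<phi> \<noteq> 0"
    proof
      assume "B \<phi> \<phi> = 0"
      then have "AE x in \<mu>. h x * \<bar>\<phi> x\<bar> powr s = 0"
        unfolding B_eq weighted_def using s
        by (subst (asm) integral_nonneg_eq_0_iff_AE)
          (auto intro!: weighted_integrable[OF weight_integrable[OF h(1)] \<phi>(1)] AE_I2
            mult_nonneg_nonneg weight_nonneg[OF h(1)] simp: space_gasket_measure)
      then have "AE x in \<mu>. \<phi> x = 1 \<longrightarrow> h x = 0" by eventually_elim auto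
      then show False using \<phi>(3) by blast
    qed
    then have B_pos: "0 < B \<phi> \<phi>" using weighted_weight_nonneg[OF h(1), of s \<phi>] by (simp add: B_eq)
    define t where "t = (1 + (E \<phi> \<phi> + D \<phi> \<phi>) / B \<phi> \<phi>) powr (1 / (s - p))"
    have base: "1 \<le> 1 + (E \<phi> \<phi> + D \<phi> \<phi>) / B \<phi> \<phi>" using B_pos E_nonneg D_nonneg by simp
    have t: "1 \<le> t" unfolding t_def using base s by (intro ge_one_powr_ge_zero) auto
    have tsp: "t powr (s - p) = 1 + (E \<phi> \<phi> + D \<phi> \<phi>) / B \<phi> \<phi>" using base s by (simp add: t_def powr_powr)
    have "t powr p * E \<phi> \<phi> + t powr q * D \<phi> \<phi> \<le> t powr p * E \<phi> \<phi> + t powr p * D \<phi> \<phi>"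
      using t exps D_nonneg by (intro add_left_mono mult_right_mono powr_mono) auto
    also have "\<dots> \<le> t powr p * (t powr (s - p) * B \<phi> \<phi>)"
      unfolding tsp distrib_left[symmetric] using B_pos by (intro mult_left_mono) (auto simp: field_simps)
    also have "\<dots> = t powr s * B \<phi> \<phi>" by (simp flip: powr_add mult.assoc)
    finally have "(\<lambda>x. t * \<phi> x, \<lambda>x. t * \<phi> x) \<in> F"
      using t B_pos \<phi>(1) by (simp add: F_def scale scale_in_dom0)
    then show ?thesis by blast
  qed
  obtain C where C: "0 < C" "\<And>u v. u \<in> dom0 \<Longrightarrow> v \<in> dom0 \<Longrightarrow> B u v \<le> C * E u v powr (s / p)"
  proof -
    obtain C where "0 < C" "\<And>u v. u \<in> dom0 \<Longrightarrow> v \<in> dom0 \<Longrightarrow>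
        coupling h \<alpha> \<beta> u v \<le> C * (en u + en v) powr ((\<alpha> + \<beta>) / p)"
      using coupling_bound[OF weight_integrable[OF h(1)] weight_nonneg[OF h(1)] exps(1,2)] by blast
    then show thesis by (intro that[of C]) (simp_all add: B_def E_def s_def)
  qed
  have E_pos: "0 < E u v" if "u \<in> dom0" "v \<in> dom0" "0 < B u v" for u v
    using C(2)[OF that(1,2)] that(3) E_nonneg[of u v] s p_gt_1 by (cases "E u v = 0") auto
  define \<epsilon> where "\<epsilon> = (1 / C) powr (p / (s - p))"
  have \<epsilon>: "0 < \<epsilon>" using C(1) by (simp add: \<epsilon>_def)
  have lower: "\<epsilon> \<le> B u v" if "(u, v) \<in> F" for u v
  proof -
    have uv: "u \<in> dom0" "v \<in> dom0" "0 < B u v" "E u v + D u v \<le> B u v" using that by (auto simp: F_def)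
    have e: "0 < E u v" by (rule E_pos[OF uv(1-3)])
    have "E u v * 1 \<le> E u v * (C * E u v powr ((s - p) / p))"
    proof -
      have "E u v * 1 \<le> C * E u v powr (s / p)" using C(2)[OF uv(1,2)] uv(4) D_nonneg[of u v] by simp
      also have "E u v powr (s / p) = E u v * E u v powr ((s - p) / p)"
        using e p_gt_1 by (simp add: diff_divide_distrib powr_diff)
      finally show ?thesis by (simp add: mult_ac)
    qed
    then have "1 / C \<le> E u v powr ((s - p) / p)"
      using e C(1) by (simp add: pos_divide_le_eq mult.commute)
    then have "\<epsilon> \<le> (E u v powr ((s - p) / p)) powr (p / (s - p))"
      unfolding \<epsilon>_def using C(1) s p_gt_1 by (intro powr_mono2) auto
    also have "\<dots> = E u v" unfolding powr_powr using e s p_gt_1 by simp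
    also have "\<dots> \<le> B u v" using uv(4) D_nonneg[of u v] by simp
    finally show ?thesis .
  qed
  have below: "bdd_below ((\<lambda>(u, v). I u v) ` F)"
    using c E_nonneg D_nonneg by (intro bdd_belowI2[of _ 0]) (auto simp: I)
  define m where "m = Inf ((\<lambda>(u, v). I u v) ` F)"
  have "\<exists>u v. (u, v) \<in> F \<and> I u v < m + eps n" for n
  proof -
    have "m < m + eps n" using eps by simp
    then show ?thesis unfolding m_def using \<open>F \<noteq> {}\<close> below by (subst (asm) cInf_less_iff) auto
  qed
  then obtain w z where wz: "\<And>n. (w n, z n) \<in> F" "\<And>n. I (w n) (z n) < m + eps n" by metis
  have wz_dom: "w n \<in> dom0" "z n \<in> dom0" and wz_B: "E (w n) (z n) + D (w n) (z n) \<le> B (w n) (z n)" for n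
    using wz(1)[of n] by (auto simp: F_def)
  define M where "M = (m + 1) / c1"
  have E_le: "E (w n) (z n) \<le> M" for n
  proof -
    have "c1 * E (w n) (z n) \<le> m + 1"
      using wz(2)[of n] eps(2)[of n] mult_nonneg_nonneg[OF less_imp_le[OF c(2)] D_nonneg[of "w n" "z n"]]
      by (simp add: I)
    then show ?thesis using c(1) by (simp add: M_def field_simps)
  qed
  have wM: "en (w n) \<le> M" and zM: "en (z n) \<le> M" for n
    using E_le[of n] en_nonneg[of "w n"] en_nonneg[of "z n"] by (auto simp: E_def)
  obtain k1 u l1 where k1: "strict_mono (k1 :: nat \<Rightarrow> nat)" "u \<in> dom0"
    "\<And>x. x \<in> S \<Longrightarrow> (\<lambda>n. w (k1 n) x) \<longlonglongrightarrow> u x" "(\<lambda>n. en (w (k1 n))) \<longlonglongrightarrow> l1" "en u \<le> l1"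
    using compactness[of w M, OF wz_dom(1) wM] by blast
  obtain k2 v l2 where k2: "strict_mono (k2 :: nat \<Rightarrow> nat)" "v \<in> dom0"
    "\<And>x. x \<in> S \<Longrightarrow> (\<lambda>n. z (k1 (k2 n)) x) \<longlonglongrightarrow> v x" "(\<lambda>n. en (z (k1 (k2 n)))) \<longlonglongrightarrow> l2" "en v \<le> l2"
    using compactness[of "\<lambda>n. z (k1 n)" M, OF wz_dom(2) zM] by blast
  define k where "k n = k1 (k2 n)" for n
  have wlim: "(\<lambda>n. w (k n) x) \<longlonglongrightarrow> u x" if "x \<in> S" for x
    using LIMSEQ_subseq_LIMSEQ[OF k1(3)[OF that] k2(1)] by (simp add: o_def k_def)
  have zlim: "(\<lambda>n. z (k n) x) \<longlonglongrightarrow> v x" if "x \<in> S" for x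
    using k2(3)[OF that] by (simp add: k_def)
  have Elim: "(\<lambda>n. E (w (k n)) (z (k n))) \<longlonglongrightarrow> l1 + l2"
    using tendsto_add[OF LIMSEQ_subseq_LIMSEQ[OF k1(4) k2(1)] k2(4)] by (simp add: o_def k_def E_def)
  have Dlim: "(\<lambda>n. D (w (k n)) (z (k n))) \<longlonglongrightarrow> D u v"
    unfolding D_def using exps wM zM wz_dom wlim zlim k1(2) k2(2)
    by (intro tendsto_add weighted_tendsto[where M=M] weight_integrable a b) auto
  obtain K where K: "K > 0" "\<And>u x. u \<in> dom0 \<Longrightarrow> x \<in> S \<Longrightarrow> \<bar>u x\<bar> \<le> K * en u powr (1 / p)"
    using sup_bound by blast
  have sup: "\<bar>f x\<bar> \<le> K * M powr (1 / p)" if "f \<in> dom0" "en f \<le> M" "x \<in> S" for f x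
  proof -
    have "K * en f powr (1 / p) \<le> K * M powr (1 / p)"
      using K(1) that en_nonneg p_gt_1 by (intro mult_left_mono powr_mono2) auto
    then show ?thesis using K(2)[OF that(1,3)] by simp
  qed
  have Blim: "(\<lambda>n. B (w (k n)) (z (k n))) \<longlonglongrightarrow> B u v"
    unfolding B_def
    by (rule coupling_tendsto[OF weight_integrable[OF h(1)] exps(1,2) wz_dom sup[OF wz_dom(1) wM] sup[OF wz_dom(2) zM] k1(2) k2(2) wlim zlim])
  have B_uv: "\<epsilon> \<le> B u v"
    using Blim by (rule LIMSEQ_le_const) (use lower[OF wz(1)] in blast)
  have feasible_uv: "l1 + l2 + D u v \<le> B u v"
    using tendsto_add[OF Elim Dlim] Blim by (rule LIMSEQ_le) (use wz_B in blast)
  have "(\<lambda>n. c1 * E (w (k n)) (z (k n)) + c2 * D (w (k n)) (z (k n))) \<longlonglongrightarrow> c1 * (l1 + l2) + c2 * D u v"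
    by (intro tendsto_intros Elim Dlim)
  moreover have "(\<lambda>n. m + eps (k n)) \<longlonglongrightarrow> m + 0"
    using LIMSEQ_subseq_LIMSEQ[OF LIMSEQ_subseq_LIMSEQ[OF eps_tendsto_0 k1(1)] k2(1)]
    by (intro tendsto_intros) (simp add: o_def k_def)
  ultimately have value_uv: "c1 * (l1 + l2) + c2 * D u v \<le> m + 0"
    by (rule LIMSEQ_le) (use wz(2) less_imp_le in \<open>auto simp: I\<close>)
  \<comment> \<open>Passing to positive parts does not increase the energy or the weighted powers and leaves the coupling unchanged.\<close>
  define u' where "u' x = max 0 (u x)" for x
  define v' where "v' x = max 0 (v x)" for x
  have dom': "u' \<in> dom0" "v' \<in> dom0"
    using max_0_in_dom0(1)[OF k1(2)] max_0_in_dom0(1)[OF k2(2)] by (simp_all add: u'_def[abs_def] v'_def[abs_def])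
  have E': "E u' v' \<le> l1 + l2"
    using max_0_in_dom0(2)[OF k1(2)] max_0_in_dom0(2)[OF k2(2)] k1(5) k2(5)
    by (simp add: E_def u'_def[abs_def] v'_def[abs_def])
  have D': "D u' v' \<le> D u v"
    unfolding D_def u'_def v'_def using exps by (intro add_mono weighted_max_0_le weight_integrable a b k1(2) k2(2))
      (auto intro: weight_nonneg a b)
  have B': "B u' v' = B u v"
    by (simp add: B_def coupling_def u'_def v'_def)
  have BE: "0 < B u' v'" "E u' v' + D u' v' \<le> B u' v'"
    using B_uv \<epsilon> E' D' feasible_uv by (simp_all add: B')
  have F': "(u', v') \<in> F" using dom' BE by (simp add: F_def)
  have e': "0 < E u' v'" by (rule E_pos[OF dom' BE(1)])
  have minimal: "I u' v' \<le> I f g" if "f \<in> dom0" "g \<in> dom0" "0 < B f g" "E f g + D f g \<le> B f g" for f g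
  proof -
    have "I u' v' \<le> c1 * (l1 + l2) + c2 * D u v"
      unfolding I using c E' D' by (intro add_mono mult_left_mono) auto
    also have "\<dots> \<le> m" using value_uv by simp
    also have "m \<le> (\<lambda>(u, v). I u v) (f, g)"
      unfolding m_def using that by (intro cINF_lower below) (simp add: F_def)
    finally show ?thesis by simp
  qed
  \<comment> \<open>A point strictly inside the constraint could be shrunk, which would lower the functional.\<close>
  have "E u' v' + D u' v' = B u' v'"
  proof (rule ccontr)
    assume "\<not> ?thesis"
    then have gap: "0 < B u' v' - E u' v' - D u' v'" using BE(2) by simp
    define \<tau> where "\<tau> n = 1 - eps n / 2" for n
    have \<tau>: "0 < \<tau> n" "\<tau> n < 1" for n using eps[of n] by (auto simp: \<tau>_def)
    have "\<tau> \<longlonglongrightarrow> 1 - 0 / 2" unfolding \<tau>_def by (intro tendsto_intros eps_tendsto_0) simp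
    then have "(\<lambda>n. \<tau> n powr s * B u' v' - \<tau> n powr p * E u' v' - \<tau> n powr q * D u' v')
        \<longlonglongrightarrow> 1 powr s * B u' v' - 1 powr p * E u' v' - 1 powr q * D u' v'"
      by (intro tendsto_intros) auto
    then have "\<forall>\<^sub>F n in sequentially. 0 < \<tau> n powr s * B u' v' - \<tau> n powr p * E u' v' - \<tau> n powr q * D u' v'"
      using gap by (intro order_tendstoD) auto
    then obtain n where n: "0 < \<tau> n powr s * B u' v' - \<tau> n powr p * E u' v' - \<tau> n powr q * D u' v'"
      by (auto simp: eventually_sequentially)
    have "I u' v' \<le> I (\<lambda>x. \<tau> n * u' x) (\<lambda>x. \<tau> n * v' x)"
      using n \<tau>[of n] BE(1) by (intro minimal scale_in_dom0 dom') (simp_all add: scale dom')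
    also have "\<dots> = c1 * (\<tau> n powr p * E u' v') + c2 * (\<tau> n powr q * D u' v')"
      using \<tau>[of n] by (simp add: I scale dom')
    also have "\<dots> < c1 * (1 * E u' v') + c2 * (1 * D u' v')"
    proof (rule add_less_le_mono)
      have lt: "\<tau> n powr p < 1" "\<tau> n powr q < 1"
        using \<tau>[of n] exps p_gt_1 powr_less_mono2[of p "\<tau> n" 1] powr_less_mono2[of q "\<tau> n" 1] by auto
      show "c1 * (\<tau> n powr p * E u' v') < c1 * (1 * E u' v')"
        by (intro mult_strict_left_mono mult_strict_right_mono lt e' c)
      show "c2 * (\<tau> n powr q * D u' v') \<le> c2 * (1 * D u' v')"
        using c lt D_nonneg by (intro mult_left_mono mult_right_mono) auto
    qed
    also have "\<dots> = I u' v'" by (simp add: I)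
    finally show False by simp
  qed
  then have "nehari_minimizer a b h \<alpha> \<beta> q u' v'"
    using dom' BE(1) e' minimal
    by (auto simp: nehari_minimizer_def E_def D_def B_def I_def s_def u'_def v'_def)
  then show ?thesis using that by blast
qed

text \<open>
  The perturbation lemma for the constraint, applied to \<open>(u + \<epsilon> \<phi>, v)\<close> and divided by \<open>\<epsilon>\<close>.
\<close>

lemma nehari_quotient_bound:
  assumes a: "weight a" and b: "weight b"
    and h: "weight h"
    and exps: "0 < \<alpha>" "0 < \<beta>" "1 < q" "q < p" "p < \<alpha> + \<beta>"
    and min: "nehari_minimizer a b h \<alpha> \<beta> q u v" and \<phi>: "\<phi> \<in> dom0"
  defines "k \<equiv> \<lambda>x. h x * max 0 (v x) powr \<beta>"
  obtains X where
    "\<forall>\<^sub>F n in sequentially. (pos_weighted \<alpha> k (\<lambda>x. u x + eps n * \<phi> x) - pos_weighted \<alpha> k u) / eps n \<le> X n"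
    "X \<longlonglongrightarrow> (\<alpha> + \<beta>) * (energy_upper Q r A p u \<phi> + pairing q a u \<phi>)"
proof -
  define s where "s = \<alpha> + \<beta>"
  have s: "p < s" "0 < s" using exps by (auto simp: s_def)
  have uv: "u \<in> dom0" "v \<in> dom0" using min by (auto simp: nehari_minimizer_def)
  define un where "un n = (\<lambda>x. u x + eps n * \<phi> x)" for n
  have un: "un n \<in> dom0" for n unfolding un_def by (intro add_in_dom0 uv \<phi>)
  define e where "e = en u + en v"
  define d where "d = weighted q a u + weighted q b v"
  define c where "c = coupling h \<alpha> \<beta> u v"
  define e' where "e' n = en (un n) + en v" for n
  define d' where "d' n = weighted q a (un n) + weighted q b v" for n
  define c' where "c' n = coupling h \<alpha> \<beta> (un n) v" for n
  have vals: "0 < e" "0 \<le> d" "c = e + d"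
    using min weighted_weight_nonneg[OF a] weighted_weight_nonneg[OF b]
    by (auto simp: nehari_minimizer_def e_def d_def c_def)
  have e_quot: "(\<lambda>n. (e' n - e) / eps n) \<longlonglongrightarrow> p * energy_upper Q r A p u \<phi>"
    using energy_upper_tendsto[OF uv(1) \<phi>] by (simp add: e'_def e_def un_def)
  have d_quot: "(\<lambda>n. (d' n - d) / eps n) \<longlonglongrightarrow> q * pairing q a u \<phi>"
    using weighted_deriv(1)[OF weight_integrable[OF a] uv(1) \<phi> exps(3)] by (simp add: d'_def d_def un_def)
  have recover: "f \<longlonglongrightarrow> l" if "(\<lambda>n. (f n - l) / eps n) \<longlonglongrightarrow> L'" for f :: "nat \<Rightarrow> real" and l L'
  proof -
    have "(\<lambda>n. l + eps n * ((f n - l) / eps n)) \<longlonglongrightarrow> l + 0 * L'"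
      by (intro tendsto_intros that eps_tendsto_0)
    moreover have "l + eps n * ((f n - l) / eps n) = f n" for n using eps(1)[of n] by simp
    ultimately show ?thesis by simp
  qed
  have c_lim: "c' \<longlonglongrightarrow> c"
    unfolding c'_def c_def
  proof -
    obtain R where R: "0 \<le> R" "\<And>x. x \<in> S \<Longrightarrow> \<bar>\<phi> x\<bar> \<le> R"
      "\<And>x. x \<in> S \<Longrightarrow> \<bar>u x\<bar> \<le> R" "\<And>x n. x \<in> S \<Longrightarrow> \<bar>u x + eps n * \<phi> x\<bar> \<le> R"
      using perturbation_bounded[OF uv(1) \<phi>] by blast
    obtain B where B: "0 \<le> B" "\<And>x. x \<in> S \<Longrightarrow> \<bar>v x\<bar> \<le> B" using dom0_bounded[OF uv(2)] by blast
    show "(\<lambda>n. coupling h \<alpha> \<beta> (un n) v) \<longlonglongrightarrow> coupling h \<alpha> \<beta> u v"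
    proof (rule coupling_tendsto[OF weight_integrable[OF h] exps(1,2) un uv(2) _ _ uv])
      show "\<bar>un n x\<bar> \<le> R + B" "\<bar>v x\<bar> \<le> R + B" if "x \<in> S" for n x
        using R(1) R(4)[OF that, of n] B(1) B(2)[OF that] by (auto simp: un_def)
    next
      fix x
      have "(\<lambda>n. u x + eps n * \<phi> x) \<longlonglongrightarrow> u x + 0 * \<phi> x" by (intro tendsto_intros eps_tendsto_0)
      then show "(\<lambda>n. un n x) \<longlonglongrightarrow> u x" by (simp add: un_def)
    qed (rule tendsto_const)
  qed
  have scaled_minimal: "(1 / p - 1 / s) * e + (1 / q - 1 / s) * d
      \<le> (1 / p - 1 / s) * (\<tau> powr p * e' n) + (1 / q - 1 / s) * (\<tau> powr q * d' n)"
    if "0 < \<tau>" "0 < c' n" "\<tau> powr p * e' n + \<tau> powr q * d' n = \<tau> powr s * c' n" for n \<tau>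
  proof -
    let ?f = "\<lambda>x. \<tau> * un n x" and ?g = "\<lambda>x. \<tau> * v x"
    have en': "en ?f + en ?g = \<tau> powr p * e' n"
      using that(1) by (simp add: en_scale un uv e'_def distrib_left)
    have wt': "weighted q a ?f + weighted q b ?g = \<tau> powr q * d' n"
      using that(1) by (simp add: weighted_scale d'_def distrib_left)
    have cp': "coupling h \<alpha> \<beta> ?f ?g = \<tau> powr s * c' n"
      using that(1) by (simp add: coupling_scale c'_def s_def)
    have "reduced s q a b u v \<le> reduced s q a b ?f ?g"
    proof -
      have "0 < coupling h \<alpha> \<beta> ?f ?g" using that(1,2) by (simp add: cp')
      moreover have "en ?f + en ?g + (weighted q a ?f + weighted q b ?g) \<le> coupling h \<alpha> \<beta> ?f ?g"
        unfolding en' wt' cp' using that(3) by simp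
      moreover have "?f \<in> dom0" "?g \<in> dom0" by (intro scale_in_dom0 un uv)+
      ultimately show ?thesis using min unfolding nehari_minimizer_def s_def by simp
    qed
    then show ?thesis unfolding reduced_def en' wt' by (simp add: e_def d_def)
  qed
  obtain T where T: "T \<longlonglongrightarrow> 1" "\<forall>\<^sub>F n in sequentially. (c' n - c) / s
      \<le> T n powr (p - s) * ((e' n - e) / p) + T n powr (q - s) * ((d' n - d) / q)"
    using constrained_perturbation[of q p s e d c e' d' c'] exps(3,4) s(1) vals recover[OF e_quot] recover[OF d_quot]
      c_lim scaled_minimal by (smt (verit))
  define X where "X n = s * (T n powr (p - s) * ((e' n - e) / eps n / p) + T n powr (q - s) * ((d' n - d) / eps n / q))" for n
  have "\<forall>\<^sub>F n in sequentially. (c' n - c) / eps n \<le> X n"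
    using T(2)
  proof eventually_elim
    case (elim n)
    then have "(c' n - c) / s / eps n
        \<le> (T n powr (p - s) * ((e' n - e) / p) + T n powr (q - s) * ((d' n - d) / q)) / eps n"
      using eps(1)[of n] by (intro divide_right_mono) auto
    then have "s * ((c' n - c) / s / eps n)
        \<le> s * ((T n powr (p - s) * ((e' n - e) / p) + T n powr (q - s) * ((d' n - d) / q)) / eps n)"
      using s(2) by (intro mult_left_mono) auto
    then show ?case using s(2) by (simp add: X_def add_divide_distrib mult_ac)
  qed
  then have 1: "\<forall>\<^sub>F n in sequentially. (pos_weighted \<alpha> k (\<lambda>x. u x + eps n * \<phi> x) - pos_weighted \<alpha> k u) / eps n \<le> X n"
    by (simp add: c'_def c_def coupling_eq_pos_weighted k_def un_def)
  have "X \<longlonglongrightarrow> s * (1 powr (p - s) * (p * energy_upper Q r A p u \<phi> / p) +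
      1 powr (q - s) * (q * pairing q a u \<phi> / q))"
    unfolding X_def using exps p_gt_1
    by (intro tendsto_intros T(1) e_quot d_quot) auto
  then have 2: "X \<longlonglongrightarrow> (\<alpha> + \<beta>) * (energy_upper Q r A p u \<phi> + pairing q a u \<phi>)"
    using exps p_gt_1 by (simp add: s_def)
  show ?thesis using that 1 2 by blast
qed

text \<open>
  The bound for the direction \<open>\<bar>\<phi>\<bar>\<close> gives integrability, after which the bound for \<open>\<phi>\<close> itself
  gives the inequality.
\<close>

lemma nehari_euler_inequality:
  assumes a: "weight a" and b: "weight b"
    and h: "weight h"
    and exps: "0 < \<alpha>" "0 < \<beta>" "1 < q" "q < p" "p < \<alpha> + \<beta>"
    and min: "nehari_minimizer a b h \<alpha> \<beta> q u v" and \<phi>: "\<phi> \<in> dom0"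
  shows "integrable \<mu> (\<lambda>x. h x * \<bar>u x\<bar> powr (\<alpha> - 2) * u x * \<bar>v x\<bar> powr \<beta> * \<phi> x)"
    and "\<alpha> / (\<alpha> + \<beta>) * (\<integral>x. h x * \<bar>u x\<bar> powr (\<alpha> - 2) * u x * \<bar>v x\<bar> powr \<beta> * \<phi> x \<partial>\<mu>)
      - pairing q a u \<phi> \<le> energy_upper Q r A p u \<phi>"
proof -
  have uv: "u \<in> dom0" "v \<in> dom0" "\<And>x. 0 \<le> u x" "\<And>x. 0 \<le> v x"
    using min by (auto simp: nehari_minimizer_def)
  note [measurable] = dom0_measurable[OF uv(1)] dom0_measurable[OF uv(2)] dom0_measurable[OF \<phi>]
    borel_measurable_integrable[OF weight_integrable[OF h]]
  define k where "k x = h x * max 0 (v x) powr \<beta>" for x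
  have k: "integrable \<mu> k" "\<And>x. x \<in> S \<Longrightarrow> 0 \<le> k x"
    unfolding k_def using exps
    by (auto intro!: pos_weighted_integrable weight_integrable[OF h] mult_nonneg_nonneg
        weight_nonneg[OF h] uv)
  have k_eq: "h x * \<bar>u x\<bar> powr (\<alpha> - 2) * u x * \<bar>v x\<bar> powr \<beta> * y = k x * \<bar>u x\<bar> powr (\<alpha> - 2) * u x * y" for x y
    using uv(4)[of x] by (simp add: k_def max_absorb2 mult_ac)
  have abs_int: "integrable \<mu> (\<lambda>x. k x * \<bar>u x\<bar> powr (\<alpha> - 2) * u x * \<bar>\<phi> x\<bar>)"
  proof -
    obtain X X' where X: "\<forall>\<^sub>F n in sequentially. (pos_weighted \<alpha> k (\<lambda>x. u x + eps n * \<bar>\<phi> x\<bar>) - pos_weighted \<alpha> k u) / eps n \<le> X n"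
      "X \<longlonglongrightarrow> X'"
      using nehari_quotient_bound[OF a b h exps min abs_in_dom0[OF \<phi>]] unfolding k_def by blast
    have "\<forall>\<^sub>F n in sequentially. X n < X' + 1" using X(2) by (intro order_tendstoD) auto
    with X(1) have "\<forall>\<^sub>F n in sequentially. (pos_weighted \<alpha> k (\<lambda>x. u x + eps n * \<bar>\<phi> x\<bar>) - pos_weighted \<alpha> k u) / eps n \<le> X' + 1"
      by eventually_elim linarith
    then show ?thesis
      by (intro pos_weighted_integrable_deriv[OF k uv(1) abs_in_dom0[OF \<phi>] uv(3) _ exps(1)]) auto
  qed
  have int: "integrable \<mu> (\<lambda>x. k x * \<bar>u x\<bar> powr (\<alpha> - 2) * u x * \<phi> x)"
  proof (rule Bochner_Integration.integrable_bound[OF abs_int])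
    show "(\<lambda>x. k x * \<bar>u x\<bar> powr (\<alpha> - 2) * u x * \<phi> x) \<in> borel_measurable \<mu>"
      unfolding k_def by measurable
  qed (simp add: abs_mult)
  then show "integrable \<mu> (\<lambda>x. h x * \<bar>u x\<bar> powr (\<alpha> - 2) * u x * \<bar>v x\<bar> powr \<beta> * \<phi> x)"
    by (simp only: k_eq)
  obtain X where X: "\<forall>\<^sub>F n in sequentially. (pos_weighted \<alpha> k (\<lambda>x. u x + eps n * \<phi> x) - pos_weighted \<alpha> k u) / eps n \<le> X n"
    "X \<longlonglongrightarrow> (\<alpha> + \<beta>) * (energy_upper Q r A p u \<phi> + pairing q a u \<phi>)"
    using nehari_quotient_bound[OF a b h exps min \<phi>] unfolding k_def by blast
  have "\<alpha> * pairing \<alpha> k u \<phi>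
      \<le> (\<alpha> + \<beta>) * (energy_upper Q r A p u \<phi> + pairing q a u \<phi>)"
    by (rule pos_weighted_deriv_le[OF k uv(1) \<phi> uv(3) exps(1) abs_int X])
  then show "\<alpha> / (\<alpha> + \<beta>) * (\<integral>x. h x * \<bar>u x\<bar> powr (\<alpha> - 2) * u x * \<bar>v x\<bar> powr \<beta> * \<phi> x \<partial>\<mu>)
      - pairing q a u \<phi> \<le> energy_upper Q r A p u \<phi>"
    unfolding k_eq using exps by (simp add: field_simps)
qed

section \<open>Weak solutions\<close>

lemma weak_solutionI:
  fixes a b h u v :: "real ^ 2 \<Rightarrow> real" and q \<alpha> \<beta> lam gam :: real
  defines "f1 \<equiv> \<lambda>\<phi> x. lam * a x * \<bar>u x\<bar> powr (q - 2) * u x * \<phi> x"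
    and "f2 \<equiv> \<lambda>\<phi> x. h x * \<bar>u x\<bar> powr (\<alpha> - 2) * u x * \<bar>v x\<bar> powr \<beta> * \<phi> x"
    and "f3 \<equiv> \<lambda>\<phi> x. gam * b x * \<bar>v x\<bar> powr (q - 2) * v x * \<phi> x"
    and "f4 \<equiv> \<lambda>\<phi> x. h x * \<bar>u x\<bar> powr \<alpha> * \<bar>v x\<bar> powr (\<beta> - 2) * v x * \<phi> x"
  assumes dom: "u \<in> dom0" "v \<in> dom0"
    and int: "\<And>\<phi>. \<phi> \<in> dom0 \<Longrightarrow> integrable \<mu> (f1 \<phi>)" "\<And>\<phi>. \<phi> \<in> dom0 \<Longrightarrow> integrable \<mu> (f2 \<phi>)"
      "\<And>\<phi>. \<phi> \<in> dom0 \<Longrightarrow> integrable \<mu> (f3 \<phi>)" "\<And>\<phi>. \<phi> \<in> dom0 \<Longrightarrow> integrable \<mu> (f4 \<phi>)"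
    and u: "\<And>\<phi>. \<phi> \<in> dom0 \<Longrightarrow>
      (\<integral>x. f1 \<phi> x \<partial>\<mu>) + \<alpha> / (\<alpha> + \<beta>) * (\<integral>x. f2 \<phi> x \<partial>\<mu>) \<le> energy_upper Q r A p u \<phi>"
    and v: "\<And>\<phi>. \<phi> \<in> dom0 \<Longrightarrow>
      (\<integral>x. f3 \<phi> x \<partial>\<mu>) + \<beta> / (\<alpha> + \<beta>) * (\<integral>x. f4 \<phi> x \<partial>\<mu>) \<le> energy_upper Q r A p v \<phi>"
  shows "weak_solution Q r A p q \<alpha> \<beta> a b h lam gam u v"
proof -
  have "(\<integral>x. f1 \<phi>1 x \<partial>\<mu>) + \<alpha> / (\<alpha> + \<beta>) * (\<integral>x. f2 \<phi>1 x \<partial>\<mu>) +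
        (\<integral>x. f3 \<phi>2 x \<partial>\<mu>) + \<beta> / (\<alpha> + \<beta>) * (\<integral>x. f4 \<phi>2 x \<partial>\<mu>)
      \<in> energy_form Q r A p u \<phi>1 + energy_form Q r A p v \<phi>2"
    if \<phi>: "\<phi>1 \<in> dom0" "\<phi>2 \<in> dom0" for \<phi>1 \<phi>2
  proof -
    have "(\<integral>x. f1 \<phi>1 x \<partial>\<mu>) + \<alpha> / (\<alpha> + \<beta>) * (\<integral>x. f2 \<phi>1 x \<partial>\<mu>) \<in> energy_form Q r A p u \<phi>1"
      by (rule energy_formI[OF dom(1) \<phi>(1) u]) (simp_all add: f1_def f2_def)
    moreover have "(\<integral>x. f3 \<phi>2 x \<partial>\<mu>) + \<beta> / (\<alpha> + \<beta>) * (\<integral>x. f4 \<phi>2 x \<partial>\<mu>) \<in> energy_form Q r A p v \<phi>2"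
      by (rule energy_formI[OF dom(2) \<phi>(2) v]) (simp_all add: f3_def f4_def)
    ultimately show ?thesis using set_plus_intro by (fastforce simp: add.assoc)
  qed
  then show ?thesis
    using dom int unfolding weak_solution_def Let_def f1_def f2_def f3_def f4_def by simp
qed

lemma weak_solution_minus:
  assumes "weak_solution Q r A p q \<alpha> \<beta> a b h lam gam u v"
  shows "weak_solution Q r A p q \<alpha> \<beta> a b h lam gam (\<lambda>x. - u x) (\<lambda>x. - v x)"
proof -
  have form_minus: "energy_form Q r A p (\<lambda>x. - w x) \<phi> = energy_form Q r A p w (\<lambda>x. - \<phi> x)" for w \<phi>
  proof -
    have "energy Q r A (\<lambda>x. - w x + t * \<phi> x) = energy Q r A (\<lambda>x. w x + t * - \<phi> x)" for t
    proof -
      have "L m (\<lambda>x. - w x + t * \<phi> x) = L m (\<lambda>x. w x + t * - \<phi> x)" for m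
        using level_energy_scale[of m "-1" "\<lambda>x. w x + t * - \<phi> x"] by simp
      then show ?thesis by (simp add: energy_def)
    qed
    then show ?thesis by (simp add: energy_form_def energy_upper_def energy_lower_def)
  qed
  have minus: "(\<lambda>x. - w x) \<in> dom0" if "w \<in> dom0" for w
    using scale_in_dom0[OF that, of "-1"] by simp
  have dom: "u \<in> dom0" "v \<in> dom0" using assms by (auto simp: weak_solution_def)
  show ?thesis
    unfolding weak_solution_def
  proof (intro conjI ballI minus dom)
    fix \<phi>1 \<phi>2 assume "\<phi>1 \<in> dom0" "\<phi>2 \<in> dom0"
    then have m: "(\<lambda>x. - \<phi>1 x) \<in> dom0" "(\<lambda>x. - \<phi>2 x) \<in> dom0" by (auto intro: minus)
    note solves = assms[unfolded weak_solution_def Let_def, THEN conjunct2, THEN conjunct2,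
        THEN bspec[OF _ m(1)], THEN bspec[OF _ m(2)]]
    from solves show "let \<mu> = \<mu>;
            f1 = (\<lambda>x. lam * a x * \<bar>- u x\<bar> powr (q - 2) * - u x * \<phi>1 x);
            f2 = (\<lambda>x. h x * \<bar>- u x\<bar> powr (\<alpha> - 2) * - u x * \<bar>- v x\<bar> powr \<beta> * \<phi>1 x);
            f3 = (\<lambda>x. gam * b x * \<bar>- v x\<bar> powr (q - 2) * - v x * \<phi>2 x);
            f4 = (\<lambda>x. h x * \<bar>- u x\<bar> powr \<alpha> * \<bar>- v x\<bar> powr (\<beta> - 2) * - v x * \<phi>2 x)
        in integrable \<mu> f1 \<and> integrable \<mu> f2 \<and> integrable \<mu> f3 \<and> integrable \<mu> f4 \<and>
           (\<integral>x. f1 x \<partial>\<mu>) + \<alpha> / (\<alpha> + \<beta>) * (\<integral>x. f2 x \<partial>\<mu>) +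
           (\<integral>x. f3 x \<partial>\<mu>) + \<beta> / (\<alpha> + \<beta>) * (\<integral>x. f4 x \<partial>\<mu>)
             \<in> energy_form Q r A p (\<lambda>x. - u x) \<phi>1 + energy_form Q r A p (\<lambda>x. - v x) \<phi>2"
      unfolding Let_def by (simp add: form_minus)
  qed
qed

lemma energy_upper_zero: "\<phi> \<in> dom0 \<Longrightarrow> 0 \<le> energy_upper Q r A p (\<lambda>x. 0) \<phi>"
proof -
  assume \<phi>: "\<phi> \<in> dom0"
  have "0 \<le> p * energy_upper Q r A p (\<lambda>x. 0) \<phi>"
    by (rule LIMSEQ_le_const[OF energy_upper_tendsto[OF zero_in_dom0 \<phi>]])
      (use en_nonneg eps(1) in \<open>auto simp: en_zero less_imp_le\<close>)
  then show ?thesis using p_gt_1 by (simp add: zero_le_mult_iff)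
qed

text \<open>
  Both coupling terms vanish when one component is zero, also for exponents below \<open>2\<close>, because
  powers of \<open>0\<close> are \<open>0\<close>.
\<close>

lemma semitrivial_solutions:
  assumes a: "weight a" "\<not> (AE x in \<mu>. a x = 0)"
    and lam: "0 < lam" and exps: "0 < \<alpha>" "0 < \<beta>" "1 < q" "q < p"
  obtains u where "\<exists>x\<in>S. u x \<noteq> 0"
    "\<And>b h gam. weak_solution Q r A p q \<alpha> \<beta> a b h lam gam u (\<lambda>x. 0)"
    "\<And>b h gam. weak_solution Q r A p q \<beta> \<alpha> b a h gam lam (\<lambda>x. 0) u"
proof -
  have AE: "\<not> (AE x in \<mu>. lam * a x = 0)" using a(2) lam by simp
  have int_a: "integrable \<mu> (\<lambda>x. lam * a x)" using weight_integrable[OF a(1)] by simp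
  have nonneg: "0 \<le> lam * a x" if "x \<in> S" for x using weight_nonneg[OF a(1) that] lam by simp
  obtain u where u: "u \<in> dom0" "\<exists>x\<in>S. u x \<noteq> 0"
    "\<And>\<phi>. \<phi> \<in> dom0 \<Longrightarrow> pairing q (\<lambda>x. lam * a x) u \<phi> \<le> energy_upper Q r A p u \<phi>"
    using semitrivial_minimizer[OF int_a nonneg AE exps(3,4)] by blast
  have int: "integrable \<mu> (\<lambda>x. lam * a x * \<bar>u x\<bar> powr (q - 2) * u x * \<phi> x)" if "\<phi> \<in> dom0" for \<phi>
    by (rule weighted_deriv(2)[OF int_a u(1) that exps(3)])
  show ?thesis
  proof (rule that[OF u(2)])
    show "weak_solution Q r A p q \<alpha> \<beta> a b h lam gam u (\<lambda>x. 0)" for b h gam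
      by (rule weak_solutionI) (use u int in \<open>simp_all add: zero_in_dom0 energy_upper_zero\<close>)
    show "weak_solution Q r A p q \<beta> \<alpha> b a h gam lam (\<lambda>x. 0) u" for b h gam
      by (rule weak_solutionI) (use u int in \<open>simp_all add: zero_in_dom0 energy_upper_zero\<close>)
  qed
qed

text \<open>
  Under the hypotheses on the signs, \<open>lam a\<close> and \<open>gam b\<close> are almost everywhere the negatives of
  nonnegative weights.
\<close>

lemma nehari_solution:
  assumes a: "weight a" and b: "weight b"
    and h: "weight h" "\<not> (AE x in \<mu>. h x = 0)"
    and exps: "0 < \<alpha>" "0 < \<beta>" "1 < q" "q < p" "p < \<alpha> + \<beta>"
    and lam: "lam \<le> 0 \<or> (AE x in \<mu>. a x = 0)" and gam: "gam \<le> 0 \<or> (AE x in \<mu>. b x = 0)"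
  obtains u v where "weak_solution Q r A p q \<alpha> \<beta> a b h lam gam u v" "nontrivial_pair Q u v"
proof -
  define a' where "a' x = max 0 (- lam) * a x" for x
  define b' where "b' x = max 0 (- gam) * b x" for x
  have a': "weight a'" using a by (auto simp: a'_def[abs_def] weight_def)
  have b': "weight b'" using b by (auto simp: b'_def[abs_def] weight_def)
  have AE_a: "AE x in \<mu>. lam * a x = - a' x" using lam by (auto simp: a'_def)
  have AE_b: "AE x in \<mu>. gam * b x = - b' x" using gam by (auto simp: b'_def)
  obtain u v where min: "nehari_minimizer a' b' h \<alpha> \<beta> q u v"
    using nehari_minimizer_exists[OF a' b' h exps] by blast
  have uv: "u \<in> dom0" "v \<in> dom0" using min by (auto simp: nehari_minimizer_def)
  have exps': "p < \<beta> + \<alpha>" using exps by simp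
  note eu = nehari_euler_inequality[OF a' b' h(1) exps min]
  note ev = nehari_euler_inequality[OF b' a' h(1) exps(2,1,3,4) exps' nehari_minimizer_commute[OF min]]
  have swap: "h x * \<bar>u x\<bar> powr \<alpha> * \<bar>v x\<bar> powr (\<beta> - 2) * v x * y = h x * \<bar>v x\<bar> powr (\<beta> - 2) * v x * \<bar>u x\<bar> powr \<alpha> * y" for x y
    by (simp add: mult_ac)
  have lower_order: "pairing q (\<lambda>x. \<kappa> * k x) w \<phi> = - pairing q k' w \<phi>"
    "integrable \<mu> (\<lambda>x. \<kappa> * k x * \<bar>w x\<bar> powr (q - 2) * w x * \<phi> x)"
    if k: "weight k" "AE x in \<mu>. \<kappa> * k x = - k' x" "weight k'" and dom: "w \<in> dom0" "\<phi> \<in> dom0" for \<kappa> k k' w \<phi>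
  proof -
    note [measurable] = dom0_measurable[OF dom(1)] dom0_measurable[OF dom(2)]
      borel_measurable_integrable[OF weight_integrable[OF k(1)]]
      borel_measurable_integrable[OF weight_integrable[OF k(3)]]
    have "pairing q (\<lambda>x. \<kappa> * k x) w \<phi> = (\<integral>x. - (k' x * \<bar>w x\<bar> powr (q - 2) * w x * \<phi> x) \<partial>\<mu>)"
    proof (rule integral_cong_AE)
      show "AE x in \<mu>. \<kappa> * k x * \<bar>w x\<bar> powr (q - 2) * w x * \<phi> x = - (k' x * \<bar>w x\<bar> powr (q - 2) * w x * \<phi> x)"
        using k(2) by eventually_elim simp
    qed measurable
    then show "pairing q (\<lambda>x. \<kappa> * k x) w \<phi> = - pairing q k' w \<phi>"
      by simp
    show "integrable \<mu> (\<lambda>x. \<kappa> * k x * \<bar>w x\<bar> powr (q - 2) * w x * \<phi> x)"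
      using weight_integrable[OF k(1)] by (intro weighted_deriv(2) dom exps) simp
  qed
  have "weak_solution Q r A p q \<alpha> \<beta> a b h lam gam u v"
  proof (rule weak_solutionI[OF uv])
    fix \<phi> assume \<phi>: "\<phi> \<in> dom0"
    show "integrable \<mu> (\<lambda>x. lam * a x * \<bar>u x\<bar> powr (q - 2) * u x * \<phi> x)"
      by (rule lower_order(2)[OF a AE_a a' uv(1) \<phi>])
    show "integrable \<mu> (\<lambda>x. gam * b x * \<bar>v x\<bar> powr (q - 2) * v x * \<phi> x)"
      by (rule lower_order(2)[OF b AE_b b' uv(2) \<phi>])
    show "integrable \<mu> (\<lambda>x. h x * \<bar>u x\<bar> powr (\<alpha> - 2) * u x * \<bar>v x\<bar> powr \<beta> * \<phi> x)"
      by (rule eu(1)[OF \<phi>])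
    show "integrable \<mu> (\<lambda>x. h x * \<bar>u x\<bar> powr \<alpha> * \<bar>v x\<bar> powr (\<beta> - 2) * v x * \<phi> x)"
      unfolding swap by (rule ev(1)[OF \<phi>])
    show "pairing q (\<lambda>x. lam * a x) u \<phi> +
        \<alpha> / (\<alpha> + \<beta>) * (\<integral>x. h x * \<bar>u x\<bar> powr (\<alpha> - 2) * u x * \<bar>v x\<bar> powr \<beta> * \<phi> x \<partial>\<mu>) \<le> energy_upper Q r A p u \<phi>"
      using eu(2)[OF \<phi>] by (simp add: lower_order(1)[OF a AE_a a' uv(1) \<phi>])
    show "pairing q (\<lambda>x. gam * b x) v \<phi> +
        \<beta> / (\<alpha> + \<beta>) * (\<integral>x. h x * \<bar>u x\<bar> powr \<alpha> * \<bar>v x\<bar> powr (\<beta> - 2) * v x * \<phi> x \<partial>\<mu>) \<le> energy_upper Q r A p v \<phi>"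
      unfolding swap using ev(2)[OF \<phi>]
      by (simp add: lower_order(1)[OF b AE_b b' uv(2) \<phi>] add.commute[of \<beta> \<alpha>])
  qed
  moreover have "nontrivial_pair Q u v"
  proof (rule ccontr)
    assume "\<not> ?thesis"
    then have "coupling h \<alpha> \<beta> u v = 0"
      unfolding coupling_def
      by (intro integral_eq_zero_AE AE_I2) (auto simp: nontrivial_pair_def space_gasket_measure)
    then show False using min by (simp add: nehari_minimizer_def)
  qed
  ultimately show ?thesis using that by blast
qed

lemma nontrivial_solution_exists:
  assumes a: "weight a" and b: "weight b"
    and h: "weight h" "\<not> (AE x in \<mu>. h x = 0)"
    and exps: "0 < \<alpha>" "0 < \<beta>" "1 < q" "q < p" "p < \<alpha> + \<beta>"
  obtains u v where "weak_solution Q r A p q \<alpha> \<beta> a b h lam gam u v" "nontrivial_pair Q u v"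
proof -
  consider (semitrivial1) "0 < lam" "\<not> (AE x in \<mu>. a x = 0)"
    | (semitrivial2) "0 < gam" "\<not> (AE x in \<mu>. b x = 0)"
    | (nehari) "lam \<le> 0 \<or> (AE x in \<mu>. a x = 0)" "gam \<le> 0 \<or> (AE x in \<mu>. b x = 0)"
    unfolding not_less[symmetric] by satx
  then show ?thesis
  proof cases
    case semitrivial1
    show ?thesis
    proof (rule semitrivial_solutions[OF a semitrivial1(2,1) exps(1-4)])
      fix u
      assume nonzero: "\<exists>x\<in>S. u x \<noteq> 0"
        and solution: "\<And>b h gam. weak_solution Q r A p q \<alpha> \<beta> a b h lam gam u (\<lambda>x. 0)"
      show ?thesis by (rule that[OF solution]) (use nonzero in \<open>simp add: nontrivial_pair_def\<close>)
    qed
  next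
    case semitrivial2
    show ?thesis
    proof (rule semitrivial_solutions[OF b semitrivial2(2,1) exps(2,1,3,4)])
      fix v
      assume nonzero: "\<exists>x\<in>S. v x \<noteq> 0"
        and solution: "\<And>a h lam. weak_solution Q r A p q \<alpha> \<beta> a b h lam gam (\<lambda>x. 0) v"
      show ?thesis by (rule that[OF solution]) (use nonzero in \<open>simp add: nontrivial_pair_def\<close>)
    qed
  next
    case nehari
    show ?thesis by (rule nehari_solution[OF a b h exps nehari]) (rule that)
  qed
qed

end

theorem theorem2p4:
  fixes Q :: "3 \<Rightarrow> real ^ 2" and A :: "real ^ 3 \<Rightarrow> real"
    and r p q \<alpha> \<beta> :: real and a b h :: "real ^ 2 \<Rightarrow> real"
  assumes "equidistant Q"
    and "0 < p" "0 < q" "0 < \<alpha>" "0 < \<beta>"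
    and "1 < q" "q < p" "p < \<alpha> + \<beta>"
    and "p_form p A" and "0 < r" "r < 1" and "renormalizes r A"
    and "integrable (gasket_measure Q) a" "integrable (gasket_measure Q) b"
      "integrable (gasket_measure Q) h"
    and "\<forall>x \<in> gasket Q. a x \<ge> 0" "\<forall>x \<in> gasket Q. b x \<ge> 0" "\<forall>x \<in> gasket Q. h x \<ge> 0"
    and "\<exists>x \<in> gasket Q. a x \<noteq> 0" "\<exists>x \<in> gasket Q. b x \<noteq> 0" "\<exists>x \<in> gasket Q. h x \<noteq> 0"
    and "(\<integral>x. \<bar>h x\<bar> \<partial>gasket_measure Q) > 0"
  shows "\<exists>\<kappa>0 > 0. \<forall>lam gam :: real.
    \<bar>lam\<bar> * (\<integral>x. \<bar>a x\<bar> \<partial>gasket_measure Q) + \<bar>gam\<bar> * (\<integral>x. \<bar>b x\<bar> \<partial>gasket_measure Q) < \<kappa>0 \<longrightarrow>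
    (\<exists>u v u' v'.
       weak_solution Q r A p q \<alpha> \<beta> a b h lam gam u v \<and> nontrivial_pair Q u v \<and>
       weak_solution Q r A p q \<alpha> \<beta> a b h lam gam u' v' \<and> nontrivial_pair Q u' v' \<and>
       distinct_pairs Q u v u' v')"
proof -
  interpret gasket_form Q A r p
    using assms by unfold_locales auto
  have h: "\<not> (AE x in gasket_measure Q. h x = 0)"
  proof
    assume "AE x in gasket_measure Q. h x = 0"
    then have "(\<integral>x. \<bar>h x\<bar> \<partial>gasket_measure Q) = 0" by (intro integral_eq_zero_AE) auto
    then show False using assms(22) by simp
  qed
  have "\<exists>u v u' v'.
       weak_solution Q r A p q \<alpha> \<beta> a b h lam gam u v \<and> nontrivial_pair Q u v \<and>
       weak_solution Q r A p q \<alpha> \<beta> a b h lam gam u' v' \<and> nontrivial_pair Q u' v' \<and>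
       distinct_pairs Q u v u' v'" for lam gam
  proof -
    obtain u v where uv: "weak_solution Q r A p q \<alpha> \<beta> a b h lam gam u v" "nontrivial_pair Q u v"
    proof (rule nontrivial_solution_exists[of a b h \<alpha> \<beta> q lam gam])
      show "weight a" "weight b" "weight h" using assms(13-18) by (simp_all add: weight_def)
    qed (use h assms(4-8) in simp_all)
    have "weak_solution Q r A p q \<alpha> \<beta> a b h lam gam (\<lambda>x. - u x) (\<lambda>x. - v x)"
      by (rule weak_solution_minus[OF uv(1)])
    moreover have "nontrivial_pair Q (\<lambda>x. - u x) (\<lambda>x. - v x)" "distinct_pairs Q u v (\<lambda>x. - u x) (\<lambda>x. - v x)"
      using uv(2) by (auto simp: nontrivial_pair_def distinct_pairs_def)
    ultimately show ?thesis using uv by blast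
  qed
  then show ?thesis by (intro exI[of _ 1]) simp
qed

end
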